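(* Let $W\in C^{1}(\mathbb{R})$ satisfy: (W-i) there is $\eta>0$ such that $W(s)\geq \eta s^{2}$ for $|s|\leq 1$ and $W(s)\geq \eta$ for $|s|\geq 1$; (W-ii) $W''(0)$ exists and $W''(0)=1$; (W-iii) there are $M>0$ and $\alpha\in[0,2)$ such that $W(s)\leq M|s|^{\alpha}$ for all $s\geq 0$. Consider the nonlinear beam equation $\partial_t^2 u+\partial_x^4 u+W'(u)=0$, written as the Hamiltonian system $\partial_t u=v$, $\partial_t v=-\partial_x^4 u-W'(u)$ on the phase space $X=H^{2}(\mathbb{R})\times L^{2}(\mathbb{R})$. Then there exists an open interval $I\subset\mathbb{R}$ such that for every $\delta\in I$ there is a hylomorphic soliton $\mathbf{u}_{\delta}\in X$ for this dynamical system. Moreover, if $\delta_1\neq\delta_2$, then $\mathbf{u}_{\delta_1}\neq g_\tau\mathbf{u}_{\delta_2}$ for every $\tau\in\mathbb{R}$.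
   Context: Points of $X$ are $\mathbf{u}=(u,v)$, with norm $\|\mathbf{u}\|^2=\int_{\mathbb{R}}(v^2+u_{xx}^2+u^2)\,dx$. The system is regarded (as in the paper) as a dynamical system $(X,\gamma)$, $\gamma_t$ being the time-evolution map, with the two first integrals energy $E(\mathbf{u})=\frac12\int (v^2+u_{xx}^2)\,dx+\int W(u)\,dx$ and momentum $C(\mathbf{u})=-\int v\,u_x\,dx$. For $\tau\in\mathbb{R}$, $(g_\tau\mathbf{u})(x)=\mathbf{u}(x-\tau)$; $G=\{g_\tau\}$. A set $\Gamma\subset X$ is invariant if $\gamma_t\Gamma\subset\Gamma$ for all $t\in\mathbb{R}$; an invariant set $\Gamma$ is stable if for every $\varepsilon>0$ there is $\delta'>0$ such that $d(\mathbf{u},\Gamma)\leq\delta'$ implies $d(\gamma_t\mathbf{u},\Gamma)\leq\varepsilon$ for all $t\geq0$; a closed $G$-invariant set $\Gamma$ is $G$-compact if for every sequence $\mathbf{u}_n\in\Gamma$ there are $\tau_n$ with $g_{\tau_n}\mathbf{u}_n$ having a convergent subsequence. A state $\mathbf{u}$ is a solitary wave if $\gamma_t\mathbf{u}(x)=\mathbf{u}(x-\xi(t))$ for some function $\xi(t)$; it is a soliton if there is an invariant set $\Gamma$ with $\gamma_t\mathbf{u}\in\Gamma$ for all $t$, $\Gamma$ stable and $\Gamma$ $G$-compact. A soliton $\mathbf{u}_0$ is hylomorphic if $\Gamma$ can be taken to be $\{\mathbf{u}\in X: E(\mathbf{u})=e_0,\ C(\mathbf{u})=p_0\}$ where $p_0\in\mathbb{R}$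 and $e_0=\min\{E(\mathbf{u}): C(\mathbf{u})=p_0\}$. *)

theory Defs
  imports "HOL-Analysis.Analysis"
begin

text \<open>States of the beam equation: pairs (u,v) of real functions on the line,
  identified up to almost-everywhere equality (see Xeq).\<close>
type_synonym state = "(real \<Rightarrow> real) \<times> (real \<Rightarrow> real)"

definition test_fun :: "(real \<Rightarrow> real) \<Rightarrow> bool" where
  "test_fun \<phi> \<longleftrightarrow> (\<forall>k x. ((deriv ^^ k) \<phi>) differentiable (at x)) \<and> bounded {x. \<phi> x \<noteq> 0}"

definition L2 :: "(real \<Rightarrow> real) \<Rightarrow> bool" where
  "L2 f \<longleftrightarrow> f \<in> borel_measurable lborel \<and> integrable lborel (\<lambda>x. (f x)\<^sup>2)"

definition weak_deriv :: "(real \<Rightarrow> real) \<Rightarrow> (real \<Rightarrow> real) \<Rightarrow> bool" where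
  "weak_deriv u w \<longleftrightarrow>
     (\<forall>K. compact K \<longrightarrow> set_integrable lborel K u \<and> set_integrable lborel K w) \<and>
     (\<forall>\<phi>. test_fun \<phi> \<longrightarrow>
        (LINT x|lborel. u x * deriv \<phi> x) = - (LINT x|lborel. w x * \<phi> x))"

definition H2 :: "(real \<Rightarrow> real) \<Rightarrow> bool" where
  "H2 u \<longleftrightarrow> L2 u \<and> (\<exists>u1 u2. L2 u1 \<and> L2 u2 \<and> weak_deriv u u1 \<and> weak_deriv u1 u2)"

definition ux :: "(real \<Rightarrow> real) \<Rightarrow> (real \<Rightarrow> real)" where
  "ux u = (SOME u1. L2 u1 \<and> weak_deriv u u1 \<and> (\<exists>u2. L2 u2 \<and> weak_deriv u1 u2))"

definition uxx :: "(real \<Rightarrow> real) \<Rightarrow> (real \<Rightarrow> real)" where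
  "uxx u = (SOME u2. L2 u2 \<and> weak_deriv (ux u) u2)"

definition X :: "state set" where
  "X = {p. H2 (fst p) \<and> L2 (snd p)}"

definition Xeq :: "state \<Rightarrow> state \<Rightarrow> bool" where
  "Xeq p q \<longleftrightarrow> (AE x in lborel. fst p x = fst q x \<and> snd p x = snd q x)"

definition Xnorm :: "state \<Rightarrow> real" where
  "Xnorm p = sqrt (LINT x|lborel. (snd p x)\<^sup>2 + (uxx (fst p) x)\<^sup>2 + (fst p x)\<^sup>2)"

definition Xdist :: "state \<Rightarrow> state \<Rightarrow> real" where
  "Xdist p q = Xnorm (\<lambda>x. fst p x - fst q x, \<lambda>x. snd p x - snd q x)"

definition Xdist_set :: "state \<Rightarrow> state set \<Rightarrow> real" where
  "Xdist_set p \<Gamma> = Inf (Xdist p ` \<Gamma>)"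

definition energy :: "(real \<Rightarrow> real) \<Rightarrow> state \<Rightarrow> real" where
  "energy W p = (1/2) * (LINT x|lborel. (snd p x)\<^sup>2 + (uxx (fst p) x)\<^sup>2)
                + (LINT x|lborel. W (fst p x))"

definition momentum :: "state \<Rightarrow> real" where
  "momentum p = - (LINT x|lborel. snd p x * ux (fst p) x)"

definition shift :: "real \<Rightarrow> state \<Rightarrow> state" where
  "shift \<tau> p = (\<lambda>x. fst p (x - \<tau>), \<lambda>x. snd p (x - \<tau>))"

text \<open>gamma is the time-evolution map of the beam equation u_tt + u_xxxx + W'(u) = 0,
  written as u_t = v, v_t = -u_xxxx - W'(u), on X (weak formulation, continuous in X),
  a group of maps on X compatible with a.e. equality, with energy and momentum as
  first integrals.\<close>
definition beam_dyn_system :: "(real \<Rightarrow> real) \<Rightarrow> (real \<Rightarrow> state \<Rightarrow> state) \<Rightarrow> bool" where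
  "beam_dyn_system W \<gamma> \<longleftrightarrow>
     (\<forall>t. \<forall>p\<in>X. \<gamma> t p \<in> X) \<and>
     (\<forall>t p q. p \<in> X \<longrightarrow> q \<in> X \<longrightarrow> Xeq p q \<longrightarrow> Xeq (\<gamma> t p) (\<gamma> t q)) \<and>
     (\<forall>p\<in>X. Xeq (\<gamma> 0 p) p) \<and>
     (\<forall>t s. \<forall>p\<in>X. Xeq (\<gamma> (t + s) p) (\<gamma> t (\<gamma> s p))) \<and>
     (\<forall>p\<in>X. \<forall>t0. ((\<lambda>t. Xdist (\<gamma> t p) (\<gamma> t0 p)) \<longlongrightarrow> 0) (at t0)) \<and>
     (\<forall>p\<in>X. \<forall>\<psi>. test_fun \<psi> \<longrightarrow> (\<forall>t.
        ((\<lambda>s. LINT x|lborel. fst (\<gamma> s p) x * \<psi> x) has_real_derivative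
           (LINT x|lborel. snd (\<gamma> t p) x * \<psi> x)) (at t) \<and>
        ((\<lambda>s. LINT x|lborel. snd (\<gamma> s p) x * \<psi> x) has_real_derivative
           (- (LINT x|lborel. uxx (fst (\<gamma> t p)) x * deriv (deriv \<psi>) x)
            - (LINT x|lborel. deriv W (fst (\<gamma> t p) x) * \<psi> x))) (at t))) \<and>
     (\<forall>t. \<forall>p\<in>X. energy W (\<gamma> t p) = energy W p \<and> momentum (\<gamma> t p) = momentum p)"

definition invariant_set :: "(real \<Rightarrow> state \<Rightarrow> state) \<Rightarrow> state set \<Rightarrow> bool" where
  "invariant_set \<gamma> \<Gamma> \<longleftrightarrow> (\<forall>t. \<gamma> t ` \<Gamma> \<subseteq> \<Gamma>)"

definition stable_set :: "(real \<Rightarrow> state \<Rightarrow> state) \<Rightarrow> state set \<Rightarrow> bool" where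
  "stable_set \<gamma> \<Gamma> \<longleftrightarrow> (\<forall>\<epsilon>>0. \<exists>\<delta>>0. \<forall>p\<in>X.
      Xdist_set p \<Gamma> \<le> \<delta> \<longrightarrow> (\<forall>t\<ge>0. Xdist_set (\<gamma> t p) \<Gamma> \<le> \<epsilon>))"

definition X_closed :: "state set \<Rightarrow> bool" where
  "X_closed \<Gamma> \<longleftrightarrow> \<Gamma> \<subseteq> X \<and> (\<forall>s l. (\<forall>n. s n \<in> \<Gamma>) \<longrightarrow> l \<in> X \<longrightarrow>
      (\<lambda>n. Xdist (s n) l) \<longlonglongrightarrow> 0 \<longrightarrow> l \<in> \<Gamma>)"

definition G_compact :: "state set \<Rightarrow> bool" where
  "G_compact \<Gamma> \<longleftrightarrow> X_closed \<Gamma> \<and> (\<forall>\<tau>. shift \<tau> ` \<Gamma> \<subseteq> \<Gamma>) \<and>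
     (\<forall>s::nat \<Rightarrow> state. (\<forall>n. s n \<in> \<Gamma>) \<longrightarrow>
        (\<exists>\<tau>::nat \<Rightarrow> real. \<exists>r l. strict_mono r \<and> l \<in> X \<and>
            (\<lambda>n. Xdist (shift (\<tau> (r n)) (s (r n))) l) \<longlonglongrightarrow> 0))"

definition soliton_with :: "(real \<Rightarrow> state \<Rightarrow> state) \<Rightarrow> state set \<Rightarrow> state \<Rightarrow> bool" where
  "soliton_with \<gamma> \<Gamma> u0 \<longleftrightarrow> u0 \<in> X \<and> (\<forall>t. \<gamma> t u0 \<in> \<Gamma>) \<and>
     invariant_set \<gamma> \<Gamma> \<and> stable_set \<gamma> \<Gamma> \<and> G_compact \<Gamma>"

definition soliton :: "(real \<Rightarrow> state \<Rightarrow> state) \<Rightarrow> state \<Rightarrow> bool" where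
  "soliton \<gamma> u0 \<longleftrightarrow> (\<exists>\<Gamma>. soliton_with \<gamma> \<Gamma> u0)"

definition hylomorphic_soliton :: "(real \<Rightarrow> real) \<Rightarrow> (real \<Rightarrow> state \<Rightarrow> state) \<Rightarrow> state \<Rightarrow> bool" where
  "hylomorphic_soliton W \<gamma> u0 \<longleftrightarrow> soliton \<gamma> u0 \<and>
     (\<exists>p0 e0. (\<exists>w\<in>X. momentum w = p0 \<and> energy W w = e0) \<and>
              (\<forall>w\<in>X. momentum w = p0 \<longrightarrow> e0 \<le> energy W w) \<and>
              soliton_with \<gamma> {w\<in>X. energy W w = e0 \<and> momentum w = p0} u0)"

end

theory Submission
  imports Defs "HOL-Complex_Analysis.Great_Picard"
begin

text \<open>For \<open>\<delta> > 0\<close> the soliton is a minimizer of \<open>J \<delta> = E / \<bar>C\<bar> + \<delta> * E\<close> on \<open>{C \<noteq> 0}\<close>; such a minimizer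
  also minimizes \<open>E\<close> at fixed momentum. By (W-i) a state of amplitude at most 1 satisfies
  \<open>min 1 (2 * \<eta>) * \<bar>C\<bar> \<le> E\<close>, whereas (W-iii) provides, by spreading out a large bump, states with \<open>E / \<bar>C\<bar>\<close>
  arbitrarily small; so for small \<open>\<delta>\<close> a minimizing sequence cannot vanish. It cannot split either: if it breaks
  into two distant pieces, each piece satisfies \<open>(inf J - \<delta> * E) * \<bar>C\<bar> \<le> E\<close>, and adding the two inequalities
  shows that one piece carries no energy. A tight sequence converges in \<open>L\<^sup>2\<close> along a subsequence,
  and the parallelogram identity applied to midpoints upgrades this to convergence in \<open>X\<close>.
  Hence every sequence with energy and momentum tending to those of the minimizer is compact modulo translations, which
  gives both \<open>G\<close>-compactness and, since the flow preserves energy and momentum, stability.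
  Finally \<open>\<delta>\<close> can be read off from the minimizer by scaling its velocity.\<close>

section \<open>Smooth functions and test functions\<close>

text \<open>The term \<open>\<delta> * E\<close> has three effects. It bounds the energy along a
  minimizing sequence, since \<open>E \<le> J / \<delta>\<close>. It makes the inequality
  \<open>(inf J - \<delta> * E) * |C| \<le> E\<close> stronger for states of smaller energy, which
  is why splitting costs something; the quotient \<open>E / |C|\<close> alone would merely be
  averaged by two distant pieces. And it labels the minimizers: stationarity under scaling of the
  velocity reads \<open>\<delta> * |C| * ||v||^2 = E - ||v||^2\<close>. For large amplitudes (W-i)
  gives no more than \<open>W \<ge> \<eta>\<close>, so a bound on the amplitude has to precede any
  L2 bound. The passage from L2 to \<open>X\<close> works because the potential energy is Lipschitz
  in the L2 norm on bounded sets and the first derivative interpolates between the function and its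
  second derivative; what remains of \<open>E\<close> is quadratic. States are functions, not
  classes, and \<open>ux\<close>, \<open>uxx\<close> are arbitrary choices. Estimates are therefore
  made on continuous representatives whose derivatives are explicit arguments.\<close>

definition smooth :: "(real \<Rightarrow> real) \<Rightarrow> bool" where
  "smooth f \<longleftrightarrow> (\<forall>k x. ((deriv ^^ k) f) differentiable (at x))"

lemma test_fun_iff: "test_fun f \<longleftrightarrow> smooth f \<and> bounded {x. f x \<noteq> 0}"
  by (simp add: test_fun_def smooth_def)

text \<open>Coinduction: a family in which every member has its derivative in the family contains
  all iterated derivatives of \<open>f\<close>. Each use amounts to finding a family of closed form
  that is stable under differentiation.\<close>

lemma smooth_coinduct:
  assumes "f \<in> F" "\<And>h. h \<in> F \<Longrightarrow> \<exists>h'\<in>F. \<forall>x. (h has_real_derivative h' x) (at x)"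
  shows "smooth f"
proof -
  have mem: "(deriv ^^ k) f \<in> F" for k
  proof (induction k)
    case 0
    then show ?case using assms(1) by simp
  next
    case (Suc k)
    then obtain h' where h': "h' \<in> F" "\<forall>x. ((deriv ^^ k) f has_real_derivative h' x) (at x)"
      using assms(2) by blast
    then have "deriv ((deriv ^^ k) f) = h'"
      by (auto intro!: ext DERIV_imp_deriv)
    then show ?case using h' by simp
  qed
  then show ?thesis
    unfolding smooth_def using assms(2) real_differentiable_def by meson
qed

lemma smooth_DERIV: "smooth f \<Longrightarrow> (f has_real_derivative deriv f x) (at x)"
  unfolding smooth_def by (metis DERIV_deriv_iff_real_differentiable funpow_0)

lemma smooth_deriv: "smooth f \<Longrightarrow> smooth (deriv f)"
  unfolding smooth_def by (metis comp_apply funpow_Suc_right)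

lemma smooth_continuous: "smooth f \<Longrightarrow> continuous_on A f"
  by (meson DERIV_isCont continuous_at_imp_continuous_on smooth_DERIV)

lemma smooth_antideriv:
  assumes "\<And>x. (f has_real_derivative f' x) (at x)" "smooth f'"
  shows "smooth f"
  by (rule smooth_coinduct[of f "insert f {h. smooth h}"])
    (use assms smooth_DERIV smooth_deriv in blast)+

lemma smooth_affine:
  assumes "smooth f" shows "smooth (\<lambda>x. f (a * x + b))"
proof (rule smooth_coinduct[of _ "{\<lambda>x. c * f (a * x + b) | c f. smooth f}"])
  show "(\<lambda>x. f (a * x + b)) \<in> {\<lambda>x. c * f (a * x + b) | c f. smooth f}"
    using assms by (auto intro!: exI[of _ 1])
next
  fix h assume "h \<in> {\<lambda>x. c * f (a * x + b) | c f. smooth f}"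
  then obtain c f where h: "h = (\<lambda>x. c * f (a * x + b))" "smooth f" by auto
  have "(h has_real_derivative (c * a) * deriv f (a * x + b)) (at x)" for x
    unfolding h by (auto intro!: derivative_eq_intros DERIV_chain2[OF smooth_DERIV[OF h(2)]])
  moreover have "(\<lambda>x. (c * a) * deriv f (a * x + b)) \<in> {\<lambda>x. c * f (a * x + b) | c f. smooth f}"
    using smooth_deriv[OF h(2)] by blast
  ultimately show "\<exists>h'\<in>{\<lambda>x. c * f (a * x + b) | c f. smooth f}. \<forall>x. (h has_real_derivative h' x) (at x)"
    by (intro bexI[of _ "\<lambda>x. (c * a) * deriv f (a * x + b)"]) auto
qed

text \<open>The Leibniz rule turns a product into a sum of two products of smooth functions, so
  closing the products under addition gives a family stable under differentiation. This replaces a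
  formula for the k-th derivative of a product.\<close>

inductive_set product_sums :: "(real \<Rightarrow> real) set" where
  "smooth f \<Longrightarrow> smooth g \<Longrightarrow> (\<lambda>x. f x * g x) \<in> product_sums"
| "f \<in> product_sums \<Longrightarrow> g \<in> product_sums \<Longrightarrow> (\<lambda>x. f x + g x) \<in> product_sums"

lemma product_sums_smooth:
  assumes "f \<in> product_sums" shows "smooth f"
proof (rule smooth_coinduct[OF assms])
  fix h assume "h \<in> product_sums"
  then show "\<exists>h'\<in>product_sums. \<forall>x. (h has_real_derivative h' x) (at x)"
  proof induction
    case (1 f g)
    have "((\<lambda>x. f x * g x) has_real_derivative deriv f x * g x + f x * deriv g x) (at x)" for x
      by (auto intro!: derivative_eq_intros smooth_DERIV 1)
    moreover have "(\<lambda>x. deriv f x * g x + f x * deriv g x) \<in> product_sums"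
      by (intro product_sums.intros smooth_deriv 1)
    ultimately show ?case by (intro bexI[of _ "\<lambda>x. deriv f x * g x + f x * deriv g x"]) auto
  next
    case (2 f g)
    then obtain f' g' where *: "f' \<in> product_sums" "g' \<in> product_sums"
      "\<forall>x. (f has_real_derivative f' x) (at x)" "\<forall>x. (g has_real_derivative g' x) (at x)" by auto
    then show ?case
      by (intro bexI[of _ "\<lambda>x. f' x + g' x"]) (auto intro!: product_sums.intros derivative_eq_intros)
  qed
qed

lemma smooth_mult: "smooth f \<Longrightarrow> smooth g \<Longrightarrow> smooth (\<lambda>x. f x * g x)"
  by (rule product_sums_smooth) (rule product_sums.intros(1))

lemma smooth_const: "smooth (\<lambda>x. c)"
  by (rule smooth_coinduct[of _ "range (\<lambda>c x. c)"]) (auto intro!: exI[of _ 0] derivative_eq_intros)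

lemma smooth_cmult: "smooth f \<Longrightarrow> smooth (\<lambda>x. c * f x)"
  by (intro smooth_mult smooth_const)

lemma smooth_add: "smooth f \<Longrightarrow> smooth g \<Longrightarrow> smooth (\<lambda>x. f x + g x)"
  \<comment> \<open>A sum is \<open>1 * f + 1 * g\<close>, a member of
    \<open>product_sums\<close>.\<close>
  using product_sums_smooth[OF product_sums.intros(2)
      [OF product_sums.intros(1)[OF smooth_const[of 1]] product_sums.intros(1)[OF smooth_const[of 1]]]]
  by simp

lemma smooth_diff: "smooth f \<Longrightarrow> smooth g \<Longrightarrow> smooth (\<lambda>x. f x - g x)"
  using smooth_add[OF _ smooth_cmult[of g "-1"], of f] by simp

section \<open>The function \<open>exp (- 1 / x)\<close>, flat at the origin, and test
  functions\<close>

definition flat :: "real \<Rightarrow> real" where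
  "flat x = (if x > 0 then exp (- 1 / x) else 0)"

text \<open>Splitting off the constant coefficient multiplies the rest of the polynomial by
  \<open>z\<close>, so the induction has to leave the power \<open>k\<close> arbitrary.\<close>

lemma poly_exp_decay: "((\<lambda>z::real. z ^ k * poly q z * exp (- z)) \<longlongrightarrow> 0) at_top"
proof (induction q arbitrary: k)
  case 0
  then show ?case by simp
next
  case (pCons a q)
  have "((\<lambda>z. a * (z ^ k / exp z) + z ^ Suc k * poly q z * exp (- z)) \<longlongrightarrow> a * 0 + 0) at_top"
    by (intro tendsto_intros tendsto_power_div_exp_0 pCons.IH)
  then show ?case
    by (simp add: algebra_simps exp_minus divide_inverse)
qed

text \<open>On the positive side every derivative is a polynomial in \<open>1 / x\<close> times
  \<open>exp (- 1 / x)\<close>. This family, extended by zero, is stable under differentiation, also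
  at the origin.\<close>

lemma smooth_flat: "smooth flat"
proof (rule smooth_coinduct[of _ "range (\<lambda>p x. if x > 0 then poly p (1 / x) * exp (- 1 / x) else 0)"])
  show "flat \<in> range (\<lambda>p x. if x > 0 then poly p (1 / x) * exp (- 1 / x) else 0)"
    by (auto simp: flat_def fun_eq_iff intro!: exI[of _ 1] image_eqI[of _ _ 1])
next
  fix h :: "real \<Rightarrow> real" assume "h \<in> range (\<lambda>p x. if x > 0 then poly p (1 / x) * exp (- 1 / x) else 0)"
  then obtain p where h: "h = (\<lambda>x. if x > 0 then poly p (1 / x) * exp (- 1 / x) else 0)" by auto
  \<comment> \<open>With \<open>z = 1 / x\<close>, the derivative of \<open>p z * exp (- z)\<close>
    in \<open>x\<close> is \<open>z^2 * (p z - p' z) * exp (- z)\<close>.\<close>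
  define q where "q = monom 1 2 * (p - pderiv p)"
  define h' where "h' = (\<lambda>x::real. if x > 0 then poly q (1 / x) * exp (- 1 / x) else 0)"
  have "(h has_real_derivative h' x) (at x)" for x
  proof -
    consider "x > 0" | "x < 0" | "x = 0" by linarith
    then show ?thesis
    proof cases
      case 1
      have "((\<lambda>x. poly p (1 / x) * exp (- 1 / x)) has_real_derivative h' x) (at x)"
        using 1 by (auto intro!: derivative_eq_intros DERIV_chain2[OF poly_DERIV]
            simp: h'_def q_def poly_monom field_simps power2_eq_square)
      then show ?thesis
        by (rule has_field_derivative_transform_within_open[where S="{0<..}"]) (use 1 in \<open>auto simp: h\<close>)
    next
      case 2
      have "((\<lambda>x. 0) has_real_derivative h' x) (at x)"
        using 2 by (auto simp: h'_def)
      then show ?thesis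
        by (rule has_field_derivative_transform_within_open[where S="{..<0}"]) (use 2 in \<open>auto simp: h\<close>)
    next
      case 3
      \<comment> \<open>At the origin the right difference quotient is
        \<open>z * p z * exp (- z)\<close> with \<open>z = 1 / y\<close> tending to
        infinity.\<close>
      have "((\<lambda>z. z ^ 1 * poly p z * exp (- z)) \<longlongrightarrow> 0) at_top" by (rule poly_exp_decay)
      then have "((\<lambda>y. (inverse y) ^ 1 * poly p (inverse y) * exp (- (inverse y))) \<longlongrightarrow> 0) (at_right 0)"
        by (rule filterlim_compose) (rule filterlim_inverse_at_top_right)
      then have r: "((\<lambda>y. (h y - h 0) / (y - 0)) \<longlongrightarrow> 0) (at_right 0)"
        by (rule Lim_transform_eventually)
          (auto simp: h eventually_at_filter divide_inverse mult_ac)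
      have l: "((\<lambda>y. (h y - h 0) / (y - 0)) \<longlongrightarrow> 0) (at_left 0)"
        by (rule tendsto_eventually) (auto simp: h eventually_at_filter)
      show ?thesis unfolding 3 has_field_derivative_iff
        using filterlim_split_at[OF l r] by (simp add: h'_def)
    qed
  qed
  moreover have "h' \<in> range (\<lambda>p x. if x > 0 then poly p (1 / x) * exp (- 1 / x) else 0)"
    by (auto simp: h'_def)
  ultimately show "\<exists>h'\<in>range (\<lambda>p x. if x > 0 then poly p (1 / x) * exp (- 1 / x) else 0). \<forall>x. (h has_real_derivative h' x) (at x)"
    by (intro bexI[of _ h']) auto
qed

lemma flat_bounds: "0 \<le> flat x" "flat x \<le> 1" "x \<le> 0 \<Longrightarrow> flat x = 0" "0 < x \<Longrightarrow> 0 < flat x"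
  by (auto simp: flat_def)

lemma test_fun_continuous: "test_fun \<phi> \<Longrightarrow> continuous_on A \<phi>"
  by (simp add: test_fun_iff smooth_continuous)

lemma test_fun_DERIV: "test_fun \<phi> \<Longrightarrow> (\<phi> has_real_derivative deriv \<phi> x) (at x)"
  by (simp add: test_fun_iff smooth_DERIV)

lemma test_fun_support:
  assumes "test_fun \<phi>"
  obtains R where "0 < R" "\<And>x. R \<le> \<bar>x\<bar> \<Longrightarrow> \<phi> x = 0"
proof -
  obtain R where "0 < R" "\<forall>x\<in>{x. \<phi> x \<noteq> 0}. norm x \<le> R"
    using assms unfolding test_fun_iff bounded_pos by auto
  then show thesis by (intro that[of "R + 1"]) force+
qed

lemma test_funI: "smooth \<phi> \<Longrightarrow> (\<And>x. R \<le> \<bar>x\<bar> \<Longrightarrow> \<phi> x = 0) \<Longrightarrow> test_fun \<phi>"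
  unfolding test_fun_iff bounded_iff by (intro conjI exI[of _ R]) (auto, force)

lemma test_fun_deriv: assumes "test_fun \<phi>" shows "test_fun (deriv \<phi>)"
proof -
  obtain R where R: "0 < R" "\<And>x. R \<le> \<bar>x\<bar> \<Longrightarrow> \<phi> x = 0" using test_fun_support[OF assms] by blast
  show ?thesis
  proof (rule test_funI[of _ "R + 1"])
    show "smooth (deriv \<phi>)" using assms by (simp add: test_fun_iff smooth_deriv)
    fix x assume x: "R + 1 \<le> \<bar>x\<bar>"
    have "((\<lambda>x. 0) has_real_derivative 0) (at x)" by simp
    then have "(\<phi> has_real_derivative 0) (at x)"
      by (rule has_field_derivative_transform_within_open[where S="- {-R..R}"])
        (use x R in \<open>auto simp: abs_if not_le split: if_splits\<close>)
    then show "deriv \<phi> x = 0" by (rule DERIV_imp_deriv)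
  qed
qed

lemma test_fun_mult: "smooth f \<Longrightarrow> test_fun \<phi> \<Longrightarrow> test_fun (\<lambda>x. f x * \<phi> x)"
  unfolding test_fun_iff by (auto intro: smooth_mult bounded_subset)

lemma test_fun_diff: "test_fun f \<Longrightarrow> test_fun g \<Longrightarrow> test_fun (\<lambda>x. f x - g x)"
  unfolding test_fun_iff
  by (auto intro: smooth_diff bounded_subset[of "{x. f x \<noteq> 0} \<union> {x. g x \<noteq> 0}"])

lemma test_fun_shift: assumes "test_fun \<phi>" shows "test_fun (\<lambda>x. \<phi> (x + t))"
proof -
  obtain R where R: "0 < R" "\<And>x. R \<le> \<bar>x\<bar> \<Longrightarrow> \<phi> x = 0" using test_fun_support[OF assms] by blast
  show ?thesis
    by (rule test_funI[of _ "R + \<bar>t\<bar>"])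
      (use R assms smooth_affine[of \<phi> 1 t] in \<open>auto simp: test_fun_iff\<close>)
qed

section \<open>Local integrability and the fundamental lemma of the calculus of variations\<close>

definition locint :: "(real \<Rightarrow> real) \<Rightarrow> bool" where
  "locint u \<longleftrightarrow> (\<forall>K. compact K \<longrightarrow> set_integrable lborel K u)"

lemma locintD: "locint u \<Longrightarrow> set_integrable lborel {a..b} u"
  by (simp add: locint_def)

lemma locint_measurable: assumes "locint u" shows "u \<in> borel_measurable borel"
proof -
  have "(\<lambda>x. indicator {- real n..real n} x * u x) \<in> borel_measurable borel" for n
    using locintD[OF assms, of "- real n" "real n"]
    unfolding set_integrable_def by (auto dest!: borel_measurable_integrable)
  moreover have "(\<lambda>n. indicator {- real n..real n} x * u x) \<longlonglongrightarrow> u x" for x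
  proof (rule tendsto_eventually)
    obtain N where "\<bar>x\<bar> \<le> real N" using real_arch_simple by blast
    then show "\<forall>\<^sub>F n in sequentially. indicator {- real n..real n} x * u x = u x"
      by (intro eventually_sequentiallyI[of N]) (auto simp: indicator_def)
  qed
  ultimately show ?thesis
    by (rule borel_measurable_LIMSEQ_metric[where f="\<lambda>n x. indicator {- real n..real n} x * u x"])
qed

lemma continuous_bounded_Icc:
  fixes H :: "real \<Rightarrow> real"
  assumes "continuous_on UNIV H"
  obtains B where "\<And>x. x \<in> {a..b} \<Longrightarrow> \<bar>H x\<bar> \<le> B"
proof -
  have "compact (H ` {a..b})" by (intro compact_continuous_image continuous_on_subset[OF assms]) auto
  then show thesis
    using that by (metis compact_imp_bounded bounded_iff imageI real_norm_def)
qed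

lemma locint_mult_test:
  assumes u: "locint u" and g: "continuous_on UNIV g" "\<And>x. R \<le> \<bar>x\<bar> \<Longrightarrow> g x = 0"
  shows "integrable lborel (\<lambda>x. u x * g x)"
proof -
  have [measurable]: "u \<in> borel_measurable borel" by (rule locint_measurable[OF u])
  have [measurable]: "g \<in> borel_measurable borel" by (rule borel_measurable_continuous_onI[OF g(1)])
  obtain B where B: "\<And>x. x \<in> {-R..R} \<Longrightarrow> \<bar>g x\<bar> \<le> B" using continuous_bounded_Icc[OF g(1)] by blast
  have "integrable lborel (\<lambda>x. B * (indicator {-R..R} x *\<^sub>R u x))"
    using locintD[OF u, of "-R" R] by (auto simp: set_integrable_def)
  then show ?thesis
  proof (rule Bochner_Integration.integrable_bound)
    show "AE x in lborel. norm (u x * g x) \<le> norm (B * (indicator {-R..R} x *\<^sub>R u x))"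
    proof (intro AE_I2)
      fix x show "norm (u x * g x) \<le> norm (B * (indicator {-R..R} x *\<^sub>R u x))"
      proof (cases "x \<in> {-R..R}")
        case True
        then have "\<bar>g x\<bar> \<le> \<bar>B\<bar>" using B[of x] by linarith
        then show ?thesis using True by (auto simp: abs_mult mult.commute[of "\<bar>B\<bar>"] intro!: mult_left_mono)
      next
        case False
        then have "R \<le> \<bar>x\<bar>" by auto
        then show ?thesis using g(2)[of x] by simp
      qed
    qed
  qed simp
qed

lemma locint_mult_test_fun:
  assumes "locint u" "test_fun \<phi>" shows "integrable lborel (\<lambda>x. u x * \<phi> x)"
proof -
  obtain R where R: "0 < R" "\<And>x. R \<le> \<bar>x\<bar> \<Longrightarrow> \<phi> x = 0" using test_fun_support[OF assms(2)] by blast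
  show ?thesis by (rule locint_mult_test[OF assms(1) test_fun_continuous[OF assms(2)] R(2)])
qed

lemma locint_continuous: "continuous_on UNIV u \<Longrightarrow> locint u"
  unfolding set_integrable_def locint_def
  by (intro allI impI borel_integrable_compact) (auto intro: continuous_on_subset)

lemma locint_diff: "locint u \<Longrightarrow> locint w \<Longrightarrow> locint (\<lambda>x. u x - w x)"
  by (simp add: locint_def)

lemma test_fun_integrable: assumes "test_fun \<phi>" shows "integrable lborel \<phi>"
  using locint_mult_test_fun[OF locint_continuous, of "\<lambda>_. 1" \<phi>] assms by simp

text \<open>As \<open>n\<close> grows these increase to the indicator function of the open interval.\<close>
definition ibump :: "real \<Rightarrow> real \<Rightarrow> nat \<Rightarrow> real \<Rightarrow> real" where
  "ibump a b n x = flat (real (Suc n) * (x - a)) * flat (real (Suc n) * (b - x))"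

lemma ibump_test_fun: "test_fun (ibump a b n)"
proof (rule test_funI[of _ "\<bar>a\<bar> + \<bar>b\<bar>"])
  have "smooth (\<lambda>x. flat (real (Suc n) * x + (- real (Suc n) * a)) * flat (- real (Suc n) * x + real (Suc n) * b))"
    by (intro smooth_mult smooth_affine smooth_flat)
  then show "smooth (ibump a b n)" by (simp add: ibump_def[abs_def] algebra_simps)
  fix x assume "\<bar>a\<bar> + \<bar>b\<bar> \<le> \<bar>x\<bar>"
  then have "x \<le> a \<or> b \<le> x" by linarith
  then have "real (Suc n) * (x - a) \<le> 0 \<or> real (Suc n) * (b - x) \<le> 0"
    by (simp add: mult_le_0_iff)
  then show "ibump a b n x = 0" using flat_bounds(3) by (auto simp: ibump_def)
qed

lemma ibump_bounds: "0 \<le> ibump a b n x" "ibump a b n x \<le> 1"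
  "x \<notin> {a<..<b} \<Longrightarrow> ibump a b n x = 0" "x \<in> {a<..<b} \<Longrightarrow> 0 < ibump a b n x"
proof -
  show "0 \<le> ibump a b n x" "ibump a b n x \<le> 1"
    by (auto simp: ibump_def flat_bounds intro!: mult_nonneg_nonneg mult_le_one)
  show "ibump a b n x = 0" if "x \<notin> {a<..<b}"
  proof -
    have "real (Suc n) * (x - a) \<le> 0 \<or> real (Suc n) * (b - x) \<le> 0"
      using that by (auto simp: mult_le_0_iff)
    then show ?thesis using flat_bounds(3) by (auto simp: ibump_def)
  qed
  show "0 < ibump a b n x" if "x \<in> {a<..<b}"
    unfolding ibump_def using that by (intro mult_pos_pos flat_bounds(4)) auto
qed

lemma ibump_tendsto: "(\<lambda>n. ibump a b n x) \<longlonglongrightarrow> indicator {a<..<b} x"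
proof (cases "x \<in> {a<..<b}")
  case True
  have one: "(\<lambda>n. flat (real (Suc n) * y)) \<longlonglongrightarrow> 1" if "y > 0" for y
  proof -
    have "(\<lambda>n. exp (- ((1 / y) * inverse (real (Suc n))))) \<longlonglongrightarrow> exp (- ((1 / y) * 0))"
      by (intro tendsto_intros LIMSEQ_inverse_real_of_nat)
    then show ?thesis using that by (simp add: flat_def field_simps del: of_nat_Suc)
  qed
  have "(\<lambda>n. ibump a b n x) \<longlonglongrightarrow> 1 * 1"
    unfolding ibump_def using True by (intro tendsto_mult one) auto
  then show ?thesis using True by simp
next
  case False
  then show ?thesis using ibump_bounds(3)[OF False] by simp
qed

text \<open>The Borel sets over which the truncated \<open>h\<close> integrates to zero contain the
  intervals and are closed under complements and disjoint unions, hence are all of them. Truncation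
  to \<open>{-n..n}\<close> makes \<open>h\<close> integrable and keeps its total integral zero,
  which the complement step uses.\<close>

lemma AE_zero_if_interval_integrals_zero:
  fixes h :: "real \<Rightarrow> real"
  assumes h: "locint h" and z: "\<And>a b. (LINT x:{a..b}|lborel. h x) = 0"
  shows "AE x in lborel. h x = 0"
proof -
  have [measurable]: "h \<in> borel_measurable borel" by (rule locint_measurable[OF h])
  have "AE x in lborel. indicator {- real n..real n} x * h x = 0" for n :: nat
  proof (rule density_unique_real)
    let ?h = "\<lambda>x. indicator {- real n..real n} x * h x"
    show int: "integrable lborel ?h"
      using locintD[OF h, of "- real n" "real n"] by (simp add: set_integrable_def)
    have si: "set_integrable lborel B ?h" if "B \<in> sets borel" for B
      unfolding set_integrable_def using that by (intro integrable_mult_indicator int) simp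
    show "integrable lborel (\<lambda>x. 0::real)" by simp
    fix A :: "real set" assume "A \<in> sets lborel"
    then have "A \<in> sets borel" by simp
    then have "(LINT x:A|lborel. ?h x) = 0"
    proof (induction rule: borel_set_induct)
      case empty then show ?case by (simp add: set_lebesgue_integral_def)
    next
      case (interval a b)
      have "(LINT x:{a..b}|lborel. ?h x) = (LINT x:{max a (- real n)..min b (real n)}|lborel. h x)"
        unfolding set_lebesgue_integral_def
        by (rule Bochner_Integration.integral_cong) (auto simp: indicator_def)
      then show ?case using z by simp
    next
      case (compl B)
      have "(LINT x:B \<union> - B|lborel. ?h x) = (LINT x:B|lborel. ?h x) + (LINT x:- B|lborel. ?h x)"
        by (rule set_integral_Un) (use compl si in auto)
      moreover have "(LINT x:B \<union> - B|lborel. ?h x) = 0"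
        using z[of "- real n" "real n"] by (simp add: set_lebesgue_integral_def)
      ultimately show ?case using compl by simp
    next
      case (union B)
      have "(LINT x:(\<Union>i. B i)|lborel. ?h x) = (\<Sum>i. (LINT x:B i|lborel. ?h x))"
      proof (rule lebesgue_integral_countable_add)
        show "B i \<inter> B j = {}" if "i \<noteq> j" for i j
          using union(1) that by (auto simp: disjoint_family_on_def)
        show "set_integrable lborel (\<Union>i. B i) ?h" using union(2) by (intro si) auto
      qed (use union(2) in auto)
      then show ?case using union by simp
    qed
    then show "(LINT x:A|lborel. ?h x) = (LINT x:A|lborel. 0)" by simp
  qed
  then have "AE x in lborel. \<forall>n::nat. indicator {- real n..real n} x * h x = 0"
    unfolding AE_all_countable by blast
  then show ?thesis
  proof eventually_elim
    case (elim x)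
    obtain n where "\<bar>x\<bar> < real n" using reals_Archimedean2 by blast
    then show ?case using elim[rule_format, where n=n] by (auto simp: indicator_def split: if_splits)
  qed
qed

text \<open>The test functions \<open>ibump a b n\<close> are bounded by \<open>1\<close>, vanish
  outside \<open>{a<..<b}\<close> and converge to its indicator. Testing with them and dominated
  convergence give all interval integrals; the end points are null sets.\<close>

lemma AE_zero_if_test_integrals_zero:
  assumes h: "locint h" and z: "\<And>\<psi>. test_fun \<psi> \<Longrightarrow> (LINT x|lborel. h x * \<psi> x) = 0"
  shows "AE x in lborel. h x = 0"
proof (rule AE_zero_if_interval_integrals_zero[OF h])
  fix a b :: real
  have [measurable]: "h \<in> borel_measurable borel" by (rule locint_measurable[OF h])
  have m[measurable]: "ibump a b n \<in> borel_measurable borel" for n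
    by (intro borel_measurable_continuous_onI test_fun_continuous ibump_test_fun)
  have "(\<lambda>n. LINT x|lborel. h x * ibump a b n x) \<longlonglongrightarrow> (LINT x|lborel. h x * indicator {a<..<b} x)"
  proof (rule integral_dominated_convergence[where w="\<lambda>x. indicator {a..b} x * \<bar>h x\<bar>"])
    show "integrable lborel (\<lambda>x. indicator {a..b} x * \<bar>h x\<bar>)"
      using set_integrable_abs[OF locintD[OF h, of a b]] by (simp add: set_integrable_def)
    show "AE x in lborel. (\<lambda>n. h x * ibump a b n x) \<longlonglongrightarrow> h x * indicator {a<..<b} x"
      by (intro AE_I2 tendsto_intros ibump_tendsto)
    show "AE x in lborel. norm (h x * ibump a b n x) \<le> indicator {a..b} x * \<bar>h x\<bar>" for n
    proof (intro AE_I2)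
      fix x show "norm (h x * ibump a b n x) \<le> indicator {a..b} x * \<bar>h x\<bar>"
        using ibump_bounds[where a=a and b=b and n=n and x=x]
        by (cases "x \<in> {a<..<b}") (auto simp: abs_mult intro: mult_left_le)
    qed
  qed simp_all
  moreover have "(LINT x|lborel. h x * ibump a b n x) = 0" for n by (rule z[OF ibump_test_fun])
  ultimately have "(LINT x|lborel. h x * indicator {a<..<b} x) = 0"
    by (simp add: LIMSEQ_const_iff)
  moreover have "(LINT x|lborel. h x * indicator {a<..<b} x) = (LINT x|lborel. indicator {a..b} x *\<^sub>R h x)"
  proof (rule integral_cong_AE)
    show "AE x in lborel. h x * indicator {a<..<b} x = indicator {a..b} x *\<^sub>R h x"
      using AE_lborel_singleton[of a] AE_lborel_singleton[of b] by eventually_elim (auto simp: indicator_def)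
  qed measurable
  ultimately show "(LINT x:{a..b}|lborel. h x) = 0"
    by (simp add: set_lebesgue_integral_def)
qed

section \<open>Absolutely continuous functions and weak derivatives\<close>

text \<open>\<open>F\<close> is an indefinite Lebesgue integral of \<open>w\<close>, that is,
  locally absolutely continuous with derivative \<open>w\<close> almost everywhere. The restriction
  to \<open>a \<le> b\<close> reflects that a set integral over a reversed interval is zero.\<close>

definition ac :: "(real \<Rightarrow> real) \<Rightarrow> (real \<Rightarrow> real) \<Rightarrow> bool" where
  "ac F w \<longleftrightarrow> locint w \<and> (\<forall>a b. a \<le> b \<longrightarrow> F b - F a = (LINT t:{a..b}|lborel. w t))"

lemma ac_locint: "ac F w \<Longrightarrow> locint w" by (simp add: ac_def)

lemma ac_diff_eq: "ac F w \<Longrightarrow> a \<le> b \<Longrightarrow> F b - F a = (LINT t:{a..b}|lborel. w t)"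
  by (simp add: ac_def)

lemma set_integral_Icc_combine:
  fixes w :: "real \<Rightarrow> real"
  assumes "locint w" "a \<le> c" "c \<le> b"
  shows "(LINT t:{a..b}|lborel. w t) = (LINT t:{a..c}|lborel. w t) + (LINT t:{c..b}|lborel. w t)"
proof -
  have "{a..b} = {a..c} \<union> {c..b}" using assms by auto
  moreover have "AE x in lborel. \<not> (x \<in> {a..c} \<and> x \<in> {c..b})"
    using AE_lborel_singleton[of c] by eventually_elim auto
  ultimately show ?thesis
    using set_integral_Un_AE[of "{a..c}" "{c..b}" lborel w] locintD[OF assms(1)] by simp
qed

lemma set_integral_singleton:
  fixes w :: "real \<Rightarrow> real"
  shows "(LINT t:{a..a}|lborel. w t) = (0::real)"
proof -
  have "AE x in lborel. indicat_real {a..a} x *\<^sub>R w x = 0"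
    using AE_lborel_singleton[of a] by eventually_elim (auto simp: indicator_def dest: order.antisym)
  then have "(LINT x|lborel. indicat_real {a..a} x *\<^sub>R w x) = 0" by (rule integral_eq_zero_AE)
  then show ?thesis by (simp add: set_lebesgue_integral_def)
qed

lemma ac_exists: assumes "locint w" shows "\<exists>F. ac F w"
proof -
  \<comment> \<open>One of the two intervals is always empty or a point, so the difference is the
    signed integral from \<open>0\<close> to \<open>x\<close>.\<close>
  define F where "F x = (LINT t:{0..x}|lborel. w t) - (LINT t:{x..0}|lborel. w t)" for x
  have e: "(LINT t:{a..b}|lborel. w t) = 0" if "b \<le> a" for a b :: real
    using that set_integral_singleton[of a w] by (cases "a = b") (auto simp: set_lebesgue_integral_def)
  have "F b - F a = (LINT t:{a..b}|lborel. w t)" if "a \<le> b" for a b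
  proof -
    consider "0 \<le> a" | "b \<le> 0" | "a \<le> 0" "0 \<le> b" by linarith
    then show ?thesis
    proof cases
      case 1
      then show ?thesis using set_integral_Icc_combine[OF assms 1 that] e[of 0 a] e[of 0 b] that by (simp add: F_def)
    next
      case 2
      then show ?thesis using set_integral_Icc_combine[OF assms that 2] e[of a 0] e[of b 0] that by (simp add: F_def)
    next
      case 3
      then show ?thesis using set_integral_Icc_combine[OF assms 3] e[of a 0] e[of 0 b] by (simp add: F_def)
    qed
  qed
  then show ?thesis using assms unfolding ac_def by blast
qed

lemma ac_eq_integral: assumes "ac F w" "a \<le> x" shows "F x = F a + integral {a..x} w"
  using ac_diff_eq[OF assms] set_borel_integral_eq_integral(2)[OF locintD[OF ac_locint[OF assms(1)], of a x]]
  by simp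

lemma ac_continuous: assumes "ac F w" shows "continuous_on A F"
proof -
  have "isCont F x" for x
  proof -
    have "w integrable_on {x-1..x+1}"
      by (rule set_borel_integral_eq_integral(1)[OF locintD[OF ac_locint[OF assms]]])
    then have "continuous_on {x-1..x+1} (\<lambda>y. F (x-1) + integral {x-1..y} w)"
      by (intro continuous_intros indefinite_integral_continuous_1)
    then have "continuous_on {x-1..x+1} F"
      by (rule continuous_on_eq) (use ac_eq_integral[OF assms] in auto)
    then show ?thesis by (rule continuous_on_interior) simp
  qed
  then show ?thesis by (simp add: continuous_at_imp_continuous_on)
qed

lemma ac_DERIV: assumes "ac F w" "continuous_on UNIV w" shows "(F has_real_derivative w x) (at x)"
proof -
  have "((\<lambda>y. integral {x-1..y} w) has_real_derivative w x) (at x within {x-1..x+1})"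
    by (rule integral_has_real_derivative) (use assms(2) in \<open>auto intro: continuous_on_subset\<close>)
  then have "((\<lambda>y. integral {x-1..y} w) has_real_derivative w x) (at x)"
    by (simp add: at_within_Icc_at)
  then have "((\<lambda>y. F (x-1) + integral {x-1..y} w) has_real_derivative w x) (at x)"
    by (auto intro!: derivative_eq_intros)
  then show ?thesis
    by (rule has_field_derivative_transform_within_open[where S="{x-1<..<x+1}"])
      (auto intro!: ac_eq_integral[OF assms(1), symmetric])
qed

lemma DERIV_ac:
  assumes "\<And>x. (F has_real_derivative w x) (at x)" "continuous_on UNIV w"
  shows "ac F w"
  unfolding ac_def
proof (intro conjI allI impI)
  show "locint w" by (rule locint_continuous[OF assms(2)])
  fix a b :: real assume "a \<le> b"
  show "F b - F a = (LINT t:{a..b}|lborel. w t)"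
    unfolding set_lebesgue_integral_def
    by (rule integral_FTC_atLeastAtMost[symmetric, OF \<open>a \<le> b\<close>])
      (use assms in \<open>auto intro: continuous_on_subset has_vector_derivative_at_within
        simp: has_real_derivative_iff_has_vector_derivative\<close>)
qed

text \<open>Fubini for \<open>w y * g x\<close> on the triangle \<open>a \<le> y \<le> x \<le> b\<close>.\<close>
lemma ac_integral_by_parts:
  assumes F: "ac F w" and G: "ac G g" and ab: "a \<le> b"
  shows "(LINT x:{a..b}|lborel. F x * g x) + (LINT x:{a..b}|lborel. w x * G x) = F b * G b - F a * G a"
proof -
  have [measurable]: "w \<in> borel_measurable borel" "g \<in> borel_measurable borel"
    using locint_measurable ac_locint F G by blast+
  define w' where "w' y = indicator {a..b} y * w y" for y
  define g' where "g' x = indicator {a..b} x * g x" for x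
  have [measurable]: "w' \<in> borel_measurable borel" "g' \<in> borel_measurable borel"
    unfolding w'_def[abs_def] g'_def[abs_def] by measurable
  have iw: "integrable lborel w'" and ig: "integrable lborel g'"
    using locintD[OF ac_locint[OF F], of a b] locintD[OF ac_locint[OF G], of a b]
    by (auto simp: w'_def[abs_def] g'_def[abs_def] set_integrable_def)
  define k where "k x y = (if y \<le> x then w' y * g' x else 0)" for x y
  have mk[measurable]: "case_prod k \<in> borel_measurable (lborel \<Otimes>\<^sub>M lborel)"
    unfolding k_def[abs_def] by measurable
  have mk1[measurable]: "k x \<in> borel_measurable borel" for x
    unfolding k_def[abs_def] by measurable
  have k_le: "norm (k x y) \<le> \<bar>g' x\<bar> * \<bar>w' y\<bar>" for x y by (auto simp: k_def abs_mult)
  have ik: "integrable lborel (k x)" for x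
    by (rule Bochner_Integration.integrable_bound[of _ "\<lambda>y. \<bar>g' x\<bar> * \<bar>w' y\<bar>"]) (use iw k_le in auto)
  have "integrable (lborel \<Otimes>\<^sub>M lborel) (case_prod k)"
  proof (rule lborel_pair.Fubini_integrable[OF mk])
    show "integrable lborel (\<lambda>x. LINT y|lborel. norm (case (x, y) of (x, y) \<Rightarrow> k x y))"
    proof (rule Bochner_Integration.integrable_bound)
      show "integrable lborel (\<lambda>x. \<bar>g' x\<bar> * (LINT y|lborel. \<bar>w' y\<bar>))" using ig by auto
      show "(\<lambda>x. LINT y|lborel. norm (case (x, y) of (x, y) \<Rightarrow> k x y)) \<in> borel_measurable lborel"
        by measurable
      show "AE x in lborel. norm (LINT y|lborel. norm (case (x, y) of (x, y) \<Rightarrow> k x y)) \<le> norm (\<bar>g' x\<bar> * (LINT y|lborel. \<bar>w' y\<bar>))"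
      proof (intro AE_I2)
        fix x
        have "(LINT y|lborel. norm (k x y)) \<le> (LINT y|lborel. \<bar>g' x\<bar> * \<bar>w' y\<bar>)"
          by (rule integral_mono) (use ik iw k_le in auto)
        then show "norm (LINT y|lborel. norm (case (x, y) of (x, y) \<Rightarrow> k x y)) \<le> norm (\<bar>g' x\<bar> * (LINT y|lborel. \<bar>w' y\<bar>))"
          by simp
      qed
    qed
    show "AE x in lborel. integrable lborel (\<lambda>y. case (x, y) of (x, y) \<Rightarrow> k x y)"
      using ik by simp
  qed
  then have fub: "(LINT y|lborel. LINT x|lborel. k x y) = (LINT x|lborel. LINT y|lborel. k x y)"
    by (rule lborel_pair.Fubini_integral)
  have in1: "(LINT y|lborel. k x y) = g' x * (F x - F a)" for x
  proof (cases "x \<in> {a..b}")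
    case True
    have "(LINT y|lborel. k x y) = (LINT y|lborel. g' x * (indicator {a..x} y *\<^sub>R w y))"
      by (rule Bochner_Integration.integral_cong) (use True in \<open>auto simp: k_def w'_def indicator_def\<close>)
    then show ?thesis using ac_diff_eq[OF F, of a x] True by (simp add: set_lebesgue_integral_def)
  next
    case False
    then have "g' x = 0" by (auto simp: g'_def)
    then show ?thesis by (simp add: k_def cong: if_cong)
  qed
  have in2: "(LINT x|lborel. k x y) = w' y * (G b - G y)" for y
  proof (cases "y \<in> {a..b}")
    case True
    have "(LINT x|lborel. k x y) = (LINT x|lborel. w' y * (indicator {y..b} x *\<^sub>R g x))"
      by (rule Bochner_Integration.integral_cong) (use True in \<open>auto simp: k_def g'_def indicator_def\<close>)
    then show ?thesis using ac_diff_eq[OF G, of y b] True by (simp add: set_lebesgue_integral_def)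
  next
    case False
    then have "w' y = 0" by (auto simp: w'_def)
    then show ?thesis by (simp add: k_def cong: if_cong)
  qed
  have int_mult: "integrable lborel (\<lambda>x. indicator {a..b} x * (u x * H x))"
    if u: "locint u" and H: "continuous_on UNIV H" for u H :: "real \<Rightarrow> real"
  proof -
    have [measurable]: "u \<in> borel_measurable borel" "H \<in> borel_measurable borel"
      using locint_measurable[OF u] borel_measurable_continuous_onI[OF H] by auto
    obtain B where B: "\<And>x. x \<in> {a..b} \<Longrightarrow> \<bar>H x\<bar> \<le> B" using continuous_bounded_Icc[OF H] by blast
    show ?thesis
    proof (rule Bochner_Integration.integrable_bound)
      show "integrable lborel (\<lambda>x. B * (indicator {a..b} x *\<^sub>R u x))"
        using locintD[OF u, of a b] by (simp add: set_integrable_def)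
      show "AE x in lborel. norm (indicator {a..b} x * (u x * H x)) \<le> norm (B * (indicator {a..b} x *\<^sub>R u x))"
      proof (intro AE_I2)
        fix x
        have "\<bar>u x\<bar> * \<bar>H x\<bar> \<le> \<bar>u x\<bar> * \<bar>B\<bar>" if "x \<in> {a..b}"
          using B[OF that] by (intro mult_left_mono) auto
        then show "norm (indicator {a..b} x * (u x * H x)) \<le> norm (B * (indicator {a..b} x *\<^sub>R u x))"
          by (cases "x \<in> {a..b}") (auto simp: abs_mult mult.commute)
      qed
    qed simp
  qed
  have "(LINT x|lborel. g' x * (F x - F a)) =
      (LINT x|lborel. indicator {a..b} x * (g x * F x) - F a * (indicator {a..b} x *\<^sub>R g x))"
    by (rule Bochner_Integration.integral_cong) (auto simp: g'_def algebra_simps)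
  also have "\<dots> = (LINT x|lborel. indicator {a..b} x * (g x * F x)) - F a * (G b - G a)"
    using int_mult[OF ac_locint[OF G] ac_continuous[OF F]] locintD[OF ac_locint[OF G], of a b] ac_diff_eq[OF G ab]
    by (subst Bochner_Integration.integral_diff) (auto simp: set_integrable_def set_lebesgue_integral_def)
  finally have e1: "(LINT x|lborel. g' x * (F x - F a)) =
    (LINT x|lborel. indicator {a..b} x * (g x * F x)) - F a * (G b - G a)" .
  have "(LINT x|lborel. w' x * (G b - G x)) =
      (LINT x|lborel. G b * (indicator {a..b} x *\<^sub>R w x) - indicator {a..b} x * (w x * G x))"
    by (rule Bochner_Integration.integral_cong) (auto simp: w'_def algebra_simps)
  also have "\<dots> = G b * (F b - F a) - (LINT x|lborel. indicator {a..b} x * (w x * G x))"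
    using int_mult[OF ac_locint[OF F] ac_continuous[OF G]] locintD[OF ac_locint[OF F], of a b] ac_diff_eq[OF F ab]
    by (subst Bochner_Integration.integral_diff) (auto simp: set_integrable_def set_lebesgue_integral_def)
  finally have e2: "(LINT x|lborel. w' x * (G b - G x)) =
    G b * (F b - F a) - (LINT x|lborel. indicator {a..b} x * (w x * G x))" .
  show ?thesis
    using fub unfolding in1 in2 e1 e2 set_lebesgue_integral_def
    by (simp add: algebra_simps)
qed

text \<open>Integration by parts on a window \<open>{-T..T}\<close> outside of which the test
  function and its derivative vanish; the boundary terms are zero.\<close>

lemma ac_weak_deriv: assumes F: "ac F w" shows "weak_deriv F w"
  unfolding weak_deriv_def
proof (intro conjI allI impI)
  show "set_integrable lborel K F" "set_integrable lborel K w" if "compact K" for K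
    using that locint_continuous[OF ac_continuous[OF F]] ac_locint[OF F] by (auto simp: locint_def)
  fix \<phi> assume \<phi>: "test_fun \<phi>"
  obtain R where R: "0 < R" "\<And>x. R \<le> \<bar>x\<bar> \<Longrightarrow> \<phi> x = 0" using test_fun_support[OF \<phi>] by blast
  obtain Q where Q: "0 < Q" "\<And>x. Q \<le> \<bar>x\<bar> \<Longrightarrow> deriv \<phi> x = 0"
    using test_fun_support[OF test_fun_deriv[OF \<phi>]] by blast
  define T where "T = max R Q"
  have T: "0 < T" "\<And>x. T \<le> \<bar>x\<bar> \<Longrightarrow> \<phi> x = 0" "\<And>x. T \<le> \<bar>x\<bar> \<Longrightarrow> deriv \<phi> x = 0"
    using R Q by (auto simp: T_def)
  have win: "(LINT x|lborel. u x * \<psi> x) = (LINT x:{-T..T}|lborel. u x * \<psi> x)"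
    if "\<And>x. T \<le> \<bar>x\<bar> \<Longrightarrow> \<psi> x = 0" for u \<psi> :: "real \<Rightarrow> real"
    unfolding set_lebesgue_integral_def
  proof (rule Bochner_Integration.integral_cong)
    fix x show "u x * \<psi> x = indicat_real {- T..T} x *\<^sub>R (u x * \<psi> x)"
    proof (cases "x \<in> {-T..T}")
      case False
      then have "T \<le> \<bar>x\<bar>" by auto
      then show ?thesis using that by simp
    qed simp
  qed simp
  have "ac \<phi> (deriv \<phi>)"
    by (rule DERIV_ac[OF test_fun_DERIV[OF \<phi>] test_fun_continuous[OF test_fun_deriv[OF \<phi>]]])
  from ac_integral_by_parts[OF F this, of "-T" T]
  show "(LINT x|lborel. F x * deriv \<phi> x) = - (LINT x|lborel. w x * \<phi> x)"
    using T by (simp add: win)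
qed

text \<open>The primitive that vanishes to the left of the support is constant to the right of it,
  and the zero mean makes this constant zero. So the primitive has compact support.\<close>

lemma test_fun_antideriv:
  assumes \<omega>: "test_fun \<omega>" and z: "(LINT x|lborel. \<omega> x) = 0"
  obtains \<phi> where "test_fun \<phi>" "deriv \<phi> = \<omega>"
proof -
  obtain R where R: "0 < R" "\<And>x. R \<le> \<bar>x\<bar> \<Longrightarrow> \<omega> x = 0" using test_fun_support[OF \<omega>] by blast
  obtain F where F: "ac F \<omega>" using ac_exists[OF locint_continuous[OF test_fun_continuous[OF \<omega>]]] by blast
  define \<phi> where "\<phi> x = F x - F (-R)" for x
  have D: "(\<phi> has_real_derivative \<omega> x) (at x)" for x
    unfolding \<phi>_def using ac_DERIV[OF F test_fun_continuous[OF \<omega>], of x] by (auto intro!: derivative_eq_intros)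
  have out: "F b = F a" if "a \<le> b" "\<And>x. a < x \<Longrightarrow> x < b \<Longrightarrow> R \<le> \<bar>x\<bar>" for a b
  proof -
    have "(LINT t:{a..b}|lborel. \<omega> t) = 0" unfolding set_lebesgue_integral_def
    proof (rule integral_eq_zero_AE)
      show "AE x in lborel. indicat_real {a..b} x *\<^sub>R \<omega> x = 0"
        using AE_lborel_singleton[of a] AE_lborel_singleton[of b]
        by eventually_elim (use that R(2) in \<open>force simp: indicator_def\<close>)
    qed
    then show ?thesis using ac_diff_eq[OF F that(1)] by simp
  qed
  have "(LINT x|lborel. \<omega> x) = (LINT x:{-R..R}|lborel. \<omega> x)"
    unfolding set_lebesgue_integral_def
  proof (rule Bochner_Integration.integral_cong)
    fix x show "\<omega> x = indicat_real {- R..R} x *\<^sub>R \<omega> x"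
    proof (cases "x \<in> {-R..R}")
      case False
      then have "R \<le> \<bar>x\<bar>" by auto
      then show ?thesis using R(2) by simp
    qed simp
  qed simp
  then have RR: "F R = F (-R)" using ac_diff_eq[OF F, of "-R" R] z R(1) by simp
  have "\<phi> x = 0" if "R \<le> \<bar>x\<bar>" for x
  proof (cases "x \<ge> 0")
    case True
    then show ?thesis using out[of R x] that RR by (simp add: \<phi>_def)
  next
    case False
    then show ?thesis using out[of x "-R"] that R(1) by (simp add: \<phi>_def)
  qed
  then have "test_fun \<phi>"
    using smooth_antideriv[OF D] \<omega> by (intro test_funI[of _ R]) (auto simp: test_fun_iff)
  moreover have "deriv \<phi> = \<omega>" using D by (auto intro!: ext DERIV_imp_deriv)
  ultimately show thesis by (rule that)
qed

text \<open>A unit mass on the unit interval. It is the reference mass in the du Bois-Reymond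
  argument, its primitive gives the cutoffs, and it is the profile of the trial state.\<close>

definition mollifier :: "real \<Rightarrow> real" where
  "mollifier x = ibump 0 1 0 x / (LINT x|lborel. ibump 0 1 0 x)"

lemma ibump_integral_pos: "a < b \<Longrightarrow> 0 < (LINT x|lborel. ibump a b n x)"
proof -
  assume ab: "a < b"
  have int: "integrable lborel (ibump a b n)" by (rule test_fun_integrable[OF ibump_test_fun])
  have "(LINT x|lborel. ibump a b n x) \<noteq> 0"
  proof
    assume "(LINT x|lborel. ibump a b n x) = 0"
    then have "AE x in lborel. ibump a b n x = 0"
      using integral_nonneg_eq_0_iff_AE[OF int] ibump_bounds(1) by simp
    then have "AE x in lborel. x \<notin> {a<..<b}"
      by eventually_elim (metis ibump_bounds(4) less_irrefl)
    then have "emeasure lborel {a<..<b} = 0" by (subst (asm) AE_iff_measurable[of "{a<..<b}"]) auto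
    then show False using ab by simp
  qed
  moreover have "0 \<le> (LINT x|lborel. ibump a b n x)"
    by (rule integral_nonneg_AE) (simp add: ibump_bounds)
  ultimately show ?thesis by simp
qed

lemma mollifier:
  "test_fun mollifier" "0 \<le> mollifier x" "(LINT x|lborel. mollifier x) = 1" "x \<notin> {0<..<1} \<Longrightarrow> mollifier x = 0"
proof -
  note pos = ibump_integral_pos[of 0 1 0, simplified]
  show "test_fun mollifier"
    using test_fun_mult[OF smooth_const ibump_test_fun, of "1 / (LINT x|lborel. ibump 0 1 0 x)" 0 1 0]
    by (simp add: mollifier_def[abs_def])
  show "0 \<le> mollifier x" using pos ibump_bounds(1) by (simp add: mollifier_def)
  show "(LINT x|lborel. mollifier x) = 1" using pos by (simp add: mollifier_def)
  show "mollifier x = 0" if "x \<notin> {0<..<1}" using ibump_bounds(3)[OF that] by (simp add: mollifier_def)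
qed

lemma weak_deriv_locint: "weak_deriv u w \<Longrightarrow> locint u" "weak_deriv u w \<Longrightarrow> locint w"
  unfolding weak_deriv_def locint_def by blast+

lemma weak_derivD: "weak_deriv u w \<Longrightarrow> test_fun \<phi> \<Longrightarrow>
    (LINT x|lborel. u x * deriv \<phi> x) = - (LINT x|lborel. w x * \<phi> x)"
  unfolding weak_deriv_def by blast

text \<open>Du Bois-Reymond: a test function minus its integral times the mollifier has zero mean,
  hence is the derivative of a test function and is annihilated by \<open>h\<close>. So
  \<open>h\<close> acts on test functions like the constant \<open>c\<close>, its average against
  the mollifier.\<close>

lemma AE_const_if_weak_deriv_0:
  assumes h: "locint h" and z: "\<And>\<phi>. test_fun \<phi> \<Longrightarrow> (LINT x|lborel. h x * deriv \<phi> x) = 0"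
  shows "\<exists>c. AE x in lborel. h x = c"
proof -
  define c where "c = (LINT x|lborel. h x * mollifier x)"
  have "AE x in lborel. h x - c = 0"
  proof (rule AE_zero_if_test_integrals_zero)
    show "locint (\<lambda>x. h x - c)" by (intro locint_diff h locint_continuous) auto
    fix \<psi> assume \<psi>: "test_fun \<psi>"
    define m where "m = (LINT x|lborel. \<psi> x)"
    define \<omega> where "\<omega> x = \<psi> x - m * mollifier x" for x
    have \<omega>: "test_fun \<omega>"
      unfolding \<omega>_def[abs_def] by (intro test_fun_diff \<psi> test_fun_mult smooth_const mollifier)
    have "(LINT x|lborel. \<omega> x) = 0"
      unfolding \<omega>_def using test_fun_integrable[OF \<psi>] test_fun_integrable[OF mollifier(1)]
      by (simp add: mollifier m_def)
    then obtain \<phi> where "test_fun \<phi>" "deriv \<phi> = \<omega>" using test_fun_antideriv[OF \<omega>] by blast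
    then have "(LINT x|lborel. h x * \<omega> x) = 0" using z by metis
    moreover have "(LINT x|lborel. h x * \<omega> x) = (LINT x|lborel. h x * \<psi> x - m * (h x * mollifier x))"
      by (rule Bochner_Integration.integral_cong) (auto simp: \<omega>_def algebra_simps)
    moreover have "\<dots> = (LINT x|lborel. h x * \<psi> x) - m * c"
      using locint_mult_test_fun[OF h \<psi>] locint_mult_test_fun[OF h mollifier(1)]
      by (simp add: c_def)
    moreover have "(LINT x|lborel. (h x - c) * \<psi> x) = (LINT x|lborel. h x * \<psi> x) - c * m"
      using locint_mult_test_fun[OF h \<psi>] test_fun_integrable[OF \<psi>]
      by (simp add: left_diff_distrib m_def)
    ultimately show "(LINT x|lborel. (h x - c) * \<psi> x) = 0" by (simp add: mult.commute)
  qed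
  then show ?thesis by (intro exI[of _ c]) simp
qed

text \<open>The difference between \<open>u\<close> and a primitive of \<open>w\<close> has weak
  derivative zero, so it is a constant, which the primitive can absorb.\<close>

lemma weak_deriv_ac:
  assumes "weak_deriv u w" obtains F where "ac F w" "AE x in lborel. u x = F x"
proof -
  obtain F where F: "ac F w" using ac_exists weak_deriv_locint(2)[OF assms] by blast
  note lu = weak_deriv_locint(1)[OF assms] and lF = weak_deriv_locint(1)[OF ac_weak_deriv[OF F]]
  have "(LINT x|lborel. (u x - F x) * deriv \<phi> x) = 0" if "test_fun \<phi>" for \<phi>
    using locint_mult_test_fun[OF lu test_fun_deriv[OF that]] locint_mult_test_fun[OF lF test_fun_deriv[OF that]]
    by (simp add: left_diff_distrib weak_derivD[OF assms that] weak_derivD[OF ac_weak_deriv[OF F] that])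
  then obtain c where c: "AE x in lborel. u x - F x = c"
    using AE_const_if_weak_deriv_0[OF locint_diff[OF lu lF]] by blast
  show thesis
  proof
    show "ac (\<lambda>x. F x + c) w" using F by (simp add: ac_def)
    show "AE x in lborel. u x = F x + c" using c by eventually_elim simp
  qed
qed

text \<open>This frees the energy, momentum and norm from the choices hidden in \<open>ux\<close>
  and \<open>uxx\<close>.\<close>

lemma weak_deriv_unique:
  assumes "weak_deriv u w" "weak_deriv u' w'" "AE x in lborel. u x = u' x"
  shows "AE x in lborel. w x = w' x"
proof -
  note [measurable] = locint_measurable[OF weak_deriv_locint(1)[OF assms(1)]]
    locint_measurable[OF weak_deriv_locint(1)[OF assms(2)]]
  have "AE x in lborel. w x - w' x = 0"
  proof (rule AE_zero_if_test_integrals_zero)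
    show "locint (\<lambda>x. w x - w' x)" using weak_deriv_locint assms by (auto intro: locint_diff)
    fix \<psi> assume \<psi>: "test_fun \<psi>"
    have [measurable]: "deriv \<psi> \<in> borel_measurable borel"
      by (rule borel_measurable_continuous_onI[OF test_fun_continuous[OF test_fun_deriv[OF \<psi>]]])
    have "(LINT x|lborel. u x * deriv \<psi> x) = (LINT x|lborel. u' x * deriv \<psi> x)"
      by (rule integral_cong_AE) (use assms(3) in auto)
    then show "(LINT x|lborel. (w x - w' x) * \<psi> x) = 0"
      using weak_derivD[OF assms(1) \<psi>] weak_derivD[OF assms(2) \<psi>]
        locint_mult_test_fun[OF weak_deriv_locint(2)[OF assms(1)] \<psi>]
        locint_mult_test_fun[OF weak_deriv_locint(2)[OF assms(2)] \<psi>]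
      by (simp add: left_diff_distrib)
  qed
  then show ?thesis by simp
qed

section \<open>The space of square integrable functions\<close>

definition nrm :: "(real \<Rightarrow> real) \<Rightarrow> real" where
  "nrm f = sqrt (LINT x|lborel. (f x)\<^sup>2)"

lemma L2_measurable: "L2 f \<Longrightarrow> f \<in> borel_measurable borel"
  by (simp add: L2_def)

lemma L2_sq: "L2 f \<Longrightarrow> integrable lborel (\<lambda>x. (f x)\<^sup>2)"
  by (simp add: L2_def)

lemma L2_mult_integrable: assumes "L2 f" "L2 g" shows "integrable lborel (\<lambda>x. f x * g x)"
proof (rule Bochner_Integration.integrable_bound)
  note [measurable] = L2_measurable[OF assms(1)] L2_measurable[OF assms(2)]
  show "integrable lborel (\<lambda>x. (f x)\<^sup>2 + (g x)\<^sup>2)" using assms by (auto simp: L2_def)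
  show "(\<lambda>x. f x * g x) \<in> borel_measurable lborel" by measurable
  show "AE x in lborel. norm (f x * g x) \<le> norm ((f x)\<^sup>2 + (g x)\<^sup>2)"
  proof (intro AE_I2)
    fix x
    have "2 * (\<bar>f x\<bar> * \<bar>g x\<bar>) \<le> (f x)\<^sup>2 + (g x)\<^sup>2"
      using sum_squares_bound[of "\<bar>f x\<bar>" "\<bar>g x\<bar>"] by simp
    moreover have "0 \<le> \<bar>f x\<bar> * \<bar>g x\<bar>" by simp
    ultimately show "norm (f x * g x) \<le> norm ((f x)\<^sup>2 + (g x)\<^sup>2)"
      unfolding real_norm_def abs_mult by linarith
  qed
qed

lemma L2_lin: assumes "L2 f" "L2 g" shows "L2 (\<lambda>x. a * f x + b * g x)"
proof -
  note [measurable] = L2_measurable[OF assms(1)] L2_measurable[OF assms(2)]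
  have "integrable lborel (\<lambda>x. a\<^sup>2 * (f x)\<^sup>2 + (2 * a * b) * (f x * g x) + b\<^sup>2 * (g x)\<^sup>2)"
    using L2_sq[OF assms(1)] L2_sq[OF assms(2)] L2_mult_integrable[OF assms] by auto
  then show ?thesis by (simp add: L2_def power2_sum power_mult_distrib algebra_simps)
qed

lemma L2_add: "L2 f \<Longrightarrow> L2 g \<Longrightarrow> L2 (\<lambda>x. f x + g x)"
  using L2_lin[of f g 1 1] by simp

lemma L2_diff: "L2 f \<Longrightarrow> L2 g \<Longrightarrow> L2 (\<lambda>x. f x - g x)"
  using L2_lin[of f g 1 "-1"] by simp

lemma L2_cmult: "L2 f \<Longrightarrow> L2 (\<lambda>x. a * f x)"
  using L2_lin[of f f a 0] by simp

lemma L2_bounded_mult: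
  assumes "L2 f" "g \<in> borel_measurable borel" "\<And>x. \<bar>g x\<bar> \<le> B"
  shows "L2 (\<lambda>x. g x * f x)"
proof -
  note [measurable] = L2_measurable[OF assms(1)] assms(2)
  have "integrable lborel (\<lambda>x. (g x * f x)\<^sup>2)"
  proof (rule Bochner_Integration.integrable_bound)
    show "integrable lborel (\<lambda>x. B\<^sup>2 * (f x)\<^sup>2)" using assms(1) by (auto simp: L2_def)
    show "AE x in lborel. norm ((g x * f x)\<^sup>2) \<le> norm (B\<^sup>2 * (f x)\<^sup>2)"
    proof (intro AE_I2)
      fix x have "(g x)\<^sup>2 \<le> B\<^sup>2" using assms(3)[of x] abs_le_square_iff[of "g x" B] by linarith
      then show "norm ((g x * f x)\<^sup>2) \<le> norm (B\<^sup>2 * (f x)\<^sup>2)"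
        by (auto simp: power_mult_distrib intro: mult_right_mono)
    qed
  qed measurable
  then show ?thesis by (simp add: L2_def)
qed

lemma L2_AE_cong: assumes "L2 f" "g \<in> borel_measurable borel" "AE x in lborel. f x = g x" shows "L2 g"
proof -
  note [measurable] = L2_measurable[OF assms(1)] assms(2)
  have "integrable lborel (\<lambda>x. (f x)\<^sup>2) \<longleftrightarrow> integrable lborel (\<lambda>x. (g x)\<^sup>2)"
    by (rule integrable_cong_AE) (use assms(3) in auto)
  then show ?thesis using assms(1,2) by (simp add: L2_def)
qed

lemma L2_shift: assumes "L2 f" shows "L2 (\<lambda>x. f (x - t))"
proof -
  note [measurable] = L2_measurable[OF assms(1)]
  show ?thesis using lborel_integrable_real_affine[OF L2_sq[OF assms], of 1 "-t"] by (simp add: L2_def)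
qed

lemma integral_shift:
  fixes f :: "real \<Rightarrow> real"
  shows "(LINT x|lborel. f (x - t)) = (LINT x|lborel. f x)"
  using lborel_integral_real_affine[of 1 f "-t"] by simp

lemma integral_sq_nonneg: "0 \<le> (LINT x|M. (f x :: real)\<^sup>2)"
  by (rule integral_nonneg_AE) simp

lemma nrm_sq: "(nrm f)\<^sup>2 = (LINT x|lborel. (f x)\<^sup>2)"
  by (simp add: nrm_def integral_sq_nonneg)

lemma nrm_nonneg: "0 \<le> nrm f"
  by (simp add: nrm_def integral_sq_nonneg)

lemma integral_lin_sq:
  assumes "L2 f" "L2 g"
  shows "(LINT x|lborel. (a * f x + b * g x)\<^sup>2)
    = a\<^sup>2 * (LINT x|lborel. (f x)\<^sup>2) + 2 * a * b * (LINT x|lborel. f x * g x) + b\<^sup>2 * (LINT x|lborel. (g x)\<^sup>2)"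
proof -
  have "(LINT x|lborel. (a * f x + b * g x)\<^sup>2)
     = (LINT x|lborel. a\<^sup>2 * (f x)\<^sup>2 + (2 * a * b) * (f x * g x) + b\<^sup>2 * (g x)\<^sup>2)"
    by (rule Bochner_Integration.integral_cong) (auto simp: power2_sum power_mult_distrib algebra_simps)
  also have "\<dots> = a\<^sup>2 * (LINT x|lborel. (f x)\<^sup>2) + 2 * a * b * (LINT x|lborel. f x * g x) + b\<^sup>2 * (LINT x|lborel. (g x)\<^sup>2)"
    using L2_sq[OF assms(1)] L2_sq[OF assms(2)] L2_mult_integrable[OF assms] by simp
  finally show ?thesis .
qed

lemma L2_Cauchy_Schwarz:
  assumes "L2 f" "L2 g" shows "\<bar>LINT x|lborel. f x * g x\<bar> \<le> nrm f * nrm g"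
proof -
  define A where "A = (LINT x|lborel. (f x)\<^sup>2)"
  define B where "B = (LINT x|lborel. f x * g x)"
  define C where "C = (LINT x|lborel. (g x)\<^sup>2)"
  have q: "0 \<le> A + 2 * t * B + t\<^sup>2 * C" for t
    using integral_lin_sq[OF assms, of 1 t] integral_sq_nonneg[of lborel "\<lambda>x. 1 * f x + t * g x"]
    by (simp add: A_def B_def C_def)
  have C0: "0 \<le> C" unfolding C_def by (rule integral_sq_nonneg)
  have "B\<^sup>2 \<le> A * C"
  proof (cases "C = 0")
    case True
    have "B = 0"
    proof (rule ccontr)
      assume "B \<noteq> 0"
      \<comment> \<open>If \<open>C = 0\<close>, the form is affine in \<open>t\<close>, and this
        value of \<open>t\<close> would make it equal to \<open>-1\<close>.\<close>
      then have "2 * (- (A + 1) / (2 * B)) * B = - (A + 1)" by simp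
      then show False using q[of "- (A + 1) / (2 * B)"] True by simp
    qed
    then show ?thesis using True by simp
  next
    case False
    then have "0 < C" using C0 by simp
    have "0 \<le> C * (A + 2 * (- B / C) * B + (- B / C)\<^sup>2 * C)" using q[of "- B / C"] C0 by simp
    also have "\<dots> = A * C - B\<^sup>2" using \<open>0 < C\<close> by (simp add: field_simps power2_eq_square)
    finally show ?thesis by simp
  qed
  then have "sqrt (B\<^sup>2) \<le> sqrt (A * C)" by (rule real_sqrt_le_mono)
  then show ?thesis by (simp add: nrm_def A_def B_def C_def real_sqrt_mult)
qed

lemma nrm_triangle: assumes "L2 f" "L2 g" shows "nrm (\<lambda>x. f x + g x) \<le> nrm f + nrm g"
proof (rule power2_le_imp_le)
  have "(nrm (\<lambda>x. f x + g x))\<^sup>2 = (nrm f)\<^sup>2 + 2 * (LINT x|lborel. f x * g x) + (nrm g)\<^sup>2"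
    using integral_lin_sq[OF assms, of 1 1] by (simp add: nrm_sq)
  then show "(nrm (\<lambda>x. f x + g x))\<^sup>2 \<le> (nrm f + nrm g)\<^sup>2"
    using L2_Cauchy_Schwarz[OF assms] by (simp add: power2_sum)
qed (simp add: nrm_nonneg)

lemma nrm_cong_AE: assumes "f \<in> borel_measurable borel" "g \<in> borel_measurable borel" "AE x in lborel. f x = g x" shows "nrm f = nrm g"
proof -
  note [measurable] = assms(1,2)
  have "(LINT x|lborel. (f x)\<^sup>2) = (LINT x|lborel. (g x)\<^sup>2)"
    by (rule integral_cong_AE) (use assms(3) in auto)
  then show ?thesis by (simp add: nrm_def)
qed

lemma L2_indicator: assumes "A \<in> sets borel" "emeasure lborel A < \<infinity>" shows "L2 (indicator A)"
  unfolding L2_def using assms by (auto simp: power2_eq_square indicator_inter_arith[symmetric])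

lemma L2_locint: assumes "L2 f" shows "locint f"
  unfolding locint_def
proof (intro allI impI)
  fix K :: "real set" assume K: "compact K"
  show "set_integrable lborel K f"
    using L2_mult_integrable[OF L2_indicator[OF borel_compact[OF K] emeasure_compact_finite[OF K]] assms]
    by (simp add: set_integrable_def)
qed

lemma L2_interval_integral_bound:
  assumes "L2 f" "a \<le> b" shows "\<bar>LINT t:{a..b}|lborel. f t\<bar> \<le> sqrt (b - a) * nrm f"
proof -
  have "nrm (indicator {a..b}) = sqrt (b - a)"
    using assms(2) by (simp add: nrm_def power2_eq_square indicator_inter_arith[symmetric])
  then show ?thesis
    using L2_Cauchy_Schwarz[OF L2_indicator[of "{a..b}"] assms(1)] assms(2) by (simp add: set_lebesgue_integral_def)
qed

lemma L2_test_fun: assumes "test_fun \<phi>" shows "L2 \<phi>"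
  unfolding L2_def
proof
  show "\<phi> \<in> borel_measurable lborel"
    using borel_measurable_continuous_onI[OF test_fun_continuous[OF assms]] by simp
  show "integrable lborel (\<lambda>x. (\<phi> x)\<^sup>2)"
    using locint_mult_test_fun[OF locint_continuous[OF test_fun_continuous[OF assms]] assms]
    by (simp add: power2_eq_square)
qed

section \<open>Completeness of the space of square integrable functions\<close>

lemma ennreal_le_suminf: "(a k :: ennreal) \<le> (\<Sum>k. a k)"
proof -
  have "sum a {k} \<le> (\<Sum>k. a k)" by (rule sum_le_suminf) auto
  then show ?thesis by simp
qed

text \<open>Riesz-Fischer. Along a subsequence the squared increments integrate to at most
  \<open>(1/4) ^ k\<close>; with weights \<open>2 ^ k\<close> their sum is still integrable, so
  almost everywhere the increments are bounded by a multiple of \<open>(1 / sqrt 2) ^ k\<close>.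
  Fatou's lemma then carries the Cauchy estimate over to the limit, for the whole sequence.\<close>

lemma L2_complete:
  assumes f: "\<And>n. L2 (f n)"
    and Cauchy: "\<And>e. 0 < e \<Longrightarrow> \<exists>N. \<forall>m\<ge>N. \<forall>n\<ge>N. (LINT x|lborel. (f m x - f n x)\<^sup>2) < e"
  shows "\<exists>g. L2 g \<and> (\<lambda>n. nrm (\<lambda>x. f n x - g x)) \<longlonglongrightarrow> 0"
proof -
  note [measurable] = L2_measurable[OF f]
  have "\<exists>N. \<forall>m\<ge>N. \<forall>n\<ge>N. (LINT x|lborel. (f m x - f n x)\<^sup>2) < (1/4) ^ k" for k
    by (rule Cauchy) simp
  then obtain N where N: "\<And>k m n. N k \<le> m \<Longrightarrow> N k \<le> n \<Longrightarrow> (LINT x|lborel. (f m x - f n x)\<^sup>2) < (1/4) ^ k"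
    by metis
  \<comment> \<open>Summing the \<open>N i\<close> makes \<open>r j\<close> large enough for every
    \<open>k \<le> j\<close>; the extra summand gives \<open>k \<le> r k\<close>, which the Fatou
    step needs.\<close>
  define r where "r k = (\<Sum>i\<le>k. N i) + k" for k
  have rN: "N k \<le> r j" if "k \<le> j" for k j
  proof -
    have "N k \<le> (\<Sum>i\<le>j. N i)" using that by (intro member_le_sum) auto
    then show ?thesis by (simp add: r_def)
  qed
  define d where "d k x = f (r (Suc k)) x - f (r k) x" for k x
  have [measurable]: "d k \<in> borel_measurable borel" for k unfolding d_def by measurable
  have d: "L2 (d k)" for k unfolding d_def[abs_def] by (intro L2_diff f)
  have dint: "(\<integral>\<^sup>+x. ennreal (2 ^ k * (d k x)\<^sup>2) \<partial>lborel) \<le> ennreal ((1/2) ^ k)" for k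
  proof -
    have "(\<integral>\<^sup>+x. ennreal (2 ^ k * (d k x)\<^sup>2) \<partial>lborel) = ennreal (LINT x|lborel. 2 ^ k * (d k x)\<^sup>2)"
      by (rule nn_integral_eq_integral) (use L2_sq[OF d] in auto)
    also have "(LINT x|lborel. 2 ^ k * (d k x)\<^sup>2) \<le> 2 ^ k * (1/4) ^ k"
      using N[OF rN[of k "Suc k"] rN[of k k]] by (simp add: d_def less_imp_le)
    also have "2 ^ k * (1/4) ^ k = ((1/2) ^ k :: real)"
      by (simp add: power_mult_distrib[symmetric])
    finally show ?thesis by (simp add: ennreal_leI)
  qed
  have "(\<integral>\<^sup>+x. (\<Sum>k. ennreal (2 ^ k * (d k x)\<^sup>2)) \<partial>lborel) = (\<Sum>k. \<integral>\<^sup>+x. ennreal (2 ^ k * (d k x)\<^sup>2) \<partial>lborel)"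
    by (rule nn_integral_suminf) measurable
  also have "\<dots> \<le> (\<Sum>k. ennreal ((1/2) ^ k))"
    by (intro suminf_le dint) auto
  also have "\<dots> = ennreal (\<Sum>k. (1/2) ^ k)"
    by (rule suminf_ennreal2) auto
  finally have "(\<integral>\<^sup>+x. (\<Sum>k. ennreal (2 ^ k * (d k x)\<^sup>2)) \<partial>lborel) \<noteq> \<infinity>"
    by (auto simp: top_unique)
  then have fin: "AE x in lborel. (\<Sum>k. ennreal (2 ^ k * (d k x)\<^sup>2)) \<noteq> \<infinity>"
    by (intro nn_integral_noteq_infinite) auto
  define g where "g x = lim (\<lambda>k. f (r k) x)" for x
  have [measurable]: "g \<in> borel_measurable borel" unfolding g_def[abs_def] by measurable
  have conv: "AE x in lborel. (\<lambda>k. f (r k) x) \<longlonglongrightarrow> g x"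
    using fin
  proof eventually_elim
    case (elim x)
    then obtain C where C: "(\<Sum>k. ennreal (2 ^ k * (d k x)\<^sup>2)) = ennreal C" "0 \<le> C"
      by (metis ennreal_cases infinity_ennreal_def)
    have le: "\<bar>d k x\<bar> \<le> sqrt C * (1 / sqrt 2) ^ k" for k
    proof -
      have "ennreal (2 ^ k * (d k x)\<^sup>2) \<le> (\<Sum>k. ennreal (2 ^ k * (d k x)\<^sup>2))"
        by (rule ennreal_le_suminf[where a="\<lambda>k. ennreal (2 ^ k * (d k x)\<^sup>2)"])
      also have "\<dots> = ennreal C" by (rule C(1))
      finally have "2 ^ k * (d k x)\<^sup>2 \<le> C" unfolding ennreal_le_iff[OF C(2)] .
      then have "sqrt (2 ^ k * (d k x)\<^sup>2) \<le> sqrt C" by simp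
      moreover have "sqrt (2 ^ k * (d k x)\<^sup>2) = sqrt 2 ^ k * \<bar>d k x\<bar>"
        by (simp add: real_sqrt_mult real_sqrt_power[of 2 k])
      ultimately show ?thesis by (simp add: field_simps)
    qed
    have "summable (\<lambda>k. d k x)"
    proof (rule summable_comparison_test')
      show "summable (\<lambda>k. sqrt C * (1 / sqrt 2) ^ k)"
        by (intro summable_mult summable_geometric) simp
    qed (use le in simp)
    then have "convergent (\<lambda>n. \<Sum>k<n. d k x)" by (simp add: summable_iff_convergent)
    then have "convergent (\<lambda>n. f (r n) x - f (r 0) x)" 
      by (simp add: d_def sum_lessThan_telescope[of "\<lambda>k. f (r k) x"])
    then have "convergent (\<lambda>n. (f (r n) x - f (r 0) x) + f (r 0) x)"
      by (rule convergent_add) (rule convergent_const)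
    then show ?case unfolding g_def by (simp add: convergent_LIMSEQ_iff)
  qed
  have fatou: "integrable lborel (\<lambda>x. (f n x - g x)\<^sup>2) \<and> (LINT x|lborel. (f n x - g x)\<^sup>2) \<le> e"
    if e: "0 < e" and K: "\<forall>m\<ge>K. \<forall>n\<ge>K. (LINT x|lborel. (f m x - f n x)\<^sup>2) < e" and n: "K \<le> n" for e K n
  proof -
    have "(\<integral>\<^sup>+x. ennreal ((f n x - g x)\<^sup>2) \<partial>lborel)
        = (\<integral>\<^sup>+x. liminf (\<lambda>k. ennreal ((f n x - f (r k) x)\<^sup>2)) \<partial>lborel)"
    proof (rule nn_integral_cong_AE)
      show "AE x in lborel. ennreal ((f n x - g x)\<^sup>2) = liminf (\<lambda>k. ennreal ((f n x - f (r k) x)\<^sup>2))"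
        using conv
      proof eventually_elim
        case (elim x)
        have "(\<lambda>k. ennreal ((f n x - f (r k) x)\<^sup>2)) \<longlonglongrightarrow> ennreal ((f n x - g x)\<^sup>2)"
          by (intro tendsto_intros elim tendsto_ennrealI)
        then show ?case by (intro lim_imp_Liminf[symmetric]) auto
      qed
    qed
    also have "\<dots> \<le> liminf (\<lambda>k. \<integral>\<^sup>+x. ennreal ((f n x - f (r k) x)\<^sup>2) \<partial>lborel)"
      by (rule nn_integral_liminf) measurable
    also have "\<dots> \<le> liminf (\<lambda>k. ennreal e)"
    proof (rule Liminf_mono, rule eventually_sequentiallyI[of K])
      fix k assume k: "K \<le> k"
      then have "K \<le> r k" by (simp add: r_def)
      then have "(LINT x|lborel. (f n x - f (r k) x)\<^sup>2) \<le> e" using K n by (simp add: less_imp_le)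
      moreover have "(\<integral>\<^sup>+x. ennreal ((f n x - f (r k) x)\<^sup>2) \<partial>lborel) = ennreal (LINT x|lborel. (f n x - f (r k) x)\<^sup>2)"
        by (rule nn_integral_eq_integral) (use L2_sq[OF L2_diff[OF f f]] in auto)
      ultimately show "(\<integral>\<^sup>+x. ennreal ((f n x - f (r k) x)\<^sup>2) \<partial>lborel) \<le> ennreal e"
        by (simp add: ennreal_leI)
    qed
    also have "\<dots> = ennreal e" by (rule Liminf_const) simp
    finally have le: "(\<integral>\<^sup>+x. ennreal ((f n x - g x)\<^sup>2) \<partial>lborel) \<le> ennreal e" .
    then have int: "integrable lborel (\<lambda>x. (f n x - g x)\<^sup>2)"
      by (intro integrableI_bounded) (auto simp: top_unique less_top[symmetric])
    have "ennreal (LINT x|lborel. (f n x - g x)\<^sup>2) \<le> ennreal e"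
      using le nn_integral_eq_integral[OF int] by simp
    then show ?thesis using int e by (simp add: ennreal_le_iff less_imp_le)
  qed
  obtain K where K: "\<forall>m\<ge>K. \<forall>n\<ge>K. (LINT x|lborel. (f m x - f n x)\<^sup>2) < 1" using Cauchy[of 1] by auto
  have "L2 (\<lambda>x. f K x - g x)" using fatou[OF _ K, of K] by (simp add: L2_def)
  then have g: "L2 g" using L2_diff[OF f[of K]] by fastforce
  have "(\<lambda>n. (LINT x|lborel. (f n x - g x)\<^sup>2)) \<longlonglongrightarrow> 0"
  proof (rule LIMSEQ_I)
    fix e :: real assume "0 < e"
    then obtain K where K: "\<forall>m\<ge>K. \<forall>n\<ge>K. (LINT x|lborel. (f m x - f n x)\<^sup>2) < e / 2" using Cauchy[of "e/2"] by auto
    have "norm ((LINT x|lborel. (f n x - g x)\<^sup>2) - 0) < e" if "K \<le> n" for n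
      using fatou[OF _ K that] \<open>0 < e\<close> integral_sq_nonneg[of lborel "\<lambda>x. f n x - g x"] by simp
    then show "\<exists>K. \<forall>n\<ge>K. norm ((LINT x|lborel. (f n x - g x)\<^sup>2) - 0) < e" by blast
  qed
  from tendsto_real_sqrt[OF this] show ?thesis using g by (auto simp: nrm_def)
qed

section \<open>Sobolev functions\<close>

text \<open>\<open>H2\<close> with the derivatives as arguments, so that combinations, products with
  cutoffs and limits can name their derivatives.\<close>

definition sobolev2 :: "(real \<Rightarrow> real) \<Rightarrow> (real \<Rightarrow> real) \<Rightarrow> (real \<Rightarrow> real) \<Rightarrow> bool" where
  "sobolev2 u u1 u2 \<longleftrightarrow> L2 u \<and> L2 u1 \<and> L2 u2 \<and> weak_deriv u u1 \<and> weak_deriv u1 u2"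

lemma sobolev2D: "sobolev2 u u1 u2 \<Longrightarrow> L2 u" "sobolev2 u u1 u2 \<Longrightarrow> L2 u1" "sobolev2 u u1 u2 \<Longrightarrow> L2 u2"
  "sobolev2 u u1 u2 \<Longrightarrow> weak_deriv u u1" "sobolev2 u u1 u2 \<Longrightarrow> weak_deriv u1 u2"
  by (auto simp only: sobolev2_def)

lemma H2_iff: "H2 u \<longleftrightarrow> (\<exists>u1 u2. sobolev2 u u1 u2)"
  unfolding H2_def sobolev2_def by blast

lemma sobolev2_ux_uxx: assumes "H2 u" shows "sobolev2 u (ux u) (uxx u)"
proof -
  have u: "L2 u" using assms unfolding H2_def by blast
  have "\<exists>u1. L2 u1 \<and> weak_deriv u u1 \<and> (\<exists>u2. L2 u2 \<and> weak_deriv u1 u2)"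
    using assms unfolding H2_def by blast
  then have 1: "L2 (ux u) \<and> weak_deriv u (ux u) \<and> (\<exists>u2. L2 u2 \<and> weak_deriv (ux u) u2)"
    unfolding ux_def by (rule someI_ex)
  then have "\<exists>u2. L2 u2 \<and> weak_deriv (ux u) u2" by blast
  then have "L2 (uxx u) \<and> weak_deriv (ux u) (uxx u)"
    unfolding uxx_def by (rule someI_ex)
  with 1 u show ?thesis unfolding sobolev2_def by blast
qed

lemma sobolev2_unique:
  assumes "sobolev2 u u1 u2" "sobolev2 w w1 w2" "AE x in lborel. u x = w x"
  shows "AE x in lborel. u1 x = w1 x" "AE x in lborel. u2 x = w2 x"
proof -
  show 1: "AE x in lborel. u1 x = w1 x"
    by (rule weak_deriv_unique[OF sobolev2D(4)[OF assms(1)] sobolev2D(4)[OF assms(2)] assms(3)])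
  show "AE x in lborel. u2 x = w2 x"
    by (rule weak_deriv_unique[OF sobolev2D(5)[OF assms(1)] sobolev2D(5)[OF assms(2)] 1])
qed

lemma weak_derivI:
  assumes "locint u" "locint w"
    "\<And>\<phi>. test_fun \<phi> \<Longrightarrow> (LINT x|lborel. u x * deriv \<phi> x) = - (LINT x|lborel. w x * \<phi> x)"
  shows "weak_deriv u w"
  using assms unfolding weak_deriv_def locint_def by blast

lemma weak_deriv_AE_cong:
  assumes "weak_deriv u w" "u' \<in> borel_measurable borel" "AE x in lborel. u x = u' x"
  shows "weak_deriv u' w"
proof -
  note [measurable] = assms(2) locint_measurable[OF weak_deriv_locint(1)[OF assms(1)]]
  show ?thesis
  proof (rule weak_derivI)
    show "locint u'" unfolding locint_def
    proof (intro allI impI)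
      fix K :: "real set" assume K: "compact K"
      have [measurable]: "K \<in> sets borel" by (rule borel_compact[OF K])
      have "set_integrable lborel K u \<longleftrightarrow> set_integrable lborel K u'"
        unfolding set_integrable_def by (rule integrable_cong_AE) (use assms(3) in auto)
      then show "set_integrable lborel K u'"
        using weak_deriv_locint(1)[OF assms(1)] K unfolding locint_def by blast
    qed
    show "locint w" by (rule weak_deriv_locint(2)[OF assms(1)])
    fix \<phi> assume \<phi>: "test_fun \<phi>"
    have [measurable]: "deriv \<phi> \<in> borel_measurable borel"
      by (rule borel_measurable_continuous_onI[OF test_fun_continuous[OF test_fun_deriv[OF \<phi>]]])
    have "(LINT x|lborel. u x * deriv \<phi> x) = (LINT x|lborel. u' x * deriv \<phi> x)"
      by (rule integral_cong_AE) (use assms(3) in auto)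
    then show "(LINT x|lborel. u' x * deriv \<phi> x) = - (LINT x|lborel. w x * \<phi> x)"
      using weak_derivD[OF assms(1) \<phi>] by simp
  qed
qed

lemma sobolev2_AE_cong:
  assumes "sobolev2 u u1 u2" "u' \<in> borel_measurable borel" "AE x in lborel. u x = u' x"
  shows "sobolev2 u' u1 u2"
  unfolding sobolev2_def
  using L2_AE_cong[OF sobolev2D(1)[OF assms(1)] assms(2,3)]
    weak_deriv_AE_cong[OF sobolev2D(4)[OF assms(1)] assms(2,3)] sobolev2D[OF assms(1)] by blast

lemma weak_deriv_lin:
  assumes "weak_deriv u w" "weak_deriv u' w'"
  shows "weak_deriv (\<lambda>x. a * u x + b * u' x) (\<lambda>x. a * w x + b * w' x)"
proof -
  note l = weak_deriv_locint[OF assms(1)] weak_deriv_locint[OF assms(2)]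
  have li: "locint (\<lambda>x. a * p x + b * q x)" if "locint p" "locint q" for p q
    using that by (simp add: locint_def)
  show ?thesis
  proof (rule weak_derivI)
    show "locint (\<lambda>x. a * u x + b * u' x)" "locint (\<lambda>x. a * w x + b * w' x)" by (intro li l)+
    fix \<phi> assume \<phi>: "test_fun \<phi>"
    have e: "(LINT x|lborel. (a * p x + b * q x) * \<psi> x)
        = a * (LINT x|lborel. p x * \<psi> x) + b * (LINT x|lborel. q x * \<psi> x)"
      if "locint p" "locint q" "test_fun \<psi>" for p q \<psi>
    proof -
      have "(LINT x|lborel. (a * p x + b * q x) * \<psi> x) = (LINT x|lborel. a * (p x * \<psi> x) + b * (q x * \<psi> x))"
        by (rule Bochner_Integration.integral_cong) (auto simp: algebra_simps)
      then show ?thesis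
        using locint_mult_test_fun[OF that(1,3)] locint_mult_test_fun[OF that(2,3)] by simp
    qed
    show "(LINT x|lborel. (a * u x + b * u' x) * deriv \<phi> x) = - (LINT x|lborel. (a * w x + b * w' x) * \<phi> x)"
      using weak_derivD[OF assms(1) \<phi>] weak_derivD[OF assms(2) \<phi>]
      by (simp add: e l \<phi> test_fun_deriv)
  qed
qed

lemma sobolev2_lin:
  assumes "sobolev2 u u1 u2" "sobolev2 w w1 w2"
  shows "sobolev2 (\<lambda>x. a * u x + b * w x) (\<lambda>x. a * u1 x + b * w1 x) (\<lambda>x. a * u2 x + b * w2 x)"
  unfolding sobolev2_def
  by (intro conjI L2_lin weak_deriv_lin sobolev2D[OF assms(1)] sobolev2D[OF assms(2)])

lemma sobolev2_diff:
  assumes "sobolev2 u u1 u2" "sobolev2 w w1 w2"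
  shows "sobolev2 (\<lambda>x. u x - w x) (\<lambda>x. u1 x - w1 x) (\<lambda>x. u2 x - w2 x)"
  using sobolev2_lin[OF assms, of 1 "-1"] by simp

lemma weak_deriv_shift:
  assumes "weak_deriv u w" "L2 u" "L2 w" shows "weak_deriv (\<lambda>x. u (x - t)) (\<lambda>x. w (x - t))"
proof (rule weak_derivI)
  show "locint (\<lambda>x. u (x - t))" "locint (\<lambda>x. w (x - t))" using assms by (auto intro: L2_locint L2_shift)
  fix \<phi> assume \<phi>: "test_fun \<phi>"
  have d: "deriv (\<lambda>x. \<phi> (x + t)) x = deriv \<phi> (x + t)" for x
    by (rule DERIV_imp_deriv)
      (use DERIV_shift[of \<phi> "deriv \<phi> (x + t)" x t] test_fun_DERIV[OF \<phi>, of "x + t"] in auto)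
  have "(LINT x|lborel. u (x - t) * deriv \<phi> x) = (LINT x|lborel. u x * deriv (\<lambda>x. \<phi> (x + t)) x)"
    unfolding d using integral_shift[of "\<lambda>x. u x * deriv \<phi> (x + t)" t] by simp
  also have "(LINT x|lborel. u x * deriv (\<lambda>x. \<phi> (x + t)) x) = - (LINT x|lborel. w x * \<phi> (x + t))"
    by (rule weak_derivD[OF assms(1) test_fun_shift[OF \<phi>]])
  also have "(LINT x|lborel. w x * \<phi> (x + t)) = (LINT x|lborel. w (x - t) * \<phi> x)"
    using integral_shift[of "\<lambda>x. w x * \<phi> (x + t)" t] by simp
  finally show "(LINT x|lborel. u (x - t) * deriv \<phi> x) = - (LINT x|lborel. w (x - t) * \<phi> x)" .
qed

lemma sobolev2_shift:
  assumes "sobolev2 u u1 u2" shows "sobolev2 (\<lambda>x. u (x - t)) (\<lambda>x. u1 (x - t)) (\<lambda>x. u2 (x - t))"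
  unfolding sobolev2_def
  by (intro conjI L2_shift weak_deriv_shift sobolev2D[OF assms])

text \<open>Product rule by duality: test the weak derivative of \<open>u\<close> with
  \<open>s * \<phi>\<close> and move the term containing \<open>deriv s\<close> to the other
  side.\<close>

lemma weak_deriv_mult_smooth:
  assumes u: "weak_deriv u w" and s: "smooth s"
  shows "weak_deriv (\<lambda>x. s x * u x) (\<lambda>x. s x * w x + deriv s x * u x)"
proof -
  note l = weak_deriv_locint[OF u]
  have mult: "locint (\<lambda>x. p x * v x)" if "smooth p" "locint v" for p v
    unfolding locint_def
  proof (intro allI impI)
    fix K :: "real set" assume K: "compact K"
    note [measurable] = locint_measurable[OF that(2)]
    have [measurable]: "p \<in> borel_measurable borel" "K \<in> sets borel"
      using borel_measurable_continuous_onI[OF smooth_continuous[OF that(1)]] borel_compact[OF K] by auto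
    have "bounded (p ` K)" by (intro compact_imp_bounded compact_continuous_image smooth_continuous that K)
    then obtain B where B: "\<And>x. x \<in> K \<Longrightarrow> \<bar>p x\<bar> \<le> B" by (metis bounded_iff imageI real_norm_def)
    show "set_integrable lborel K (\<lambda>x. p x * v x)" unfolding set_integrable_def
    proof (rule Bochner_Integration.integrable_bound)
      show "integrable lborel (\<lambda>x. B * (indicator K x *\<^sub>R v x))"
        using that(2) K by (simp add: locint_def set_integrable_def)
      show "AE x in lborel. norm (indicat_real K x *\<^sub>R (p x * v x)) \<le> norm (B * (indicator K x *\<^sub>R v x))"
      proof (intro AE_I2)
        fix x
        have "\<bar>p x\<bar> * \<bar>v x\<bar> \<le> \<bar>B\<bar> * \<bar>v x\<bar>" if "x \<in> K"
          using B[OF that] by (intro mult_right_mono) auto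
        then show "norm (indicat_real K x *\<^sub>R (p x * v x)) \<le> norm (B * (indicator K x *\<^sub>R v x))"
          by (cases "x \<in> K") (auto simp: abs_mult)
      qed
    qed measurable
  qed
  show ?thesis
  proof (rule weak_derivI)
    show "locint (\<lambda>x. s x * u x)" by (rule mult[OF s l(1)])
    have "locint (\<lambda>x. s x * w x)" "locint (\<lambda>x. deriv s x * u x)"
      by (rule mult[OF s l(2)], rule mult[OF smooth_deriv[OF s] l(1)])
    then show "locint (\<lambda>x. s x * w x + deriv s x * u x)" by (simp add: locint_def)
    fix \<phi> assume \<phi>: "test_fun \<phi>"
    have t1: "test_fun (\<lambda>x. s x * \<phi> x)" "test_fun (\<lambda>x. deriv s x * \<phi> x)"
      by (intro test_fun_mult s smooth_deriv \<phi>)+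
    have d: "deriv (\<lambda>x. s x * \<phi> x) x = s x * deriv \<phi> x + deriv s x * \<phi> x" for x
      by (rule DERIV_imp_deriv)
        (auto intro!: derivative_eq_intros smooth_DERIV[OF s] test_fun_DERIV[OF \<phi>] simp: algebra_simps)
    have i1: "integrable lborel (\<lambda>x. u x * deriv (\<lambda>x. s x * \<phi> x) x)"
      by (rule locint_mult_test_fun[OF l(1) test_fun_deriv[OF t1(1)]])
    have i2: "integrable lborel (\<lambda>x. u x * (deriv s x * \<phi> x))"
      by (rule locint_mult_test_fun[OF l(1) t1(2)])
    have i3: "integrable lborel (\<lambda>x. w x * (s x * \<phi> x))"
      by (rule locint_mult_test_fun[OF l(2) t1(1)])
    have "(LINT x|lborel. (s x * u x) * deriv \<phi> x)
      = (LINT x|lborel. u x * deriv (\<lambda>x. s x * \<phi> x) x - u x * (deriv s x * \<phi> x))"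
      unfolding d by (rule Bochner_Integration.integral_cong) (auto simp: algebra_simps)
    also have "\<dots> = - (LINT x|lborel. w x * (s x * \<phi> x)) - (LINT x|lborel. u x * (deriv s x * \<phi> x))"
      unfolding Bochner_Integration.integral_diff[OF i1 i2] weak_derivD[OF u t1(1)] ..
    also have "\<dots> = - (LINT x|lborel. w x * (s x * \<phi> x) + u x * (deriv s x * \<phi> x))"
      unfolding Bochner_Integration.integral_add[OF i3 i2] by simp
    also have "(LINT x|lborel. w x * (s x * \<phi> x) + u x * (deriv s x * \<phi> x)) = (LINT x|lborel. (s x * w x + deriv s x * u x) * \<phi> x)"
      by (rule Bochner_Integration.integral_cong) (auto simp: algebra_simps)
    finally show "(LINT x|lborel. (s x * u x) * deriv \<phi> x) = - (LINT x|lborel. (s x * w x + deriv s x * u x) * \<phi> x)" .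
  qed
qed

lemma sobolev2_mult_smooth:
  assumes u: "sobolev2 u u1 u2" and s: "smooth s"
    and B: "\<And>x. \<bar>s x\<bar> \<le> B" "\<And>x. \<bar>deriv s x\<bar> \<le> B" "\<And>x. \<bar>deriv (deriv s) x\<bar> \<le> B"
  shows "sobolev2 (\<lambda>x. s x * u x) (\<lambda>x. s x * u1 x + deriv s x * u x)
    (\<lambda>x. s x * u2 x + 2 * (deriv s x * u1 x) + deriv (deriv s) x * u x)"
proof -
  note s1 = smooth_deriv[OF s] and s2 = smooth_deriv[OF smooth_deriv[OF s]]
  have m: "smooth p \<Longrightarrow> p \<in> borel_measurable borel" for p
    by (rule borel_measurable_continuous_onI[OF smooth_continuous])
  have L: "L2 (\<lambda>x. s x * f x)" "L2 (\<lambda>x. deriv s x * f x)" "L2 (\<lambda>x. deriv (deriv s) x * f x)" if "L2 f" for f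
    by (rule L2_bounded_mult[OF that m[OF s] B(1)] L2_bounded_mult[OF that m[OF s1] B(2)]
        L2_bounded_mult[OF that m[OF s2] B(3)])+
  have "weak_deriv (\<lambda>x. s x * u1 x + deriv s x * u x)
      (\<lambda>x. 1 * (s x * u2 x + deriv s x * u1 x) + 1 * (deriv s x * u1 x + deriv (deriv s) x * u x))"
    using weak_deriv_lin[OF weak_deriv_mult_smooth[OF sobolev2D(5)[OF u] s]
        weak_deriv_mult_smooth[OF sobolev2D(4)[OF u] s1], of 1 1] by simp
  moreover have "(\<lambda>x. 1 * (s x * u2 x + deriv s x * u1 x) + 1 * (deriv s x * u1 x + deriv (deriv s) x * u x))
      = (\<lambda>x. s x * u2 x + 2 * (deriv s x * u1 x) + deriv (deriv s) x * u x)" by (auto simp: algebra_simps)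
  ultimately show ?thesis
    unfolding sobolev2_def
    using weak_deriv_mult_smooth[OF sobolev2D(4)[OF u] s]
    by (auto intro!: L2_add L2_cmult L sobolev2D[OF u] simp only:)
qed

lemma sobolev2_test_fun: assumes "test_fun \<phi>" shows "sobolev2 \<phi> (deriv \<phi>) (deriv (deriv \<phi>))"
proof -
  have "weak_deriv \<psi> (deriv \<psi>)" if "test_fun \<psi>" for \<psi>
    by (rule ac_weak_deriv[OF DERIV_ac[OF test_fun_DERIV[OF that] test_fun_continuous[OF test_fun_deriv[OF that]]]])
  then show ?thesis unfolding sobolev2_def using assms by (auto intro: L2_test_fun test_fun_deriv)
qed

lemma L2_limit_integral:
  assumes "\<And>n. L2 (f n)" "L2 g" "L2 \<phi>" "(\<lambda>n. nrm (\<lambda>x. f n x - g x)) \<longlonglongrightarrow> 0"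
  shows "(\<lambda>n. LINT x|lborel. f n x * \<phi> x) \<longlonglongrightarrow> (LINT x|lborel. g x * \<phi> x)"
proof (rule LIM_zero_cancel, rule tendsto_rabs_zero_cancel, rule tendsto_sandwich[OF _ _ tendsto_const])
  show "\<forall>\<^sub>F n in sequentially. \<bar>(LINT x|lborel. f n x * \<phi> x) - (LINT x|lborel. g x * \<phi> x)\<bar> \<le> nrm (\<lambda>x. f n x - g x) * nrm \<phi>"
  proof (intro always_eventually allI)
    fix n
    have "(LINT x|lborel. f n x * \<phi> x) - (LINT x|lborel. g x * \<phi> x) = (LINT x|lborel. (f n x - g x) * \<phi> x)"
      using L2_mult_integrable[OF assms(1) assms(3)] L2_mult_integrable[OF assms(2,3)] by (simp add: left_diff_distrib)
    then show "\<bar>(LINT x|lborel. f n x * \<phi> x) - (LINT x|lborel. g x * \<phi> x)\<bar> \<le> nrm (\<lambda>x. f n x - g x) * nrm \<phi>"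
      using L2_Cauchy_Schwarz[OF L2_diff[OF assms(1,2)] assms(3)] by simp
  qed
  show "(\<lambda>n. nrm (\<lambda>x. f n x - g x) * nrm \<phi>) \<longlonglongrightarrow> 0" by (rule tendsto_mult_left_zero[OF assms(4)])
qed simp

text \<open>Weak differentiation is a closed operation, because for a fixed test function both sides
  of its defining identity are continuous in L2. This identifies the derivatives of the limit in the
  compactness theorem.\<close>

lemma weak_deriv_L2_limit:
  assumes "\<And>n. weak_deriv (f n) (f' n)" "\<And>n. L2 (f n)" "\<And>n. L2 (f' n)" "L2 g" "L2 g'"
    "(\<lambda>n. nrm (\<lambda>x. f n x - g x)) \<longlonglongrightarrow> 0" "(\<lambda>n. nrm (\<lambda>x. f' n x - g' x)) \<longlonglongrightarrow> 0"
  shows "weak_deriv g g'"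
proof (rule weak_derivI)
  show "locint g" "locint g'" using assms by (auto intro: L2_locint)
  fix \<phi> assume \<phi>: "test_fun \<phi>"
  have "(\<lambda>n. LINT x|lborel. f n x * deriv \<phi> x) \<longlonglongrightarrow> (LINT x|lborel. g x * deriv \<phi> x)"
    by (rule L2_limit_integral[OF assms(2,4) L2_test_fun[OF test_fun_deriv[OF \<phi>]] assms(6)])
  moreover have "(\<lambda>n. LINT x|lborel. f n x * deriv \<phi> x) \<longlonglongrightarrow> - (LINT x|lborel. g' x * \<phi> x)"
    unfolding weak_derivD[OF assms(1) \<phi>]
    by (intro tendsto_minus L2_limit_integral[OF assms(3,5) L2_test_fun[OF \<phi>] assms(7)])
  ultimately show "(LINT x|lborel. g x * deriv \<phi> x) = - (LINT x|lborel. g' x * \<phi> x)"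
    by (rule LIMSEQ_unique)
qed

text \<open>The regular representative of an \<open>H2\<close> function: continuously differentiable, with
  absolutely continuous derivative.\<close>
definition nice :: "(real \<Rightarrow> real) \<Rightarrow> (real \<Rightarrow> real) \<Rightarrow> (real \<Rightarrow> real) \<Rightarrow> bool" where
  "nice f f1 f2 \<longleftrightarrow> L2 f \<and> L2 f1 \<and> L2 f2 \<and> ac f f1 \<and> ac f1 f2"

lemma niceD: "nice u u1 u2 \<Longrightarrow> L2 u" "nice u u1 u2 \<Longrightarrow> L2 u1" "nice u u1 u2 \<Longrightarrow> L2 u2"
  "nice u u1 u2 \<Longrightarrow> ac u u1" "nice u u1 u2 \<Longrightarrow> ac u1 u2"
  by (auto simp only: nice_def)

lemma nice_sobolev2: "nice f f1 f2 \<Longrightarrow> sobolev2 f f1 f2"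
  unfolding nice_def sobolev2_def using ac_weak_deriv by blast

lemma nice_DERIV: "nice f f1 f2 \<Longrightarrow> (f has_real_derivative f1 x) (at x)"
  using ac_DERIV[OF niceD(4) ac_continuous[OF niceD(5)]] by blast

text \<open>Take primitives twice. Replacing \<open>u1\<close> by a primitive of \<open>u2\<close>
  changes it only on a null set, so a primitive of \<open>u1\<close> is also one of its replacement.
  The second derivative is kept as it is.\<close>

lemma sobolev2_nice:
  assumes "sobolev2 u u1 u2"
  obtains f f1 where "nice f f1 u2" "AE x in lborel. u x = f x" "AE x in lborel. u1 x = f1 x"
proof -
  obtain f1 where f1: "ac f1 u2" "AE x in lborel. u1 x = f1 x" using weak_deriv_ac[OF sobolev2D(5)[OF assms]] .
  obtain f where f: "ac f u1" "AE x in lborel. u x = f x" using weak_deriv_ac[OF sobolev2D(4)[OF assms]] .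
  have [measurable]: "f1 \<in> borel_measurable borel" "f \<in> borel_measurable borel"
    using borel_measurable_continuous_onI ac_continuous f1 f by blast+
  note [measurable] = L2_measurable[OF sobolev2D(2)[OF assms]]
  have "(LINT t:{a..b}|lborel. u1 t) = (LINT t:{a..b}|lborel. f1 t)" for a b
    unfolding set_lebesgue_integral_def by (rule integral_cong_AE) (use f1(2) in auto)
  then have "ac f f1"
    using f(1) locint_continuous[OF ac_continuous[OF f1(1)]] unfolding ac_def by simp
  moreover have "L2 f" "L2 f1"
    using L2_AE_cong[OF sobolev2D(1)[OF assms] _ f(2)] L2_AE_cong[OF sobolev2D(2)[OF assms] _ f1(2)] by auto
  ultimately show thesis
    using f1 f sobolev2D[OF assms] by (intro that[of f f1]) (simp_all add: nice_def)
qed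

lemma ac_shift: assumes "ac F w" "L2 w" shows "ac (\<lambda>x. F (x - t)) (\<lambda>x. w (x - t))"
  unfolding ac_def
proof (intro conjI allI impI)
  show "locint (\<lambda>x. w (x - t))" by (intro L2_locint L2_shift assms)
  fix a b :: real assume ab: "a \<le> b"
  have "(LINT s:{a..b}|lborel. w (s - t)) = (LINT s|lborel. (\<lambda>s. indicator {a-t..b-t} s * w s) (s - t))"
    unfolding set_lebesgue_integral_def
    by (rule Bochner_Integration.integral_cong) (auto simp: indicator_def)
  also have "\<dots> = (LINT s:{a-t..b-t}|lborel. w s)"
    using integral_shift[of "\<lambda>s. indicator {a-t..b-t} s * w s" t] by (simp add: set_lebesgue_integral_def)
  finally show "F (b - t) - F (a - t) = (LINT s:{a..b}|lborel. w (s - t))"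
    using ac_diff_eq[OF assms(1), of "a - t" "b - t"] ab by simp
qed

lemma nice_shift: assumes "nice f f1 f2" shows "nice (\<lambda>x. f (x - t)) (\<lambda>x. f1 (x - t)) (\<lambda>x. f2 (x - t))"
  unfolding nice_def by (intro conjI L2_shift ac_shift niceD[OF assms])

lemma ac_Holder: assumes "ac F w" "L2 w" shows "\<bar>F x - F y\<bar> \<le> sqrt \<bar>x - y\<bar> * nrm w"
proof -
  have "\<bar>F b - F a\<bar> \<le> sqrt (b - a) * nrm w" if "a \<le> b" for a b
    using L2_interval_integral_bound[OF assms(2) that] ac_diff_eq[OF assms(1) that] by simp
  from this[of x y] this[of y x] show ?thesis by (cases "x \<le> y") (auto simp: abs_minus_commute)
qed

text \<open>On an interval of length one the minimum of \<open>\<bar>F\<bar>\<close> is at most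
  \<open>nrm F\<close>, and from the minimum point to \<open>x\<close> the function changes by at
  most \<open>nrm w\<close>.\<close>

lemma ac_sup_bound: assumes "ac F w" "L2 F" "L2 w" shows "\<bar>F x\<bar> \<le> nrm F + nrm w"
proof -
  have "\<exists>y\<in>{x..x+1}. \<forall>z\<in>{x..x+1}. \<bar>F y\<bar> \<le> \<bar>F z\<bar>"
    by (rule continuous_attains_inf) (auto intro!: continuous_intros ac_continuous[OF assms(1)])
  then obtain y where y: "y \<in> {x..x+1}" "\<And>z. z \<in> {x..x+1} \<Longrightarrow> \<bar>F y\<bar> \<le> \<bar>F z\<bar>" by blast
  have "(LINT z|lborel. indicator {x..x+1} z * (F y)\<^sup>2) \<le> (LINT z|lborel. (F z)\<^sup>2)"
  proof (rule integral_mono)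
    show "integrable lborel (\<lambda>z. (F z)\<^sup>2)" by (rule L2_sq[OF assms(2)])
    fix z show "indicator {x..x+1} z * (F y)\<^sup>2 \<le> (F z)\<^sup>2"
      using y(2)[of z] abs_le_square_iff[of "F y" "F z"] by (auto simp: indicator_def)
  qed simp
  then have "(F y)\<^sup>2 \<le> (nrm F)\<^sup>2" by (simp add: nrm_sq)
  then have "\<bar>F y\<bar> \<le> nrm F" using abs_le_square_iff[of "F y" "nrm F"] nrm_nonneg[of F] by simp
  moreover have "\<bar>F x - F y\<bar> \<le> nrm w"
  proof -
    have "sqrt \<bar>x - y\<bar> \<le> 1" using y(1) by auto
    then have "sqrt \<bar>x - y\<bar> * nrm w \<le> nrm w" using nrm_nonneg[of w] by (simp add: mult_left_le_one_le)
    then show ?thesis using ac_Holder[OF assms(1,3), of x y] by linarith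
  qed
  ultimately show ?thesis by linarith
qed

text \<open>The boundary terms vanish in the limit because they converge and are integrable.\<close>
lemma nice_integral_by_parts:
  assumes "nice f f1 f2" shows "(LINT x|lborel. (f1 x)\<^sup>2) = - (LINT x|lborel. f x * f2 x)"
proof -
  define q where "q x = f1 x * f x" for x
  define h where "h x = (f1 x)\<^sup>2 + f2 x * f x" for x
  define D where "D x = q x - q (- x)" for x
  note L = niceD[OF assms]
  have ih: "integrable lborel h" unfolding h_def[abs_def]
    using L2_sq[OF L(2)] L2_mult_integrable[OF L(3,1)] by simp
  have iq: "integrable lborel q" unfolding q_def[abs_def] by (rule L2_mult_integrable[OF L(2,1)])
  have iD: "integrable lborel D" unfolding D_def[abs_def]
    using iq lborel_integrable_real_affine[OF iq, of "-1" 0] by simp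
  note [measurable] = L2_measurable[OF L(1)] L2_measurable[OF L(2)] L2_measurable[OF L(3)]
  have [measurable]: "h \<in> borel_measurable borel" unfolding h_def[abs_def] by measurable
  have "((\<lambda>R. LINT x|lborel. indicator {-R..R} x * h x) \<longlongrightarrow> (LINT x|lborel. h x)) at_top"
  proof (rule integral_dominated_convergence_at_top[where w="\<lambda>x. \<bar>h x\<bar>"])
    show "AE x in lborel. ((\<lambda>R. indicator {-R..R} x * h x) \<longlongrightarrow> h x) at_top"
    proof (intro AE_I2 tendsto_eventually)
      fix x show "\<forall>\<^sub>F R in at_top. indicator {-R..R} x * h x = h x"
        using eventually_ge_at_top[of "\<bar>x\<bar>"] by eventually_elim (auto simp: indicator_def)
    qed
  qed (use ih in \<open>auto simp: abs_mult indicator_def\<close>)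
  moreover have "\<forall>\<^sub>F R in at_top. (LINT x|lborel. indicator {-R..R} x * h x) = D R"
    using eventually_ge_at_top[of 0]
  proof eventually_elim
    case (elim R)
    have i: "integrable lborel (\<lambda>x. indicator {-R..R} x *\<^sub>R (f1 x * f1 x))" "integrable lborel (\<lambda>x. indicator {-R..R} x *\<^sub>R (f2 x * f x))"
      by (rule integrable_mult_indicator; use L2_mult_integrable L in auto)+
    have "(LINT x|lborel. indicator {-R..R} x * h x)
      = (LINT x|lborel. indicator {-R..R} x *\<^sub>R (f1 x * f1 x) + indicator {-R..R} x *\<^sub>R (f2 x * f x))"
      by (rule Bochner_Integration.integral_cong) (auto simp: h_def power2_eq_square algebra_simps)
    also have "\<dots> = (LINT x:{-R..R}|lborel. f1 x * f1 x) + (LINT x:{-R..R}|lborel. f2 x * f x)"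
      unfolding Bochner_Integration.integral_add[OF i] set_lebesgue_integral_def ..
    also have "\<dots> = D R"
      using ac_integral_by_parts[OF L(5) L(4), of "-R" R] elim by (simp add: D_def q_def)
    finally show ?case .
  qed
  ultimately have lim: "(D \<longlongrightarrow> (LINT x|lborel. h x)) at_top"
    by (rule Lim_transform_eventually)
  have "(LINT x|lborel. h x) = 0"
  proof (rule ccontr)
    define c where "c = \<bar>LINT x|lborel. h x\<bar> / 2"
    assume "(LINT x|lborel. h x) \<noteq> 0"
    then have c: "0 < c" by (simp add: c_def)
    have "\<forall>\<^sub>F x in at_top. \<bar>D x - (LINT x|lborel. h x)\<bar> < c"
      using tendstoD[OF lim c] by (simp add: dist_real_def)
    then obtain N where N: "\<And>x. N \<le> x \<Longrightarrow> \<bar>D x - (LINT x|lborel. h x)\<bar> < c"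
      unfolding eventually_at_top_linorder by blast
    \<comment> \<open>Beyond \<open>N\<close> the modulus of \<open>D\<close> is at least
      \<open>c\<close>, so a window of length \<open>k\<close> there contributes
      \<open>k * c\<close>, more than the whole integral.\<close>
    obtain k :: nat where k: "(LINT x|lborel. \<bar>D x\<bar>) < real k * c" using reals_Archimedean3[OF c] by blast
    have "(LINT x|lborel. indicator {N..N + real k} x * c) \<le> (LINT x|lborel. \<bar>D x\<bar>)"
    proof (rule integral_mono)
      show "integrable lborel (\<lambda>x. \<bar>D x\<bar>)" using iD by simp
      fix x show "indicator {N..N + real k} x * c \<le> \<bar>D x\<bar>"
      proof (cases "x \<in> {N..N + real k}")
        case True
        then have "\<bar>D x - (LINT x|lborel. h x)\<bar> < c" using N by simp
        then have "c \<le> \<bar>D x\<bar>" unfolding c_def by linarith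
        then show ?thesis using True by simp
      qed simp
    qed simp
    then show False using k by simp
  qed
  moreover have "(LINT x|lborel. h x) = (LINT x|lborel. (f1 x)\<^sup>2) + (LINT x|lborel. f x * f2 x)"
    unfolding h_def using L2_sq[OF L(2)] L2_mult_integrable[OF L(3,1)] by (simp add: mult.commute)
  ultimately show ?thesis by simp
qed

text \<open>Integrate the square of the first derivative by parts on the continuous representative
  and apply Cauchy-Schwarz. This bounds the first derivative by the norm of \<open>X\<close>, the
  momentum by the energy, and the difference of slopes by the L2 distance.\<close>

lemma sobolev2_interpolation:
  assumes "sobolev2 u u1 u2" shows "(nrm u1)\<^sup>2 \<le> nrm u * nrm u2"
proof -
  obtain f f1 where f: "nice f f1 u2" "AE x in lborel. u x = f x" "AE x in lborel. u1 x = f1 x"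
    using sobolev2_nice[OF assms] .
  note m = L2_measurable[OF sobolev2D(1)[OF assms]] L2_measurable[OF sobolev2D(2)[OF assms]]
    L2_measurable[OF niceD(1)[OF f(1)]] L2_measurable[OF niceD(2)[OF f(1)]]
  have e: "nrm u = nrm f" "nrm u1 = nrm f1"
    by (rule nrm_cong_AE[OF m(1) m(3) f(2)], rule nrm_cong_AE[OF m(2) m(4) f(3)])
  have "(nrm f1)\<^sup>2 \<le> \<bar>LINT x|lborel. f x * u2 x\<bar>"
    unfolding nrm_sq nice_integral_by_parts[OF f(1)] by simp
  also have "\<dots> \<le> nrm f * nrm u2" by (rule L2_Cauchy_Schwarz[OF niceD(1)[OF f(1)] niceD(3)[OF f(1)]])
  finally show ?thesis unfolding e .
qed

section \<open>Energy and momentum\<close>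

text \<open>The position component may be replaced by a function that agrees with it almost
  everywhere and has known derivatives. The velocity stays, since no derivative of it is ever
  taken.\<close>

definition rep :: "state \<Rightarrow> (real \<Rightarrow> real) \<Rightarrow> (real \<Rightarrow> real) \<Rightarrow> (real \<Rightarrow> real) \<Rightarrow> bool" where
  "rep p f f1 f2 \<longleftrightarrow> sobolev2 f f1 f2 \<and> L2 (snd p) \<and> fst p \<in> borel_measurable borel \<and> (AE x in lborel. fst p x = f x)"

lemma repD: "rep p f f1 f2 \<Longrightarrow> sobolev2 f f1 f2" "rep p f f1 f2 \<Longrightarrow> L2 (snd p)"
  "rep p f f1 f2 \<Longrightarrow> fst p \<in> borel_measurable borel" "rep p f f1 f2 \<Longrightarrow> AE x in lborel. fst p x = f x"
  by (auto simp only: rep_def)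

lemma rep_self: "sobolev2 f f1 f2 \<Longrightarrow> L2 v \<Longrightarrow> rep (f, v) f f1 f2"
  by (simp add: rep_def L2_measurable[OF sobolev2D(1)])

lemma X_rep: assumes "p \<in> X" obtains f f1 f2 where "rep p f f1 f2" "nice f f1 f2"
proof -
  have "H2 (fst p)" "L2 (snd p)" using assms by (auto simp: X_def)
  obtain f f1 where f: "nice f f1 (uxx (fst p))" "AE x in lborel. fst p x = f x"
    using sobolev2_nice[OF sobolev2_ux_uxx[OF \<open>H2 (fst p)\<close>]] by metis
  have "fst p \<in> borel_measurable borel"
    using L2_measurable[OF sobolev2D(1)[OF sobolev2_ux_uxx[OF \<open>H2 (fst p)\<close>]]] .
  then show thesis using that f nice_sobolev2[OF f(1)] \<open>L2 (snd p)\<close> by (simp add: rep_def)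
qed

lemma rep_fst:
  assumes "rep p f f1 f2"
  shows "H2 (fst p)" "AE x in lborel. ux (fst p) x = f1 x" "AE x in lborel. uxx (fst p) x = f2 x"
proof -
  have s: "sobolev2 (fst p) f1 f2"
    by (rule sobolev2_AE_cong[OF repD(1)[OF assms] repD(3)[OF assms]]) (use repD(4)[OF assms] in auto)
  then show h: "H2 (fst p)" unfolding H2_iff by blast
  show "AE x in lborel. ux (fst p) x = f1 x" "AE x in lborel. uxx (fst p) x = f2 x"
    by (rule sobolev2_unique[OF sobolev2_ux_uxx[OF h] s]; simp)+
qed

lemma rep_X: "rep p f f1 f2 \<Longrightarrow> p \<in> X"
  using rep_fst(1) repD(2) by (auto simp: X_def)

lemma rep_measurable:
  assumes "rep p f f1 f2"
  shows "f \<in> borel_measurable borel" "f1 \<in> borel_measurable borel" "f2 \<in> borel_measurable borel"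
    "fst p \<in> borel_measurable borel" "snd p \<in> borel_measurable borel"
    "ux (fst p) \<in> borel_measurable borel" "uxx (fst p) \<in> borel_measurable borel"
  using sobolev2D[OF repD(1)[OF assms]] repD[OF assms] sobolev2D[OF sobolev2_ux_uxx[OF rep_fst(1)[OF assms]]]
  by (simp_all add: L2_measurable)

lemma rep_lin:
  assumes "rep p f f1 f2" "rep q g g1 g2"
  shows "rep (\<lambda>x. a * fst p x + b * fst q x, \<lambda>x. a * snd p x + b * snd q x)
    (\<lambda>x. a * f x + b * g x) (\<lambda>x. a * f1 x + b * g1 x) (\<lambda>x. a * f2 x + b * g2 x)"
proof -
  note [measurable] = rep_measurable[OF assms(1)] rep_measurable[OF assms(2)]
  have "AE x in lborel. a * fst p x + b * fst q x = a * f x + b * g x"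
    using repD(4)[OF assms(1)] repD(4)[OF assms(2)] by eventually_elim simp
  then show ?thesis
    unfolding rep_def using sobolev2_lin[OF repD(1)[OF assms(1)] repD(1)[OF assms(2)]]
      L2_lin[OF repD(2)[OF assms(1)] repD(2)[OF assms(2)]] by simp
qed

lemma rep_shift: assumes "rep p f f1 f2"
  shows "rep (shift t p) (\<lambda>x. f (x - t)) (\<lambda>x. f1 (x - t)) (\<lambda>x. f2 (x - t))"
proof -
  note [measurable] = rep_measurable[OF assms]
  have "AE x in lborel. fst p x - f x = 0" using repD(4)[OF assms] by eventually_elim simp
  \<comment> \<open>Translation invariance of Lebesgue measure transports the null set.\<close>
  then have "AE x in distr lborel borel (\<lambda>x. - t + x). fst p x - f x = 0"
    by (subst lborel_distr_plus) 
  then have "AE x in lborel. fst p (x - t) = f (x - t)"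
    by (subst (asm) AE_distr_iff) auto
  then show ?thesis
    unfolding rep_def shift_def
    using sobolev2_shift[OF repD(1)[OF assms]] L2_shift[OF repD(2)[OF assms]] by simp
qed

lemma Xnorm_rep:
  assumes "rep p f f1 f2" shows "Xnorm p = sqrt ((nrm (snd p))\<^sup>2 + (nrm f2)\<^sup>2 + (nrm f)\<^sup>2)"
proof -
  note [measurable] = rep_measurable[OF assms]
  have "(LINT x|lborel. (snd p x)\<^sup>2 + (uxx (fst p) x)\<^sup>2 + (fst p x)\<^sup>2)
    = (LINT x|lborel. (snd p x)\<^sup>2 + (f2 x)\<^sup>2 + (f x)\<^sup>2)"
  proof (rule integral_cong_AE)
    show "AE x in lborel. (snd p x)\<^sup>2 + (uxx (fst p) x)\<^sup>2 + (fst p x)\<^sup>2 = (snd p x)\<^sup>2 + (f2 x)\<^sup>2 + (f x)\<^sup>2"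
      using repD(4)[OF assms] rep_fst(3)[OF assms] by eventually_elim simp
  qed measurable
  also have "\<dots> = (nrm (snd p))\<^sup>2 + (nrm f2)\<^sup>2 + (nrm f)\<^sup>2"
    using L2_sq[OF repD(2)[OF assms]] L2_sq[OF sobolev2D(1)[OF repD(1)[OF assms]]] L2_sq[OF sobolev2D(3)[OF repD(1)[OF assms]]]
    by (simp add: nrm_sq)
  finally show ?thesis by (simp add: Xnorm_def)
qed

lemma Xdist_rep:
  assumes "rep p f f1 f2" "rep q g g1 g2"
  shows "Xdist p q = sqrt ((nrm (\<lambda>x. snd p x - snd q x))\<^sup>2 + (nrm (\<lambda>x. f2 x - g2 x))\<^sup>2 + (nrm (\<lambda>x. f x - g x))\<^sup>2)"
  using Xnorm_rep[OF rep_lin[OF assms, of 1 "-1"]] by (simp add: Xdist_def)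

lemma nrm_shift: "nrm (\<lambda>x. f (x - t)) = nrm f"
  unfolding nrm_def using integral_shift[of "\<lambda>x. (f x)\<^sup>2" t] by simp

lemma shift_X: "p \<in> X \<Longrightarrow> shift t p \<in> X"
  by (metis X_rep rep_X rep_shift)

lemma Xdist_shift:
  assumes "p \<in> X" "q \<in> X" shows "Xdist (shift t p) (shift t q) = Xdist p q"
proof -
  obtain f f1 f2 where f: "rep p f f1 f2" using X_rep[OF assms(1)] by metis
  obtain g g1 g2 where g: "rep q g g1 g2" using X_rep[OF assms(2)] by metis
  show ?thesis
    unfolding Xdist_rep[OF f g] Xdist_rep[OF rep_shift[OF f] rep_shift[OF g]]
    by (simp add: shift_def nrm_shift[of "\<lambda>x. snd p x - snd q x"] nrm_shift[of "\<lambda>x. f2 x - g2 x"]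
        nrm_shift[of "\<lambda>x. f x - g x"])
qed

lemma Xnorm_nonneg: "0 \<le> Xnorm p"
  unfolding Xnorm_def by (intro real_sqrt_ge_zero integral_nonneg_AE) simp

lemma Xdist_nonneg: "0 \<le> Xdist p q"
  unfolding Xdist_def by (rule Xnorm_nonneg)

text \<open>The first derivative does not occur in the norm of \<open>X\<close>; interpolation
  bounds it by the geometric mean of two norms that do.\<close>

lemma Xnorm_bounds:
  assumes "rep p f f1 f2"
  shows "nrm (snd p) \<le> Xnorm p" "nrm f2 \<le> Xnorm p" "nrm f \<le> Xnorm p" "nrm f1 \<le> Xnorm p"
proof -
  show 1: "nrm (snd p) \<le> Xnorm p" "nrm f2 \<le> Xnorm p" "nrm f \<le> Xnorm p"
    unfolding Xnorm_rep[OF assms] by (intro real_le_rsqrt; simp)+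
  have "(nrm f1)\<^sup>2 \<le> nrm f * nrm f2" by (rule sobolev2_interpolation[OF repD(1)[OF assms]])
  also have "\<dots> \<le> Xnorm p * Xnorm p" by (intro mult_mono 1 nrm_nonneg Xnorm_nonneg)
  finally have "(nrm f1)\<^sup>2 \<le> (Xnorm p)\<^sup>2" by (simp add: power2_eq_square)
  then show "nrm f1 \<le> Xnorm p" by (rule power2_le_imp_le) (rule Xnorm_nonneg)
qed

lemma Xdist_bounds:
  assumes "rep p f f1 f2" "rep q g g1 g2"
  shows "nrm (\<lambda>x. snd p x - snd q x) \<le> Xdist p q" "nrm (\<lambda>x. f2 x - g2 x) \<le> Xdist p q"
    "nrm (\<lambda>x. f x - g x) \<le> Xdist p q" "nrm (\<lambda>x. f1 x - g1 x) \<le> Xdist p q"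
  using Xnorm_bounds[OF rep_lin[OF assms, of 1 "-1"]] by (simp_all add: Xdist_def)

lemma Xnorm_le_sum:
  assumes "rep p f f1 f2" shows "Xnorm p \<le> nrm (snd p) + nrm f2 + nrm f"
  unfolding Xnorm_rep[OF assms]
  by (rule real_le_lsqrt) (auto simp: nrm_nonneg power2_eq_square algebra_simps)

text \<open>A crude triangle inequality, taken in each component; the factor \<open>3\<close> comes
  from bounding the Euclidean norm of the three components by their sum.\<close>

lemma Xnorm_le_Xdist:
  assumes "p \<in> X" "q \<in> X" shows "Xnorm p \<le> 3 * (Xnorm q + Xdist p q)"
proof -
  obtain f f1 f2 where f: "rep p f f1 f2" using X_rep[OF assms(1)] by metis
  obtain g g1 g2 where g: "rep q g g1 g2" using X_rep[OF assms(2)] by metis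
  have t: "nrm a \<le> nrm b + nrm (\<lambda>x. a x - b x)" if "L2 a" "L2 b" for a b
    using nrm_triangle[OF that(2) L2_diff[OF that]] by simp
  note sf = sobolev2D[OF repD(1)[OF f]] and sg = sobolev2D[OF repD(1)[OF g]]
  have "nrm (snd p) \<le> Xnorm q + Xdist p q"
    using t[OF repD(2)[OF f] repD(2)[OF g]] Xnorm_bounds(1)[OF g] Xdist_bounds(1)[OF f g] by linarith
  moreover have "nrm f2 \<le> Xnorm q + Xdist p q"
    using t[OF sf(3) sg(3)] Xnorm_bounds(2)[OF g] Xdist_bounds(2)[OF f g] by linarith
  moreover have "nrm f \<le> Xnorm q + Xdist p q"
    using t[OF sf(1) sg(1)] Xnorm_bounds(3)[OF g] Xdist_bounds(3)[OF f g] by linarith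
  ultimately show ?thesis using Xnorm_le_sum[OF f] unfolding distrib_left by linarith
qed

lemma nice_sup_bound:
  assumes "rep p f f1 f2" "nice f f1 f2" shows "\<bar>f x\<bar> \<le> 2 * Xnorm p" "\<bar>f1 x\<bar> \<le> 2 * Xnorm p"
  using ac_sup_bound[OF niceD(4,1,2)[OF assms(2)], of x] ac_sup_bound[OF niceD(5,2,3)[OF assms(2)], of x]
    Xnorm_bounds[OF assms(1)] by linarith+

lemma momentum_rep:
  assumes "rep p f f1 f2" shows "momentum p = - (LINT x|lborel. snd p x * f1 x)"
proof -
  note [measurable] = rep_measurable[OF assms]
  have "(LINT x|lborel. snd p x * ux (fst p) x) = (LINT x|lborel. snd p x * f1 x)"
    by (rule integral_cong_AE) (use rep_fst(2)[OF assms] in auto)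
  then show ?thesis by (simp add: momentum_def)
qed

lemma momentum_bound: assumes "p \<in> X" shows "\<bar>momentum p\<bar> \<le> (Xnorm p)\<^sup>2"
proof -
  obtain f f1 f2 where f: "rep p f f1 f2" using X_rep[OF assms] by metis
  have "\<bar>momentum p\<bar> \<le> nrm (snd p) * nrm f1"
    using L2_Cauchy_Schwarz[OF repD(2)[OF f] sobolev2D(2)[OF repD(1)[OF f]]] by (simp add: momentum_rep[OF f])
  also have "\<dots> \<le> Xnorm p * Xnorm p" by (intro mult_mono Xnorm_bounds[OF f] nrm_nonneg Xnorm_nonneg)
  finally show ?thesis by (simp add: power2_eq_square)
qed

text \<open>The momentum is bilinear in velocity and slope; exchange one factor at a time.\<close>

lemma momentum_Lipschitz:
  assumes "p \<in> X" "q \<in> X" "Xnorm p \<le> S" "Xnorm q \<le> S"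
  shows "\<bar>momentum p - momentum q\<bar> \<le> 2 * S * Xdist p q"
proof -
  obtain f f1 f2 where f: "rep p f f1 f2" using X_rep[OF assms(1)] by metis
  obtain g g1 g2 where g: "rep q g g1 g2" using X_rep[OF assms(2)] by metis
  note L = repD(2)[OF f] repD(2)[OF g] sobolev2D(2)[OF repD(1)[OF f]] sobolev2D(2)[OF repD(1)[OF g]]
  note i = L2_mult_integrable[OF L(1,3)] L2_mult_integrable[OF L(2,3)] L2_mult_integrable[OF L(2,4)]
  have "momentum p - momentum q = - ((LINT x|lborel. (snd p x - snd q x) * f1 x) + (LINT x|lborel. snd q x * (f1 x - g1 x)))"
    unfolding momentum_rep[OF f] momentum_rep[OF g] using i by (simp add: left_diff_distrib right_diff_distrib)
  moreover have "\<bar>LINT x|lborel. (snd p x - snd q x) * f1 x\<bar> \<le> Xdist p q * S"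
    using L2_Cauchy_Schwarz[OF L2_diff[OF L(1,2)] L(3)]
      mult_mono[OF Xdist_bounds(1)[OF f g] order_trans[OF Xnorm_bounds(4)[OF f] assms(3)] Xdist_nonneg nrm_nonneg]
    by linarith
  moreover have "\<bar>LINT x|lborel. snd q x * (f1 x - g1 x)\<bar> \<le> S * Xdist p q"
    using L2_Cauchy_Schwarz[OF L(2) L2_diff[OF L(3,4)]]
      mult_mono[OF order_trans[OF Xnorm_bounds(1)[OF g] assms(4)] Xdist_bounds(4)[OF f g] order_trans[OF Xnorm_nonneg assms(4)] nrm_nonneg]
    by linarith
  ultimately show ?thesis by (simp add: algebra_simps)
qed

lemma momentum_shift: assumes "p \<in> X" shows "momentum (shift t p) = momentum p"
proof -
  obtain f f1 f2 where f: "rep p f f1 f2" using X_rep[OF assms(1)] by metis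
  show ?thesis unfolding momentum_rep[OF f] momentum_rep[OF rep_shift[OF f]]
    using integral_shift[of "\<lambda>x. snd p x * f1 x" t] by (simp add: shift_def)
qed

section \<open>Pointwise bounds on the potential and continuity of the energy\<close>

locale potential =
  fixes W :: "real \<Rightarrow> real" and \<eta> :: real
  assumes W_differentiable: "\<And>s. W differentiable (at s)"
    and deriv_W_continuous: "continuous_on UNIV (deriv W)"
    and eta_pos: "0 < \<eta>"
    and W_small: "\<And>s. \<bar>s\<bar> \<le> 1 \<Longrightarrow> \<eta> * s\<^sup>2 \<le> W s"
    and W_large: "\<And>s. 1 \<le> \<bar>s\<bar> \<Longrightarrow> \<eta> \<le> W s"
    and deriv_W_DERIV_0: "(deriv W has_real_derivative 1) (at 0)"
    and W_0: "W 0 = 0"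
begin

lemma W_DERIV: "(W has_real_derivative deriv W s) (at s)"
  using W_differentiable DERIV_deriv_iff_real_differentiable by blast

lemma W_continuous: "continuous_on A W"
  by (meson DERIV_isCont W_DERIV continuous_at_imp_continuous_on)

lemma W_measurable[measurable]: "W \<in> borel_measurable borel"
  by (rule borel_measurable_continuous_onI[OF W_continuous])

lemma W_nonneg: "0 \<le> W s"
proof (cases "\<bar>s\<bar> \<le> 1")
  case True
  have "0 \<le> \<eta> * s\<^sup>2" using eta_pos by simp
  then show ?thesis using W_small[OF True] by linarith
next
  case False
  then show ?thesis using W_large[of s] eta_pos by linarith
qed

lemma deriv_W_0: "deriv W 0 = 0"
  by (rule DERIV_local_min[OF W_DERIV, of 1]) (use W_nonneg W_0 in auto)

text \<open>Near \<open>0\<close> the facts \<open>W'(0) = 0\<close> and \<open>W''(0) = 1\<close>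
  give slope at most \<open>2\<close>. For \<open>\<bar>s\<bar> \<ge> r\<close> a bound on a compact
  interval suffices, as \<open>\<bar>s\<bar> / r \<ge> 1\<close>.\<close>

lemma deriv_W_bound: "\<exists>K\<ge>0. \<forall>s. \<bar>s\<bar> \<le> S \<longrightarrow> \<bar>deriv W s\<bar> \<le> K * \<bar>s\<bar>"
proof -
  have "((\<lambda>y. deriv W y / y) \<longlongrightarrow> 1) (at 0)"
    using deriv_W_DERIV_0 deriv_W_0 by (simp add: has_field_derivative_iff)
  then have "\<forall>\<^sub>F y in at 0. \<bar>deriv W y / y - 1\<bar> < 1"
    by (auto dest: tendstoD[of _ _ _ 1] simp: dist_real_def)
  then obtain r where r: "0 < r" "\<And>y. y \<noteq> 0 \<Longrightarrow> \<bar>y\<bar> < r \<Longrightarrow> \<bar>deriv W y / y - 1\<bar> < 1"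
    unfolding eventually_at by (auto simp: dist_real_def)
  have near: "\<bar>deriv W y\<bar> \<le> 2 * \<bar>y\<bar>" if "\<bar>y\<bar> < r" for y
  proof (cases "y = 0")
    case False
    then have "\<bar>deriv W y / y\<bar> \<le> 2" using r(2)[OF False that] by linarith
    then show ?thesis using False by (simp add: abs_divide field_simps)
  qed (simp add: deriv_W_0)
  obtain B where B: "\<And>x. x \<in> {-S..S} \<Longrightarrow> \<bar>deriv W x\<bar> \<le> B"
    using continuous_bounded_Icc[OF deriv_W_continuous] by blast
  have "\<bar>deriv W s\<bar> \<le> max 2 (\<bar>B\<bar> / r) * \<bar>s\<bar>" if "\<bar>s\<bar> \<le> S" for s
  proof (cases "\<bar>s\<bar> < r")
    case True
    have "2 * \<bar>s\<bar> \<le> max 2 (\<bar>B\<bar> / r) * \<bar>s\<bar>" by (intro mult_right_mono) auto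
    then show ?thesis using near[OF True] by linarith
  next
    case False
    have "\<bar>deriv W s\<bar> \<le> \<bar>B\<bar>" using B[of s] that by force
    also have "\<dots> = \<bar>B\<bar> / r * r" using r(1) by simp
    also have "\<dots> \<le> \<bar>B\<bar> / r * \<bar>s\<bar>" using False r(1) by (intro mult_left_mono) auto
    also have "\<dots> \<le> max 2 (\<bar>B\<bar> / r) * \<bar>s\<bar>" by (intro mult_right_mono) auto
    finally show ?thesis .
  qed
  then show ?thesis by (intro exI[of _ "max 2 (\<bar>B\<bar> / r)"]) auto
qed

text \<open>Mean value theorem with the linear bound on \<open>W'\<close>. The factor
  \<open>\<bar>s\<bar> + \<bar>t\<bar>\<close> is what makes the estimate integrable over the whole
  line, as a product of two L2 functions.\<close>

lemma W_Lipschitz: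
  "\<exists>K\<ge>0. \<forall>s t. \<bar>s\<bar> \<le> S \<longrightarrow> \<bar>t\<bar> \<le> S \<longrightarrow> \<bar>W s - W t\<bar> \<le> K * (\<bar>s\<bar> + \<bar>t\<bar>) * \<bar>s - t\<bar>"
proof -
  obtain K where K: "0 \<le> K" "\<And>s. \<bar>s\<bar> \<le> S \<Longrightarrow> \<bar>deriv W s\<bar> \<le> K * \<bar>s\<bar>" using deriv_W_bound by blast
  have *: "\<bar>W t - W s\<bar> \<le> K * (\<bar>s\<bar> + \<bar>t\<bar>) * \<bar>t - s\<bar>" if st: "\<bar>s\<bar> \<le> S" "\<bar>t\<bar> \<le> S" "s < t" for s t
  proof -
    obtain z where z: "s < z" "z < t" "W t - W s = (t - s) * deriv W z"
      using MVT2[OF st(3), of W "deriv W"] W_DERIV by blast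
    have "\<bar>z\<bar> \<le> \<bar>s\<bar> + \<bar>t\<bar>" "\<bar>z\<bar> \<le> S" using z(1,2) st by linarith+
    then have "\<bar>deriv W z\<bar> \<le> K * (\<bar>s\<bar> + \<bar>t\<bar>)"
      using K(2)[of z] mult_left_mono[OF \<open>\<bar>z\<bar> \<le> \<bar>s\<bar> + \<bar>t\<bar>\<close> K(1)] by linarith
    then have "\<bar>t - s\<bar> * \<bar>deriv W z\<bar> \<le> \<bar>t - s\<bar> * (K * (\<bar>s\<bar> + \<bar>t\<bar>))" by (intro mult_left_mono) auto
    then show ?thesis unfolding z(3) abs_mult by (simp add: mult.commute)
  qed
  have "\<bar>W s - W t\<bar> \<le> K * (\<bar>s\<bar> + \<bar>t\<bar>) * \<bar>s - t\<bar>" if "\<bar>s\<bar> \<le> S" "\<bar>t\<bar> \<le> S" for s t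
    using *[of s t] *[of t s] that by (cases s t rule: linorder_cases) (auto simp: abs_minus_commute add.commute)
  then show ?thesis using K(1) by blast
qed

lemma W_quadratic_upper: "\<exists>K\<ge>0. \<forall>s. \<bar>s\<bar> \<le> S \<longrightarrow> W s \<le> K * s\<^sup>2"
proof -
  obtain K where K: "0 \<le> K" "\<And>s t. \<bar>s\<bar> \<le> S \<Longrightarrow> \<bar>t\<bar> \<le> S \<Longrightarrow> \<bar>W s - W t\<bar> \<le> K * (\<bar>s\<bar> + \<bar>t\<bar>) * \<bar>s - t\<bar>"
    using W_Lipschitz by blast
  have "W s \<le> K * s\<^sup>2" if "\<bar>s\<bar> \<le> S" for s
  proof -
    have "\<bar>W s - W 0\<bar> \<le> K * (\<bar>s\<bar> + \<bar>0\<bar>) * \<bar>s - 0\<bar>" using that by (intro K(2)) auto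
    then show ?thesis by (simp add: W_0 power2_eq_square mult.assoc flip: abs_mult)
  qed
  then show ?thesis using K(1) by blast
qed

lemma W_quadratic_lower: "\<exists>c>0. \<forall>s. \<bar>s\<bar> \<le> S \<longrightarrow> c * s\<^sup>2 \<le> W s"
proof -
  \<comment> \<open>Beyond amplitude one only \<open>W s \<ge> \<eta>\<close> is known. Since
    \<open>s^2 \<le> m\<close> in the range considered, \<open>\<eta> / m * s^2\<close> stays below
    \<open>\<eta>\<close>.\<close>
  define m where "m = max 1 (S\<^sup>2)"
  have m: "1 \<le> m" "S\<^sup>2 \<le> m" by (auto simp: m_def)
  have "\<eta> / m * s\<^sup>2 \<le> W s" if "\<bar>s\<bar> \<le> S" for s
  proof (cases "\<bar>s\<bar> \<le> 1")
    case True
    have "\<eta> / m * s\<^sup>2 \<le> \<eta> * s\<^sup>2" using m eta_pos by (intro mult_right_mono) (auto simp: field_simps)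
    then show ?thesis using W_small[OF True] by linarith
  next
    case False
    have "s\<^sup>2 \<le> S\<^sup>2" using that abs_le_square_iff[of s S] by linarith
    then have "s\<^sup>2 \<le> m" using m by linarith
    then have "\<eta> / m * s\<^sup>2 \<le> \<eta>" using m eta_pos by (simp add: field_simps)
    then show ?thesis using W_large[of s] False by linarith
  qed
  then show ?thesis using m eta_pos by (intro exI[of _ "\<eta> / m"]) auto
qed

lemma W_integrable:
  assumes "L2 f" "\<And>x. \<bar>f x\<bar> \<le> S" shows "integrable lborel (\<lambda>x. W (f x))"
proof -
  note [measurable] = L2_measurable[OF assms(1)]
  obtain K where K: "0 \<le> K" "\<And>s. \<bar>s\<bar> \<le> S \<Longrightarrow> W s \<le> K * s\<^sup>2" using W_quadratic_upper by blast
  show ?thesis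
  proof (rule Bochner_Integration.integrable_bound)
    show "integrable lborel (\<lambda>x. K * (f x)\<^sup>2)" using L2_sq[OF assms(1)] by simp
    show "AE x in lborel. norm (W (f x)) \<le> norm (K * (f x)\<^sup>2)"
      using K W_nonneg assms(2) by (intro AE_I2) (simp add: abs_mult)
  qed measurable
qed

lemma W_integrable_nice: "nice f f1 f2 \<Longrightarrow> integrable lborel (\<lambda>x. W (f x))"
  using W_integrable[of f "nrm f + nrm f1"] ac_sup_bound[of f f1] niceD[of f f1 f2] by blast

lemma energy_rep:
  assumes "rep p f f1 f2"
  shows "energy W p = (1/2) * ((nrm (snd p))\<^sup>2 + (nrm f2)\<^sup>2) + (LINT x|lborel. W (f x))"
proof -
  note [measurable] = rep_measurable[OF assms]
  have "(LINT x|lborel. (snd p x)\<^sup>2 + (uxx (fst p) x)\<^sup>2) = (LINT x|lborel. (snd p x)\<^sup>2 + (f2 x)\<^sup>2)"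
    by (rule integral_cong_AE) (use rep_fst(3)[OF assms] in auto)
  also have "\<dots> = (nrm (snd p))\<^sup>2 + (nrm f2)\<^sup>2"
    using L2_sq[OF repD(2)[OF assms]] L2_sq[OF sobolev2D(3)[OF repD(1)[OF assms]]] by (simp add: nrm_sq)
  finally have 1: "(LINT x|lborel. (snd p x)\<^sup>2 + (uxx (fst p) x)\<^sup>2) = (nrm (snd p))\<^sup>2 + (nrm f2)\<^sup>2" .
  have 2: "(LINT x|lborel. W (fst p x)) = (LINT x|lborel. W (f x))"
    by (rule integral_cong_AE) (use repD(4)[OF assms] in auto)
  show ?thesis unfolding energy_def 1 2 ..
qed

lemma integral_W_nonneg: "0 \<le> (LINT x|lborel. W (f x))"
  by (rule integral_nonneg_AE) (simp add: W_nonneg)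

lemma energy_nonneg: assumes "p \<in> X" shows "0 \<le> energy W p"
  using X_rep[OF assms] energy_rep integral_W_nonneg by (metis add_nonneg_nonneg mult_nonneg_nonneg zero_le_power2 zero_le_divide_1_iff zero_le_numeral)

lemma energy_shift: assumes "p \<in> X" shows "energy W (shift t p) = energy W p"
proof -
  obtain f f1 f2 where f: "rep p f f1 f2" using X_rep[OF assms(1)] by metis
  show ?thesis unfolding energy_rep[OF f] energy_rep[OF rep_shift[OF f]]
    using integral_shift[of "\<lambda>x. W (f x)" t] by (simp add: shift_def nrm_shift)
qed

lemma nrm_sq_diff_bound:
  assumes "L2 v" "L2 w" "nrm v \<le> S" "nrm w \<le> S"
  shows "\<bar>(nrm v)\<^sup>2 - (nrm w)\<^sup>2\<bar> \<le> 2 * S * nrm (\<lambda>x. v x - w x)"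
proof -
  have "(nrm v)\<^sup>2 - (nrm w)\<^sup>2 = (LINT x|lborel. (v x - w x) * (v x + w x))"
    unfolding nrm_sq Bochner_Integration.integral_diff[OF L2_sq[OF assms(1)] L2_sq[OF assms(2)], symmetric]
    by (rule Bochner_Integration.integral_cong) (auto simp: power2_eq_square algebra_simps)
  then have "\<bar>(nrm v)\<^sup>2 - (nrm w)\<^sup>2\<bar> \<le> nrm (\<lambda>x. v x - w x) * nrm (\<lambda>x. v x + w x)"
    using L2_Cauchy_Schwarz[OF L2_diff[OF assms(1,2)] L2_add[OF assms(1,2)]] by simp
  also have "\<dots> \<le> nrm (\<lambda>x. v x - w x) * (2 * S)"
    using nrm_triangle[OF assms(1,2)] assms(3,4) by (intro mult_left_mono nrm_nonneg) linarith
  finally show ?thesis by (simp add: mult.commute)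
qed

text \<open>Only the L2 norm of \<open>f - g\<close> enters and no derivative. So L2 convergence
  alone controls the potential energy of midpoints, before convergence in \<open>X\<close> is
  known.\<close>

lemma integral_W_Lipschitz:
  "\<exists>K\<ge>0. \<forall>f g. L2 f \<longrightarrow> L2 g \<longrightarrow> (\<forall>x. \<bar>f x\<bar> \<le> S) \<longrightarrow> (\<forall>x. \<bar>g x\<bar> \<le> S) \<longrightarrow>
     \<bar>(LINT x|lborel. W (f x)) - (LINT x|lborel. W (g x))\<bar> \<le> K * (nrm f + nrm g) * nrm (\<lambda>x. f x - g x)"
proof -
  obtain K where K: "0 \<le> K" "\<And>s t. \<bar>s\<bar> \<le> S \<Longrightarrow> \<bar>t\<bar> \<le> S \<Longrightarrow> \<bar>W s - W t\<bar> \<le> K * (\<bar>s\<bar> + \<bar>t\<bar>) * \<bar>s - t\<bar>"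
    using W_Lipschitz by blast
  have "\<bar>(LINT x|lborel. W (f x)) - (LINT x|lborel. W (g x))\<bar> \<le> K * (nrm f + nrm g) * nrm (\<lambda>x. f x - g x)"
    if L: "L2 f" "L2 g" and b: "\<And>x. \<bar>f x\<bar> \<le> S" "\<And>x. \<bar>g x\<bar> \<le> S" for f g
  proof -
    note [measurable] = L2_measurable[OF L(1)] L2_measurable[OF L(2)]
    have La: "L2 (\<lambda>x. \<bar>h x\<bar>)" if "L2 h" for h
      using that L2_measurable[OF that] by (auto simp: L2_def)
    have na: "nrm (\<lambda>x. \<bar>h x\<bar>) = nrm h" for h by (simp add: nrm_def)
    have i: "integrable lborel (\<lambda>x. (\<bar>f x\<bar> + \<bar>g x\<bar>) * \<bar>f x - g x\<bar>)"
      by (intro L2_mult_integrable L2_add La L2_diff L)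
    note iW = W_integrable[OF L(1) b(1)] W_integrable[OF L(2) b(2)]
    have "\<bar>(LINT x|lborel. W (f x)) - (LINT x|lborel. W (g x))\<bar> = \<bar>LINT x|lborel. W (f x) - W (g x)\<bar>"
      using iW by simp
    also have "\<dots> \<le> (LINT x|lborel. \<bar>W (f x) - W (g x)\<bar>)" by (rule integral_abs_bound)
    also have "\<dots> \<le> (LINT x|lborel. K * ((\<bar>f x\<bar> + \<bar>g x\<bar>) * \<bar>f x - g x\<bar>))"
      by (rule integral_mono) (use iW i K(2)[OF b] in \<open>auto simp: mult.assoc\<close>)
    also have "\<dots> = K * (LINT x|lborel. (\<bar>f x\<bar> + \<bar>g x\<bar>) * \<bar>f x - g x\<bar>)" by simp
    also have "\<dots> \<le> K * (nrm (\<lambda>x. \<bar>f x\<bar> + \<bar>g x\<bar>) * nrm (\<lambda>x. \<bar>f x - g x\<bar>))"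
      using L2_Cauchy_Schwarz[OF L2_add[OF La[OF L(1)] La[OF L(2)]] La[OF L2_diff[OF L]]]
      by (intro mult_left_mono K(1)) linarith
    also have "\<dots> \<le> K * ((nrm f + nrm g) * nrm (\<lambda>x. f x - g x))"
      using nrm_triangle[OF La[OF L(1)] La[OF L(2)]] unfolding na
      by (intro mult_left_mono mult_right_mono K(1) nrm_nonneg)
    finally show ?thesis by (simp add: mult.assoc)
  qed
  then show ?thesis using K(1) by blast
qed

lemma abs_half_sum_le:
  fixes a :: real
  assumes "\<bar>a - a'\<bar> \<le> A" "\<bar>b - b'\<bar> \<le> A" "\<bar>c - c'\<bar> \<le> B"
  shows "\<bar>(1/2 * (a + b) + c) - (1/2 * (a' + b') + c')\<bar> \<le> A + B"
  using assms unfolding distrib_left by linarith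

lemma energy_Lipschitz:
  "\<exists>K\<ge>0. \<forall>p\<in>X. \<forall>q\<in>X. Xnorm p \<le> S \<longrightarrow> Xnorm q \<le> S \<longrightarrow> \<bar>energy W p - energy W q\<bar> \<le> K * Xdist p q"
proof (cases "0 \<le> S")
  case False
  then show ?thesis using Xnorm_nonneg by (intro exI[of _ 0]) (auto dest: order_trans)
next
  case True
  obtain K where K: "0 \<le> K" "\<And>f g. L2 f \<Longrightarrow> L2 g \<Longrightarrow> (\<forall>x. \<bar>f x\<bar> \<le> 2 * S) \<Longrightarrow> (\<forall>x. \<bar>g x\<bar> \<le> 2 * S) \<Longrightarrow>
     \<bar>(LINT x|lborel. W (f x)) - (LINT x|lborel. W (g x))\<bar> \<le> K * (nrm f + nrm g) * nrm (\<lambda>x. f x - g x)"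
    using integral_W_Lipschitz[of "2 * S"] by blast
  have "\<bar>energy W p - energy W q\<bar> \<le> (2 * S + K * (2 * S)) * Xdist p q"
    if pq: "p \<in> X" "q \<in> X" and S: "Xnorm p \<le> S" "Xnorm q \<le> S" for p q
  proof -
    obtain f f1 f2 where f: "rep p f f1 f2" "nice f f1 f2" using X_rep[OF pq(1)] by metis
    obtain g g1 g2 where g: "rep q g g1 g2" "nice g g1 g2" using X_rep[OF pq(2)] by metis
    note bf = Xnorm_bounds[OF f(1)] and bg = Xnorm_bounds[OF g(1)] and d = Xdist_bounds[OF f(1) g(1)]
    have 1: "\<bar>(nrm (snd p))\<^sup>2 - (nrm (snd q))\<^sup>2\<bar> \<le> 2 * S * Xdist p q"
      using nrm_sq_diff_bound[OF repD(2)[OF f(1)] repD(2)[OF g(1)], of S] bf(1) bg(1) S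
        mult_left_mono[OF d(1), of "2 * S"] True by linarith
    have 2: "\<bar>(nrm f2)\<^sup>2 - (nrm g2)\<^sup>2\<bar> \<le> 2 * S * Xdist p q"
      using nrm_sq_diff_bound[OF niceD(3)[OF f(2)] niceD(3)[OF g(2)], of S] bf(2) bg(2) S
        mult_left_mono[OF d(2), of "2 * S"] True by linarith
    have "\<bar>(LINT x|lborel. W (f x)) - (LINT x|lborel. W (g x))\<bar> \<le> K * (nrm f + nrm g) * nrm (\<lambda>x. f x - g x)"
    proof (rule K(2)[OF niceD(1)[OF f(2)] niceD(1)[OF g(2)]])
      show "\<forall>x. \<bar>f x\<bar> \<le> 2 * S"
      proof
        fix x show "\<bar>f x\<bar> \<le> 2 * S" using nice_sup_bound(1)[OF f, of x] S by linarith
      qed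
      show "\<forall>x. \<bar>g x\<bar> \<le> 2 * S"
      proof
        fix x show "\<bar>g x\<bar> \<le> 2 * S" using nice_sup_bound(1)[OF g, of x] S by linarith
      qed
    qed
    also have "\<dots> \<le> K * (2 * S) * Xdist p q"
      using bf bg S True by (intro mult_mono d mult_left_mono K(1) nrm_nonneg mult_nonneg_nonneg) linarith+
    finally have 3: "\<bar>(LINT x|lborel. W (f x)) - (LINT x|lborel. W (g x))\<bar> \<le> K * (2 * S) * Xdist p q" .
    show ?thesis
      unfolding energy_rep[OF f(1)] energy_rep[OF g(1)] distrib_right
      by (rule abs_half_sum_le[OF 1 2 3])
  qed
  then show ?thesis using K(1) True by (intro exI[of _ "2 * S + K * (2 * S)"]) auto
qed

end

section \<open>Cutoffs and splitting\<close>

text \<open>Each such point is a minimum of the nonnegative mollifier; this includes the end points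
  \<open>0\<close> and \<open>1\<close>.\<close>

lemma deriv_mollifier_0: assumes "x \<notin> {0<..<1}" shows "deriv mollifier x = 0"
  by (rule DERIV_local_min[OF test_fun_DERIV[OF mollifier(1)], of 1]) (use mollifier(2,4) assms in auto)

lemma test_fun_bounded: assumes "test_fun \<phi>" obtains B where "0 \<le> B" "\<And>x. \<bar>\<phi> x\<bar> \<le> B"
proof -
  obtain R where R: "0 < R" "\<And>x. R \<le> \<bar>x\<bar> \<Longrightarrow> \<phi> x = 0" using test_fun_support[OF assms] by blast
  obtain B where B: "\<And>x. x \<in> {-R..R} \<Longrightarrow> \<bar>\<phi> x\<bar> \<le> B"
    using continuous_bounded_Icc[OF test_fun_continuous[OF assms]] by blast
  have "\<bar>\<phi> x\<bar> \<le> \<bar>B\<bar>" for x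
  proof (cases "x \<in> {-R..R}")
    case True
    then show ?thesis using B[OF True] by linarith
  next
    case False
    then have "R \<le> \<bar>x\<bar>" by auto
    then show ?thesis using R(2) by simp
  qed
  then show thesis using that[of "\<bar>B\<bar>"] by simp
qed

text \<open>\<open>B\<close> is kept separate from the plateau width \<open>k\<close> so that one
  \<open>B\<close> can serve all \<open>k\<close>. The function varies only in a shell of width one,
  so the cost of cutting is governed by the mass in that shell.\<close>

definition cutoff_bounded :: "real \<Rightarrow> real \<Rightarrow> (real \<Rightarrow> real) \<Rightarrow> bool" where
  "cutoff_bounded B k s \<longleftrightarrow> smooth s \<and> (\<forall>x. 0 \<le> s x \<and> s x \<le> 1 \<and> \<bar>deriv s x\<bar> \<le> B \<and> \<bar>deriv (deriv s) x\<bar> \<le> B) \<and>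
     (\<forall>x. \<bar>x\<bar> \<le> k \<longrightarrow> s x = 1 \<and> deriv s x = 0 \<and> deriv (deriv s) x = 0) \<and>
     (\<forall>x. k + 1 \<le> \<bar>x\<bar> \<longrightarrow> s x = 0 \<and> deriv s x = 0 \<and> deriv (deriv s) x = 0)"

text \<open>The primitive \<open>S\<close> of the mollifier climbs from \<open>0\<close> to
  \<open>1\<close> on the unit interval; the difference of two of its translates is a plateau with
  rims of width one.\<close>

lemma cutoff_exists: "\<exists>B\<ge>0. \<forall>k\<ge>0. \<exists>s. cutoff_bounded B k s"
proof -
  have mc: "continuous_on UNIV mollifier" by (rule test_fun_continuous[OF mollifier(1)])
  obtain F where F: "ac F mollifier" using ac_exists[OF locint_continuous[OF mc]] by blast
  define S where "S x = F x - F 0" for x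
  have DS: "(S has_real_derivative mollifier x) (at x)" for x
    unfolding S_def using ac_DERIV[OF F mc, of x] by (auto intro!: derivative_eq_intros)
  have smS: "smooth S" by (rule smooth_antideriv[OF DS]) (use mollifier(1) in \<open>simp add: test_fun_iff\<close>)
  have dS: "S b - S a = (LINT t:{a..b}|lborel. mollifier t)" if "a \<le> b" for a b
    using ac_diff_eq[OF F that] by (simp add: S_def)
  have mono: "S a \<le> S b" if "a \<le> b" for a b
  proof -
    have "0 \<le> (LINT t:{a..b}|lborel. mollifier t)"
      unfolding set_lebesgue_integral_def by (rule integral_nonneg_AE) (simp add: mollifier(2))
    then show ?thesis using dS[OF that] by simp
  qed
  have const: "S b = S a" if "a \<le> b" "\<And>t. t \<in> {a..b} \<Longrightarrow> t \<notin> {0<..<1}" for a b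
  proof -
    have "indicat_real {a..b} t *\<^sub>R mollifier t = 0" for t
      using that(2)[of t] mollifier(4)[of t] by (cases "t \<in> {a..b}") auto
    then have "(LINT t:{a..b}|lborel. mollifier t) = 0" by (simp only: set_lebesgue_integral_def integral_zero)
    then show ?thesis using dS[OF that(1)] by simp
  qed
  have S0: "S x = 0" if "x \<le> 0" for x
    using const[of x 0] that by (simp add: S_def)
  have "(LINT t:{0..1}|lborel. mollifier t) = (LINT t|lborel. mollifier t)"
    unfolding set_lebesgue_integral_def
  proof (rule Bochner_Integration.integral_cong)
    fix t show "indicat_real {0..1} t *\<^sub>R mollifier t = mollifier t"
      using mollifier(4)[of t] by (cases "t \<in> {0..1}") auto
  qed simp
  then have "S 1 = 1" using dS[of 0 1] S0[of 0] mollifier(3) by simp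
  then have S1: "S x = 1" if "1 \<le> x" for x
    using const[of 1 x] that by simp
  have S01: "0 \<le> S x" "S x \<le> 1" for x
    using mono[of "min x 0" x] S0[of "min x 0"] mono[of x "max x 1"] S1[of "max x 1"] by auto
  obtain B1 where B1: "0 \<le> B1" "\<And>x. \<bar>mollifier x\<bar> \<le> B1" using test_fun_bounded[OF mollifier(1)] by blast
  obtain B2 where B2: "0 \<le> B2" "\<And>x. \<bar>deriv mollifier x\<bar> \<le> B2"
    using test_fun_bounded[OF test_fun_deriv[OF mollifier(1)]] by blast
  define B where "B = 2 * B1 + 2 * B2"
  have "\<exists>s. cutoff_bounded B k s" if k: "0 \<le> k" for k
  proof
    define s where "s x = S (x + (k + 1)) - S (x + (- k))" for x
    have "smooth s" unfolding s_def[abs_def]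
      using smooth_affine[OF smS, of 1 "k + 1"] smooth_affine[OF smS, of 1 "- k"] by (intro smooth_diff) simp_all
    have D1: "deriv s = (\<lambda>x. mollifier (x + (k + 1)) - mollifier (x + (- k)))"
    proof
      fix x show "deriv s x = mollifier (x + (k + 1)) - mollifier (x + (- k))"
        unfolding s_def[abs_def]
        by (intro DERIV_imp_deriv DERIV_diff DERIV_shift[THEN iffD1] DS)
    qed
    have D2: "deriv (deriv s) = (\<lambda>x. deriv mollifier (x + (k + 1)) - deriv mollifier (x + (- k)))"
    proof
      fix x show "deriv (deriv s) x = deriv mollifier (x + (k + 1)) - deriv mollifier (x + (- k))"
        unfolding D1
        by (intro DERIV_imp_deriv DERIV_diff DERIV_shift[THEN iffD1] test_fun_DERIV mollifier(1))
    qed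
    have out: "mollifier x = 0" "deriv mollifier x = 0" if "x \<le> 0 \<or> 1 \<le> x" for x
      using that mollifier(4)[of x] deriv_mollifier_0[of x] by auto
    have bnd: "0 \<le> s x \<and> s x \<le> 1 \<and> \<bar>deriv s x\<bar> \<le> B \<and> \<bar>deriv (deriv s) x\<bar> \<le> B" for x
    proof (intro conjI)
      show "0 \<le> s x" using mono[of "x + - k" "x + (k + 1)"] k by (simp add: s_def)
      show "s x \<le> 1" using S01[of "x + - k"] S01[of "x + (k+1)"] by (simp add: s_def)
      show "\<bar>deriv s x\<bar> \<le> B" unfolding D1
        using B1(2)[of "x + (k + 1)"] B1(2)[of "x + - k"] B2(1) unfolding B_def by linarith
      show "\<bar>deriv (deriv s) x\<bar> \<le> B" unfolding D2
        using B2(2)[of "x + (k + 1)"] B2(2)[of "x + - k"] B1(1) unfolding B_def by linarith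
    qed
    have inside: "s x = 1 \<and> deriv s x = 0 \<and> deriv (deriv s) x = 0" if "\<bar>x\<bar> \<le> k" for x
    proof -
      have "1 \<le> x + (k + 1)" "x + - k \<le> 0" using that by auto
      then show ?thesis using fun_cong[OF D1, of x] fun_cong[OF D2, of x] by (simp add: s_def out S0 S1)
    qed
    have outside: "s x = 0 \<and> deriv s x = 0 \<and> deriv (deriv s) x = 0" if "k + 1 \<le> \<bar>x\<bar>" for x
    proof -
      consider "x + (k + 1) \<le> 0" "x + - k \<le> 0" | "1 \<le> x + (k + 1)" "1 \<le> x + - k" using k \<open>k + 1 \<le> \<bar>x\<bar>\<close> by linarith
      then show ?thesis using fun_cong[OF D1, of x] fun_cong[OF D2, of x] by cases (simp_all add: s_def out S0 S1)
    qed
    show "cutoff_bounded B k s"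
      unfolding cutoff_bounded_def using \<open>smooth s\<close> bnd inside outside by blast
  qed
  then show ?thesis using B1 B2 by (intro exI[of _ B]) (auto simp: B_def)
qed

text \<open>Pointwise cost of cutting inside the shell. \<open>A\<close> is the second derivative of
  the piece \<open>s * f\<close> and \<open>f2 - A\<close> that of the remainder. The constants are
  crude; it matters only that they depend on \<open>B\<close> and \<open>K\<close> alone.\<close>

lemma density_split_bound:
  fixes s v f f1 f2 d1 d2 B :: real
  assumes s: "0 \<le> s" "s \<le> 1" and B: "\<bar>d1\<bar> \<le> B" "\<bar>d2\<bar> \<le> B"
    and K: "a \<le> K * f\<^sup>2" "b \<le> K * f\<^sup>2" "0 \<le> K"
  defines "A \<equiv> s * f2 + 2 * (d1 * f1) + d2 * f"
  shows "(1/2 * ((s * v)\<^sup>2 + A\<^sup>2) + a) + (1/2 * ((v - s * v)\<^sup>2 + (f2 - A)\<^sup>2) + b)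
    \<le> (7 + 18 * B\<^sup>2 + 2 * K) * (v\<^sup>2 + f\<^sup>2 + f1\<^sup>2 + f2\<^sup>2)"
proof -
  define Z where "Z = v\<^sup>2 + f\<^sup>2 + f1\<^sup>2 + f2\<^sup>2"
  have sq: "s\<^sup>2 \<le> 1" "(1 - s)\<^sup>2 \<le> 1" using s by (simp_all add: power_le_one)
  have v1: "(s * v)\<^sup>2 \<le> v\<^sup>2" "(v - s * v)\<^sup>2 \<le> v\<^sup>2"
  proof -
    show "(s * v)\<^sup>2 \<le> v\<^sup>2" using mult_right_mono[OF sq(1), of "v\<^sup>2"] by (simp add: power_mult_distrib)
    have "v - s * v = (1 - s) * v" by (simp add: algebra_simps)
    then show "(v - s * v)\<^sup>2 \<le> v\<^sup>2" using mult_right_mono[OF sq(2), of "v\<^sup>2"] by (simp add: power_mult_distrib)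
  qed
  have d: "d1\<^sup>2 \<le> B\<^sup>2" "d2\<^sup>2 \<le> B\<^sup>2" using B abs_le_square_iff[of d1 B] abs_le_square_iff[of d2 B] by linarith+
  have "A\<^sup>2 \<le> 3 * ((s * f2)\<^sup>2 + (2 * (d1 * f1))\<^sup>2 + (d2 * f)\<^sup>2)"
    unfolding A_def
    using sum_squares_ge_zero[of "s * f2 - 2 * (d1 * f1)" "s * f2 - d2 * f"] zero_le_power2[of "2 * (d1 * f1) - d2 * f"]
    by (simp add: power2_eq_square algebra_simps)
  also have "\<dots> \<le> 3 * (f2\<^sup>2 + 4 * (B\<^sup>2 * f1\<^sup>2) + B\<^sup>2 * f\<^sup>2)"
    using mult_right_mono[OF sq(1), of "f2\<^sup>2"] mult_right_mono[OF d(1), of "f1\<^sup>2"] mult_right_mono[OF d(2), of "f\<^sup>2"]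
    by (simp add: power_mult_distrib)
  also have "\<dots> \<le> (3 + 12 * B\<^sup>2) * Z"
    unfolding Z_def by (simp add: algebra_simps)
  finally have A2: "A\<^sup>2 \<le> (3 + 12 * B\<^sup>2) * Z" .
  have "(f2 - A)\<^sup>2 \<le> 2 * f2\<^sup>2 + 2 * A\<^sup>2"
    using zero_le_power2[of "f2 + A"] by (simp add: power2_eq_square algebra_simps)
  moreover have "f2\<^sup>2 \<le> Z" "v\<^sup>2 \<le> Z" "f\<^sup>2 \<le> Z" "0 \<le> Z" by (auto simp: Z_def)
  moreover have "K * f\<^sup>2 \<le> K * Z" using K(3) \<open>f\<^sup>2 \<le> Z\<close> by (rule mult_left_mono[rotated])
  \<comment> \<open>The quadratic parts of the two pieces add up to at most
    \<open>v^2 + f2^2 + 3/2 * A^2\<close>.\<close>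
  ultimately have "(1/2 * ((s * v)\<^sup>2 + A\<^sup>2) + a) + (1/2 * ((v - s * v)\<^sup>2 + (f2 - A)\<^sup>2) + b)
     \<le> 2 * Z + 3/2 * ((3 + 12 * B\<^sup>2) * Z) + 2 * (K * Z)"
    using v1 A2 K(1,2) unfolding distrib_left by linarith
  also have "\<dots> \<le> (7 + 18 * B\<^sup>2 + 2 * K) * Z" using \<open>0 \<le> Z\<close> by (simp add: algebra_simps)
  finally show ?thesis by (simp add: Z_def)
qed

text \<open>The defect is \<open>2 * s * (1 - s) * v * f1 + (1 - 2 * s) * d1 * v * f\<close>. Both
  terms live in the shell only, and Young's inequality bounds them by the density there.\<close>

lemma momentum_density_split_bound:
  fixes s v f f1 f2 d1 B :: real
  assumes s: "0 \<le> s" "s \<le> 1" and B: "\<bar>d1\<bar> \<le> B"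
  shows "\<bar>v * f1 - (s * v) * (s * f1 + d1 * f) - (v - s * v) * (f1 - (s * f1 + d1 * f))\<bar>
    \<le> (1 + B) * (v\<^sup>2 + f\<^sup>2 + f1\<^sup>2 + f2\<^sup>2)"
proof -
  have "v * f1 - (s * v) * (s * f1 + d1 * f) - (v - s * v) * (f1 - (s * f1 + d1 * f))
     = 2 * (s * (1 - s)) * (v * f1) + (1 - 2 * s) * d1 * (v * f)"
    by (simp add: algebra_simps)
  also have "\<bar>\<dots>\<bar> \<le> 2 * \<bar>v * f1\<bar> + 2 * (B * \<bar>v * f\<bar>)"
  proof -
    have "\<bar>s * (1 - s)\<bar> \<le> 1" using s by (auto simp: abs_mult intro: mult_le_one)
    then have "\<bar>s * (1 - s)\<bar> * \<bar>v * f1\<bar> \<le> 1 * \<bar>v * f1\<bar>" by (rule mult_right_mono) simp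
    moreover have "\<bar>(1 - 2 * s) * d1\<bar> \<le> 1 * B" unfolding abs_mult using s B by (intro mult_mono) auto
    then have "\<bar>(1 - 2 * s) * d1\<bar> * \<bar>v * f\<bar> \<le> B * \<bar>v * f\<bar>" by (intro mult_right_mono) auto
    moreover have "0 \<le> B * \<bar>v * f\<bar>" using B by simp
    ultimately show ?thesis
      using abs_triangle_ineq[of "2 * (s * (1 - s)) * (v * f1)" "(1 - 2 * s) * d1 * (v * f)"]
      by (simp add: abs_mult mult.assoc)
  qed
  also have "\<dots> \<le> (v\<^sup>2 + f1\<^sup>2) + B * (v\<^sup>2 + f\<^sup>2)"
  proof -
    have "2 * \<bar>v * w\<bar> \<le> v\<^sup>2 + w\<^sup>2" for w
      using sum_squares_bound[of "\<bar>v\<bar>" "\<bar>w\<bar>"] by (simp add: abs_mult)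
    moreover have "0 \<le> B" using B by linarith
    ultimately have "B * (2 * \<bar>v * f\<bar>) \<le> B * (v\<^sup>2 + f\<^sup>2)" "2 * \<bar>v * f1\<bar> \<le> v\<^sup>2 + f1\<^sup>2"
      by (auto intro: mult_left_mono)
    then show ?thesis by (simp add: algebra_simps)
  qed
  also have "\<dots> \<le> (1 + B) * (v\<^sup>2 + f\<^sup>2 + f1\<^sup>2 + f2\<^sup>2)" using B by (simp add: algebra_simps)
  finally show ?thesis .
qed

text \<open>Pigeonhole: the \<open>N\<close> disjoint shells
  \<open>k \<le> \<bar>x\<bar> < k + 1\<close> share the mass of \<open>d\<close>, so one of them
  carries at most the fraction \<open>1 / N\<close>.\<close>

lemma small_annulus:
  fixes d :: "real \<Rightarrow> real"
  assumes d: "integrable lborel d" "\<And>x. 0 \<le> d x" and N: "0 < N"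
  shows "\<exists>k\<in>{N..<2*N}. real N * (LINT x|lborel. indicator {x. nat \<lfloor>\<bar>x\<bar>\<rfloor> = k} x * d x) \<le> (LINT x|lborel. d x)"
proof (rule ccontr)
  define t where "t k = (LINT x|lborel. indicator {x. nat \<lfloor>\<bar>x\<bar>\<rfloor> = k} x * d x)" for k
  assume "\<not> ?thesis"
  then have lt: "(LINT x|lborel. d x) / real N < t k" if "k \<in> {N..<2*N}" for k
    using that N by (auto simp: t_def field_simps not_le)
  have m[measurable]: "{x::real. nat \<lfloor>\<bar>x\<bar>\<rfloor> = k} \<in> sets borel" for k by measurable
  have i: "integrable lborel (\<lambda>x. indicator {x. nat \<lfloor>\<bar>x\<bar>\<rfloor> = k} x * d x)" for k
    using integrable_mult_indicator[OF _ d(1), of "{x::real. nat \<lfloor>\<bar>x\<bar>\<rfloor> = k}"] m by simp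
  have "(\<Sum>k\<in>{N..<2*N}. (LINT x|lborel. d x) / real N) < (\<Sum>k\<in>{N..<2*N}. t k)"
    by (rule sum_strict_mono) (use N lt in auto)
  also have "\<dots> = (LINT x|lborel. (\<Sum>k\<in>{N..<2*N}. indicator {x. nat \<lfloor>\<bar>x\<bar>\<rfloor> = k} x * d x))"
    unfolding t_def by (rule Bochner_Integration.integral_sum[symmetric]) (rule i)
  also have "\<dots> \<le> (LINT x|lborel. d x)"
  proof (rule integral_mono)
    show "integrable lborel (\<lambda>x. \<Sum>k\<in>{N..<2*N}. indicator {x. nat \<lfloor>\<bar>x\<bar>\<rfloor> = k} x * d x)"
      by (intro Bochner_Integration.integrable_sum i)
    fix x
    have "(\<Sum>k\<in>{N..<2*N}. indicator {x. nat \<lfloor>\<bar>x\<bar>\<rfloor> = k} x * d x) = (\<Sum>k\<in>{N..<2*N}. if nat \<lfloor>\<bar>x\<bar>\<rfloor> = k then d x else 0)"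
      by (rule sum.cong) (auto simp: indicator_def)
    then show "(\<Sum>k\<in>{N..<2*N}. indicator {x. nat \<lfloor>\<bar>x\<bar>\<rfloor> = k} x * d x) \<le> d x" using d(2)[of x] by simp
  qed (rule d(1))
  finally show False using N by simp
qed

context potential begin

lemma energy_density:
  assumes "rep p f f1 f2" "\<And>x. \<bar>f x\<bar> \<le> S"
  shows "integrable lborel (\<lambda>x. 1/2 * ((snd p x)\<^sup>2 + (f2 x)\<^sup>2) + W (f x))"
    "energy W p = (LINT x|lborel. 1/2 * ((snd p x)\<^sup>2 + (f2 x)\<^sup>2) + W (f x))"
proof -
  have i: "integrable lborel (\<lambda>x. (snd p x)\<^sup>2)" "integrable lborel (\<lambda>x. (f2 x)\<^sup>2)" "integrable lborel (\<lambda>x. W (f x))"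
    using L2_sq[OF repD(2)[OF assms(1)]] L2_sq[OF sobolev2D(3)[OF repD(1)[OF assms(1)]]]
      W_integrable[OF sobolev2D(1)[OF repD(1)[OF assms(1)]] assms(2)] by auto
  show "integrable lborel (\<lambda>x. 1/2 * ((snd p x)\<^sup>2 + (f2 x)\<^sup>2) + W (f x))" using i by simp
  show "energy W p = (LINT x|lborel. 1/2 * ((snd p x)\<^sup>2 + (f2 x)\<^sup>2) + W (f x))"
    unfolding energy_rep[OF assms(1)] nrm_sq using i by simp
qed

text \<open>Place the rim of the cutoff in the poorest shell between \<open>N\<close> and
  \<open>2 * N\<close>. The shell depends on the state, but the loss \<open>c / N\<close> only on
  the norm bound, so the estimate is uniform along a sequence. The piece \<open>a\<close> keeps all
  of the state on \<open>\<bar>x\<bar> \<le> N\<close>, and \<open>b\<close> all of it on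
  \<open>2 * N \<le> \<bar>x\<bar>\<close>.\<close>

lemma energy_splitting:
  "\<exists>c\<ge>0. \<forall>p f f1 f2 N. rep p f f1 f2 \<longrightarrow> nice f f1 f2 \<longrightarrow> Xnorm p \<le> S \<longrightarrow> 0 < N \<longrightarrow>
    (\<exists>a\<in>X. \<exists>b\<in>X. energy W a + energy W b \<le> energy W p + c / real N \<and>
      \<bar>momentum p - momentum a - momentum b\<bar> \<le> c / real N \<and>
      (LINT x|lborel. indicator {x. \<bar>x\<bar> \<le> real N} x * W (f x)) \<le> energy W a \<and>
      (LINT x|lborel. indicator {x. 2 * real N \<le> \<bar>x\<bar>} x * W (f x)) \<le> energy W b)"
proof -
  obtain B where B: "0 \<le> B" "\<And>k. 0 \<le> k \<Longrightarrow> \<exists>s. cutoff_bounded B k s" using cutoff_exists by blast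
  obtain K where K: "0 \<le> K" "\<And>s. \<bar>s\<bar> \<le> 2 * S \<Longrightarrow> W s \<le> K * s\<^sup>2" using W_quadratic_upper by blast
  define c0 where "c0 = (7 + 18 * B\<^sup>2 + 2 * K) + (1 + B)"
  have c0: "0 \<le> c0" "7 + 18 * B\<^sup>2 + 2 * K \<le> c0" "1 + B \<le> c0" using B K by (auto simp: c0_def)
  \<comment> \<open>\<open>4 * S^2\<close> bounds the integral of the density, whose four terms have
    norm at most \<open>S\<close> each.\<close>
  define c where "c = c0 * (4 * S\<^sup>2)"
  have "\<exists>a\<in>X. \<exists>b\<in>X. energy W a + energy W b \<le> energy W p + c / real N \<and>
      \<bar>momentum p - momentum a - momentum b\<bar> \<le> c / real N \<and>
      (LINT x|lborel. indicator {x. \<bar>x\<bar> \<le> real N} x * W (f x)) \<le> energy W a \<and>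
      (LINT x|lborel. indicator {x. 2 * real N \<le> \<bar>x\<bar>} x * W (f x)) \<le> energy W b"
    if r: "rep p f f1 f2" and n: "nice f f1 f2" and S: "Xnorm p \<le> S" and N: "0 < N" for p f f1 f2 and N :: nat
  proof -
    define v where "v = snd p"
    have v: "L2 v" unfolding v_def by (rule repD(2)[OF r])
    note L = niceD[OF n]
    define d where "d x = (v x)\<^sup>2 + (f x)\<^sup>2 + (f1 x)\<^sup>2 + (f2 x)\<^sup>2" for x
    have dint: "integrable lborel d" unfolding d_def[abs_def] using L2_sq[OF v] L2_sq[OF L(1)] L2_sq[OF L(2)] L2_sq[OF L(3)] by simp
    have d0: "0 \<le> d x" for x by (simp add: d_def)
    have "(LINT x|lborel. d x) = (nrm v)\<^sup>2 + (nrm f)\<^sup>2 + (nrm f1)\<^sup>2 + (nrm f2)\<^sup>2"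
      unfolding d_def nrm_sq using L2_sq[OF v] L2_sq[OF L(1)] L2_sq[OF L(2)] L2_sq[OF L(3)] by simp
    also have "\<dots> \<le> 4 * S\<^sup>2"
    proof -
      have "(nrm h)\<^sup>2 \<le> S\<^sup>2" if "nrm h \<le> Xnorm p" for h
        using that S nrm_nonneg[of h] by (intro power_mono) linarith+
      then show ?thesis using Xnorm_bounds[OF r] unfolding v_def by (smt (verit))
    qed
    finally have dS: "(LINT x|lborel. d x) \<le> 4 * S\<^sup>2" .
    obtain k where k: "k \<in> {N..<2*N}"
      "real N * (LINT x|lborel. indicator {x. nat \<lfloor>\<bar>x\<bar>\<rfloor> = k} x * d x) \<le> (LINT x|lborel. d x)"
      using small_annulus[OF dint d0 N] by blast
    define T where "T = {x::real. nat \<lfloor>\<bar>x\<bar>\<rfloor> = k}"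
    have Tm[measurable]: "T \<in> sets borel" unfolding T_def by measurable
    have iT: "integrable lborel (\<lambda>x. indicator T x * d x)"
      using integrable_mult_indicator[OF _ dint, of T] Tm by simp
    have outT: "\<bar>x\<bar> \<le> real k \<or> real k + 1 \<le> \<bar>x\<bar>" if "x \<notin> T" for x
    proof (rule ccontr)
      assume "\<not> ?thesis"
      then have "real k \<le> \<bar>x\<bar>" "\<bar>x\<bar> < real k + 1" by auto
      then have "\<lfloor>\<bar>x\<bar>\<rfloor> = int k" by (intro floor_unique) auto
      then show False using that by (simp add: T_def)
    qed
    have tS: "(LINT x|lborel. indicator T x * d x) \<le> 4 * S\<^sup>2 / real N"
      using k(2) dS N unfolding T_def[symmetric] by (simp add: field_simps)
    have ctS: "c0 * (LINT x|lborel. indicator T x * d x) \<le> c / real N"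
      using mult_left_mono[OF tS c0(1)] by (simp add: c_def)
    obtain s where cb: "cutoff_bounded B (real k) s" using B(2)[of "real k"] by auto
    then have s: "smooth s" "\<And>x. 0 \<le> s x" "\<And>x. s x \<le> 1" "\<And>x. \<bar>deriv s x\<bar> \<le> B" "\<And>x. \<bar>deriv (deriv s) x\<bar> \<le> B"
      and s_in: "\<And>x. \<bar>x\<bar> \<le> real k \<Longrightarrow> s x = 1 \<and> deriv s x = 0 \<and> deriv (deriv s) x = 0"
      and s_out: "\<And>x. real k + 1 \<le> \<bar>x\<bar> \<Longrightarrow> s x = 0 \<and> deriv s x = 0 \<and> deriv (deriv s) x = 0"
      unfolding cutoff_bounded_def by blast+
    have ms: "s \<in> borel_measurable borel" by (rule borel_measurable_continuous_onI[OF smooth_continuous[OF s(1)]])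
    define A1 where "A1 x = s x * f1 x + deriv s x * f x" for x
    define A2 where "A2 x = s x * f2 x + 2 * (deriv s x * f1 x) + deriv (deriv s) x * f x" for x
    have sa: "sobolev2 (\<lambda>x. s x * f x) A1 A2"
      unfolding A1_def[abs_def] A2_def[abs_def]
    \<comment> \<open>\<open>B + 1\<close> also covers the bound \<open>1\<close> on the cutoff
      itself.\<close>
    proof (rule sobolev2_mult_smooth[OF nice_sobolev2[OF n] s(1), of "B + 1"])
      fix x
      show "\<bar>s x\<bar> \<le> B + 1" using s(2,3)[of x] B(1) by linarith
      show "\<bar>deriv s x\<bar> \<le> B + 1" using s(4)[of x] by linarith
      show "\<bar>deriv (deriv s) x\<bar> \<le> B + 1" using s(5)[of x] by linarith
    qed
    have sb: "sobolev2 (\<lambda>x. f x - s x * f x) (\<lambda>x. f1 x - A1 x) (\<lambda>x. f2 x - A2 x)"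
      by (rule sobolev2_diff[OF nice_sobolev2[OF n] sa])
    have va: "L2 (\<lambda>x. s x * v x)" by (rule L2_bounded_mult[OF v ms, of 1]) (use s in auto)
    have vb: "L2 (\<lambda>x. v x - s x * v x)" by (rule L2_diff[OF v va])
    define a where "a = (\<lambda>x. s x * f x, \<lambda>x. s x * v x)"
    define b where "b = (\<lambda>x. f x - s x * f x, \<lambda>x. v x - s x * v x)"
    have ra: "rep a (\<lambda>x. s x * f x) A1 A2" unfolding a_def by (rule rep_self[OF sa va])
    have rb: "rep b (\<lambda>x. f x - s x * f x) (\<lambda>x. f1 x - A1 x) (\<lambda>x. f2 x - A2 x)"
      unfolding b_def by (rule rep_self[OF sb vb])
    have f_le: "\<bar>f x\<bar> \<le> 2 * S" for x using nice_sup_bound(1)[OF r n, of x] S by linarith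
    have sf_le: "\<bar>s x * f x\<bar> \<le> \<bar>f x\<bar>" "\<bar>f x - s x * f x\<bar> \<le> \<bar>f x\<bar>" for x
    proof -
      show "\<bar>s x * f x\<bar> \<le> \<bar>f x\<bar>" using s(2,3)[of x] by (simp add: abs_mult mult_left_le_one_le)
      have "f x - s x * f x = (1 - s x) * f x" by (simp add: algebra_simps)
      then show "\<bar>f x - s x * f x\<bar> \<le> \<bar>f x\<bar>" using s(2,3)[of x] by (simp add: abs_mult mult_left_le_one_le)
    qed
    have Wa: "W (s x * f x) \<le> K * (f x)\<^sup>2" "W (f x - s x * f x) \<le> K * (f x)\<^sup>2" for x
    proof -
      have "W y \<le> K * (f x)\<^sup>2" if "\<bar>y\<bar> \<le> \<bar>f x\<bar>" for y
      proof -
        have "W y \<le> K * y\<^sup>2" using that f_le[of x] by (intro K(2)) linarith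
        also have "\<dots> \<le> K * (f x)\<^sup>2" using that K(1) abs_le_square_iff[of y "f x"] by (intro mult_left_mono) auto
        finally show ?thesis .
      qed
      then show "W (s x * f x) \<le> K * (f x)\<^sup>2" "W (f x - s x * f x) \<le> K * (f x)\<^sup>2" using sf_le by blast+
    qed
    define ep where "ep x = 1/2 * ((v x)\<^sup>2 + (f2 x)\<^sup>2) + W (f x)" for x
    define ea where "ea x = 1/2 * ((s x * v x)\<^sup>2 + (A2 x)\<^sup>2) + W (s x * f x)" for x
    define eb where "eb x = 1/2 * ((v x - s x * v x)\<^sup>2 + (f2 x - A2 x)\<^sup>2) + W (f x - s x * f x)" for x
    have ep: "integrable lborel ep" "energy W p = (LINT x|lborel. ep x)"
      unfolding ep_def[abs_def] v_def using energy_density[OF r f_le] by auto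
    have ea: "integrable lborel ea" "energy W a = (LINT x|lborel. ea x)"
      unfolding ea_def[abs_def] using energy_density[OF ra order_trans[OF sf_le(1) f_le]] by (auto simp: a_def)
    have eb: "integrable lborel eb" "energy W b = (LINT x|lborel. eb x)"
      unfolding eb_def[abs_def] using energy_density[OF rb order_trans[OF sf_le(2) f_le]] by (auto simp: b_def)
    have enn: "0 \<le> ea x" "0 \<le> eb x" "0 \<le> ep x" for x by (auto simp: ea_def eb_def ep_def intro!: add_nonneg_nonneg W_nonneg)
    have in_val: "ea x = ep x" "eb x = 0" "A1 x = f1 x" "s x = 1" if "\<bar>x\<bar> \<le> real k" for x
      using s_in[OF that] by (auto simp: ea_def eb_def ep_def A1_def A2_def W_0)
    have out_val: "eb x = ep x" "ea x = 0" "A1 x = 0" "s x = 0" if "real k + 1 \<le> \<bar>x\<bar>" for x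
      using s_out[OF that] by (auto simp: ea_def eb_def ep_def A1_def A2_def W_0)
    have pt: "ea x + eb x \<le> ep x + c0 * (indicator T x * d x)" for x
    proof (cases "x \<in> T")
      case True
      have "ea x + eb x \<le> (7 + 18 * B\<^sup>2 + 2 * K) * d x"
        unfolding ea_def eb_def A2_def d_def
        by (rule density_split_bound[OF s(2,3) s(4,5) Wa K(1)])
      also have "\<dots> \<le> c0 * d x" by (rule mult_right_mono[OF c0(2) d0])
      finally show ?thesis using enn(3)[of x] True by simp
    next
      case False
      then show ?thesis using outT[OF False] in_val[of x] out_val[of x] by auto
    qed
    have 1: "energy W a + energy W b \<le> energy W p + c / real N"
    proof -
      have "energy W a + energy W b = (LINT x|lborel. ea x + eb x)" using ea eb by simp
      also have "\<dots> \<le> (LINT x|lborel. ep x + c0 * (indicator T x * d x))"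
        by (rule integral_mono) (use ea eb ep iT pt in auto)
      also have "\<dots> = energy W p + c0 * (LINT x|lborel. indicator T x * d x)" using ep iT by simp
      finally show ?thesis using ctS by linarith
    qed
    have 2: "\<bar>momentum p - momentum a - momentum b\<bar> \<le> c / real N"
    proof -
      define mp where "mp x = v x * f1 x" for x
      define ma where "ma x = (s x * v x) * A1 x" for x
      define mb where "mb x = (v x - s x * v x) * (f1 x - A1 x)" for x
      have i: "integrable lborel mp" "integrable lborel ma" "integrable lborel mb"
        unfolding mp_def[abs_def] ma_def[abs_def] mb_def[abs_def]
        by (intro L2_mult_integrable v va vb L sobolev2D[OF sa] sobolev2D[OF sb])+
      have "momentum p - momentum a - momentum b = - (LINT x|lborel. mp x - ma x - mb x)"
        unfolding momentum_rep[OF r] momentum_rep[OF ra] momentum_rep[OF rb]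
        using i by (simp add: a_def b_def v_def mp_def[abs_def] ma_def[abs_def] mb_def[abs_def])
      then have "\<bar>momentum p - momentum a - momentum b\<bar> \<le> (LINT x|lborel. \<bar>mp x - ma x - mb x\<bar>)"
        using integral_abs_bound[of lborel "\<lambda>x. mp x - ma x - mb x"] by simp
      also have "\<dots> \<le> (LINT x|lborel. c0 * (indicator T x * d x))"
      proof (rule integral_mono)
        show "integrable lborel (\<lambda>x. \<bar>mp x - ma x - mb x\<bar>)" using i by simp
        show "integrable lborel (\<lambda>x. c0 * (indicator T x * d x))" using iT by simp
        fix x show "\<bar>mp x - ma x - mb x\<bar> \<le> c0 * (indicator T x * d x)"
        proof (cases "x \<in> T")
          case True
          have "\<bar>mp x - ma x - mb x\<bar> \<le> (1 + B) * d x"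
            unfolding mp_def ma_def mb_def A1_def d_def by (rule momentum_density_split_bound[OF s(2,3,4)])
          also have "\<dots> \<le> c0 * d x" by (rule mult_right_mono[OF c0(3) d0])
          finally show ?thesis using True by simp
        next
          case False
          then show ?thesis using outT[OF False] in_val[of x] out_val[of x] by (auto simp: mp_def ma_def mb_def)
        qed
      qed
      also have "\<dots> = c0 * (LINT x|lborel. indicator T x * d x)" by simp
      finally show ?thesis using ctS by linarith
    qed
    have iW: "integrable lborel (\<lambda>x. indicator A x * W (f x))" if "A \<in> sets borel" for A
      using integrable_mult_indicator[OF _ W_integrable_nice[OF n], of A] that by simp
    have We: "W (f x) \<le> ep x" for x by (simp add: ep_def)
    have 3: "(LINT x|lborel. indicator {x. \<bar>x\<bar> \<le> real N} x * W (f x)) \<le> energy W a"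
      unfolding ea(2)
    proof (rule integral_mono[OF iW ea(1)])
      fix x show "indicator {x. \<bar>x\<bar> \<le> real N} x * W (f x) \<le> ea x"
      proof (cases "\<bar>x\<bar> \<le> real N")
        case True
        then have "\<bar>x\<bar> \<le> real k" using k(1) by auto
        then show ?thesis using in_val(1)[of x] We[of x] True by simp
      qed (simp add: enn)
    qed measurable
    have 4: "(LINT x|lborel. indicator {x. 2 * real N \<le> \<bar>x\<bar>} x * W (f x)) \<le> energy W b"
      unfolding eb(2)
    proof (rule integral_mono[OF iW eb(1)])
      fix x show "indicator {x. 2 * real N \<le> \<bar>x\<bar>} x * W (f x) \<le> eb x"
      proof (cases "2 * real N \<le> \<bar>x\<bar>")
        case True
        have "real k + 1 \<le> 2 * real N" using k(1) by (simp add: less_eq_Suc_le[symmetric] flip: of_nat_Suc of_nat_mult) 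
        then have "real k + 1 \<le> \<bar>x\<bar>" using True by linarith
        then show ?thesis using out_val(1)[of x] We[of x] True by simp
      qed (simp add: enn)
    qed measurable
    show ?thesis using 1 2 3 4 rep_X[OF ra] rep_X[OF rb] by blast
  qed
  moreover have "0 \<le> c" using c0(1) by (simp add: c_def)
  ultimately show ?thesis by blast
qed

end

section \<open>Coercivity and tightness\<close>

text \<open>\<open>\<kappa>\<close> is the quotient \<open>E / |C|\<close> in the limit. Adding
  \<open>a\<close> and \<open>b\<close> gives \<open>\<kappa> * (Ca + Cb) + \<delta> * ((e0 - Ea) *
  Ca + (e0 - Eb) * Cb) \<le> Ea + Eb\<close>. Up to errors of order \<open>r\<close> the first term
  is at least \<open>\<kappa> * P = e0\<close>, the right side is at most \<open>e0\<close>, and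
  \<open>e0 - Ea \<ge> Eb\<close>, \<open>e0 - Eb \<ge> Ea\<close>. Only the cross terms remain, and
  they must be of order \<open>r\<close>.\<close>

lemma split_numeric:
  fixes Ea Eb Ca Cb :: real
  assumes nn: "0 \<le> Ea" "0 \<le> Eb" "0 \<le> Ca" "0 \<le> Cb" "0 \<le> \<kappa>" "0 < \<delta>" "0 \<le> r"
    and a: "(\<kappa> + \<delta> * e0 - \<delta> * Ea) * Ca \<le> Ea" and b: "(\<kappa> + \<delta> * e0 - \<delta> * Eb) * Cb \<le> Eb"
    and E: "Ea + Eb \<le> E + r" "\<bar>E - e0\<bar> \<le> r" and C: "C \<le> Ca + Cb + r" "P - r \<le> C"
    and Q: "Ca \<le> Q" "Cb \<le> Q" and e0: "e0 = \<kappa> * P"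
  shows "\<delta> * (Eb * Ca + Ea * Cb) \<le> (2 + 2 * \<kappa> + 4 * \<delta> * Q) * r"
proof -
  have "Eb - 2 * r \<le> e0 - Ea" "Ea - 2 * r \<le> e0 - Eb" using E by linarith+
  then have 1: "(Eb - 2 * r) * Ca \<le> (e0 - Ea) * Ca" "(Ea - 2 * r) * Cb \<le> (e0 - Eb) * Cb"
    using nn by (auto intro: mult_right_mono)
  have 2: "r * Ca \<le> r * Q" "r * Cb \<le> r * Q" using nn Q by (auto intro: mult_left_mono)
  have "\<kappa> * (P - 2 * r) \<le> \<kappa> * (Ca + Cb)" using nn C by (intro mult_left_mono) linarith+
  then have 3: "e0 - 2 * (\<kappa> * r) \<le> \<kappa> * Ca + \<kappa> * Cb" using e0 by (simp add: algebra_simps)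
  have "\<delta> * ((Eb * Ca + Ea * Cb) - 4 * (r * Q)) \<le> \<delta> * ((e0 - Ea) * Ca + (e0 - Eb) * Cb)"
    using 1 2 nn by (intro mult_left_mono) (auto simp: algebra_simps)
  moreover have "\<kappa> * Ca + \<kappa> * Cb + \<delta> * ((e0 - Ea) * Ca + (e0 - Eb) * Cb) \<le> Ea + Eb"
    using a b by (simp add: algebra_simps)
  ultimately have "\<delta> * ((Eb * Ca + Ea * Cb) - 4 * (r * Q)) \<le> 2 * r + 2 * (\<kappa> * r)"
    using 3 E by linarith
  then show ?thesis by (simp add: algebra_simps)
qed

text \<open>Both cross terms are small. As \<open>Ea\<close> is bounded below, \<open>Cb\<close> is
  small; so \<open>Ca\<close> carries at least half of \<open>P\<close>, and this forces
  \<open>Eb\<close> to be small.\<close>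

lemma split_numeric_small:
  fixes Ea Eb Ca Cb :: real
  assumes nn: "0 \<le> Ea" "0 \<le> Eb" "0 \<le> Ca" "0 \<le> Cb" "0 < \<delta>" "0 < c" "0 < P" "0 \<le> D" "0 \<le> r"
    and D: "\<delta> * (Eb * Ca + Ea * Cb) \<le> D * r" and Ea: "c \<le> Ea" and C: "P - 2 * r \<le> Ca + Cb"
    and r: "2 * r + D * r / (\<delta> * c) \<le> P / 2"
  shows "Eb \<le> 2 * D * r / (\<delta> * P)"
proof -
  have nn2: "0 \<le> \<delta> * (Eb * Ca)" "0 \<le> \<delta> * (Ea * Cb)" using nn by auto
  have D': "\<delta> * (Eb * Ca) + \<delta> * (Ea * Cb) \<le> D * r" using D by (simp add: distrib_left)
  have "\<delta> * (Ea * Cb) \<le> D * r" using D' nn2 by linarith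
  moreover have "\<delta> * (c * Cb) \<le> \<delta> * (Ea * Cb)" using nn Ea by (intro mult_left_mono mult_right_mono) auto
  ultimately have "Cb \<le> D * r / (\<delta> * c)" using nn by (simp add: field_simps)
  then have Ca: "P / 2 \<le> Ca" using C r by linarith
  have "\<delta> * (Eb * Ca) \<le> D * r" using D' nn2 by linarith
  moreover have "\<delta> * (Eb * (P / 2)) \<le> \<delta> * (Eb * Ca)" using nn Ca by (intro mult_left_mono) auto
  ultimately have "\<delta> * (Eb * (P / 2)) \<le> D * r" by linarith
  then show ?thesis using nn by (simp add: field_simps)
qed

section \<open>Bounds obtained from the energy, and tightness\<close>

context potential begin

text \<open>The set where \<open>\<bar>f\<bar> \<ge> 1\<close> has measure at most
  \<open>M / \<eta>\<close>, so on both sides of \<open>x0\<close>, within bounded distance, there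
  are points with \<open>\<bar>f\<bar> < 1\<close>. Between them the mean value theorem gives a
  point of slope at most \<open>2\<close>; the bound on \<open>f2\<close> controls the slope from
  there on, and a second use of the mean value theorem bounds \<open>f x0\<close>.\<close>

lemma energy_sup_bound:
  "\<exists>S. \<forall>p f f1 f2. rep p f f1 f2 \<longrightarrow> nice f f1 f2 \<longrightarrow> energy W p \<le> M \<longrightarrow> (\<forall>x. \<bar>f x\<bar> \<le> S)"
proof -
  \<comment> \<open>The maximum with \<open>0\<close> admits negative \<open>M\<close>. An interval
    of length \<open>L + 1\<close> on which \<open>\<bar>f\<bar> \<ge> 1\<close> would cost more
    than \<open>max M 0\<close>.\<close>
  define L where "L = max M 0 / \<eta>"
  have L: "0 \<le> L" "\<eta> * L = max M 0" using eta_pos by (auto simp: L_def)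
  \<comment> \<open>\<open>2\<close> bounds the slope at the mean value point; the product is the
    Hoelder estimate for \<open>f1\<close> over a distance of at most
    \<open>2 * L + 3\<close>.\<close>
  define D where "D = 2 + sqrt (2 * L + 3) * sqrt (2 * max M 0)"
  have "\<bar>f x0\<bar> \<le> 1 + (L + 1) * D" if r: "rep p f f1 f2" and n: "nice f f1 f2" and M: "energy W p \<le> M" for p f f1 f2 x0
  proof -
    have WM: "(LINT x|lborel. W (f x)) \<le> max M 0" "(nrm f2)\<^sup>2 \<le> 2 * max M 0"
      using M energy_rep[OF r] integral_W_nonneg[of f] zero_le_power2[of "nrm (snd p)"] zero_le_power2[of "nrm f2"]
      unfolding distrib_left by linarith+
    have f2: "nrm f2 \<le> sqrt (2 * max M 0)" using real_le_rsqrt[OF WM(2)] .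
    have pt: "\<exists>y\<in>{c..c + (L + 1)}. \<bar>f y\<bar> < 1" for c
    proof (rule ccontr)
      assume "\<not> ?thesis"
      then have ge: "1 \<le> \<bar>f y\<bar>" if "y \<in> {c..c + (L + 1)}" for y using that by force
      have "(LINT x|lborel. indicator {c..c + (L + 1)} x * \<eta>) \<le> (LINT x|lborel. W (f x))"
      proof (rule integral_mono[OF _ W_integrable_nice[OF n]])
        fix x show "indicator {c..c + (L + 1)} x * \<eta> \<le> W (f x)"
          using ge[of x] W_large[of "f x"] W_nonneg[of "f x"] by (cases "x \<in> {c..c + (L + 1)}") auto
      qed (intro integrable_mult_left integrable_real_indicator; simp add: emeasure_lborel_Icc_eq)
      then have "(L + 1) * \<eta> \<le> max M 0" using WM(1) L(1) by simp
      then show False using L(2) eta_pos by (simp add: algebra_simps)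
    qed
    obtain a where a: "a \<in> {x0 - (L + 1)..x0}" "\<bar>f a\<bar> < 1" using pt[of "x0 - (L + 1)"] by auto
    \<comment> \<open>Starting one unit to the right of \<open>x0\<close> ensures
      \<open>b - a \<ge> 1\<close>, which is why the mean slope is at most \<open>2\<close>.\<close>
    obtain b where b: "b \<in> {x0 + 1..x0 + 1 + (L + 1)}" "\<bar>f b\<bar> < 1" using pt[of "x0 + 1"] by auto
    have ab: "a < b" "1 \<le> b - a" "b - a \<le> 2 * L + 3" using a b by auto
    obtain z where z: "a < z" "z < b" "f b - f a = (b - a) * f1 z"
      using MVT2[OF ab(1), of f f1] nice_DERIV[OF n] by blast
    have "\<bar>f1 z\<bar> \<le> (b - a) * \<bar>f1 z\<bar>" using ab by (simp add: mult_le_cancel_right1)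
    also have "\<dots> = \<bar>f b - f a\<bar>" unfolding z(3) abs_mult using ab by simp
    also have "\<dots> \<le> 2" using a b by linarith
    finally have z2: "\<bar>f1 z\<bar> \<le> 2" .
    have f1D: "\<bar>f1 y\<bar> \<le> D" if "a \<le> y" "y \<le> b" for y
    proof -
      have "\<bar>y - z\<bar> \<le> 2 * L + 3" using that z ab by linarith
      then have "sqrt \<bar>y - z\<bar> * nrm f2 \<le> sqrt (2 * L + 3) * sqrt (2 * max M 0)"
        by (intro mult_mono f2 nrm_nonneg) (use L in auto)
      then show ?thesis using ac_Holder[OF niceD(5,3)[OF n], of y z] z2 unfolding D_def by linarith
    qed
    have D0: "0 \<le> D" using f1D[of a] ab by linarith
    have "\<bar>f x0 - f a\<bar> \<le> (L + 1) * D"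
    proof (cases "a < x0")
      case True
      then obtain y where y: "a < y" "y < x0" "f x0 - f a = (x0 - a) * f1 y"
        using MVT2[OF True, of f f1] nice_DERIV[OF n] by blast
      have "\<bar>f x0 - f a\<bar> = (x0 - a) * \<bar>f1 y\<bar>" unfolding y(3) abs_mult using True by simp
      also have "\<dots> \<le> (L + 1) * D" using f1D[of y] y a b True L by (intro mult_mono) auto
      finally show ?thesis .
    next
      case False
      then have "x0 = a" using a by auto
      then show ?thesis using L D0 by simp
    qed
    then show ?thesis using a by linarith
  qed
  then show ?thesis by blast
qed

text \<open>Once the amplitude is bounded, \<open>W\<close> dominates a multiple of
  \<open>s^2\<close> on the range of \<open>f\<close>, and the potential energy controls the L2
  norm.\<close>

lemma energy_coercive: "\<exists>S. \<forall>p\<in>X. energy W p \<le> M \<longrightarrow> Xnorm p \<le> S"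
proof -
  obtain S where S: "\<And>p f f1 f2 x. rep p f f1 f2 \<Longrightarrow> nice f f1 f2 \<Longrightarrow> energy W p \<le> M \<Longrightarrow> \<bar>f x\<bar> \<le> S"
    using energy_sup_bound by blast
  obtain c where c: "0 < c" "\<And>s. \<bar>s\<bar> \<le> S \<Longrightarrow> c * s\<^sup>2 \<le> W s" using W_quadratic_lower by blast
  have "Xnorm p \<le> sqrt (2 * M + M / c)" if pX: "p \<in> X" and pM: "energy W p \<le> M" for p
  proof -
    obtain f f1 f2 where f: "rep p f f1 f2" "nice f f1 f2" using X_rep[OF pX] by metis
    have "(LINT x|lborel. c * (f x)\<^sup>2) \<le> (LINT x|lborel. W (f x))"
      by (rule integral_mono) (use L2_sq[OF niceD(1)[OF f(2)]] W_integrable_nice[OF f(2)] c(2)[OF S[OF f pM]] in auto)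
    then have "c * (nrm f)\<^sup>2 \<le> (LINT x|lborel. W (f x))" by (simp add: nrm_sq)
    moreover have "(nrm (snd p))\<^sup>2 + (nrm f2)\<^sup>2 + 2 * (LINT x|lborel. W (f x)) \<le> 2 * M"
      using pM unfolding energy_rep[OF f(1)] by (simp add: field_simps)
    ultimately have "c * (nrm f)\<^sup>2 \<le> M" "(nrm (snd p))\<^sup>2 + (nrm f2)\<^sup>2 \<le> 2 * M"
      using integral_W_nonneg[of f] zero_le_power2[of "nrm (snd p)"] zero_le_power2[of "nrm f2"] by linarith+
    moreover then have "(nrm f)\<^sup>2 \<le> M / c" using c(1) by (simp add: field_simps)
    ultimately show ?thesis unfolding Xnorm_rep[OF f(1)] by (intro real_sqrt_le_mono) linarith
  qed
  then show ?thesis by blast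
qed

text \<open>Young's inequality, used for the momentum and for the interpolated first derivative,
  bounds \<open>|C|\<close> by half the sum of the squared norms of \<open>v\<close>,
  \<open>f2\<close> and \<open>f\<close>. In the energy these squares have weights
  \<open>1/2\<close>, \<open>1/2\<close> and \<open>\<eta>\<close>; this is the origin of the
  threshold \<open>min 1 (2 * \<eta>)\<close>.\<close>

lemma small_amplitude_energy:
  assumes "rep p f f1 f2" "nice f f1 f2" "\<And>x. \<bar>f x\<bar> \<le> 1"
  shows "min 1 (2 * \<eta>) * \<bar>momentum p\<bar> \<le> energy W p"
proof -
  define m where "m = min 1 (2 * \<eta>)"
  have m: "0 \<le> m" "m \<le> 1" "m \<le> 2 * \<eta>" using eta_pos by (auto simp: m_def)
  have amgm: "x * y \<le> (x\<^sup>2 + y\<^sup>2) / 2" for x y :: real using sum_squares_bound[of x y] by simp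
  have "(nrm f1)\<^sup>2 \<le> ((nrm f)\<^sup>2 + (nrm f2)\<^sup>2) / 2"
    using sobolev2_interpolation[OF nice_sobolev2[OF assms(2)]] amgm[of "nrm f" "nrm f2"] by linarith
  moreover have "\<bar>momentum p\<bar> \<le> ((nrm (snd p))\<^sup>2 + (nrm f1)\<^sup>2) / 2"
    using L2_Cauchy_Schwarz[OF repD(2)[OF assms(1)] niceD(2)[OF assms(2)]] amgm[of "nrm (snd p)" "nrm f1"]
    unfolding momentum_rep[OF assms(1)] by simp
  ultimately have "\<bar>momentum p\<bar> \<le> (nrm (snd p))\<^sup>2 / 2 + (nrm f2)\<^sup>2 / 2 + (nrm f)\<^sup>2 / 2"
    using zero_le_power2[of "nrm f2"] zero_le_power2[of "nrm f"] unfolding add_divide_distrib by linarith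
  then have "m * \<bar>momentum p\<bar> \<le> m * ((nrm (snd p))\<^sup>2 / 2 + (nrm f2)\<^sup>2 / 2 + (nrm f)\<^sup>2 / 2)"
    using m by (intro mult_left_mono) auto
  also have "\<dots> \<le> (nrm (snd p))\<^sup>2 / 2 + (nrm f2)\<^sup>2 / 2 + \<eta> * (nrm f)\<^sup>2"
  proof -
    have "m * ((nrm (snd p))\<^sup>2 / 2) \<le> 1 * ((nrm (snd p))\<^sup>2 / 2)" "m * ((nrm f2)\<^sup>2 / 2) \<le> 1 * ((nrm f2)\<^sup>2 / 2)"
      "m * ((nrm f)\<^sup>2 / 2) \<le> (2 * \<eta>) * ((nrm f)\<^sup>2 / 2)"
      using m by (intro mult_right_mono; simp)+
    then show ?thesis unfolding distrib_left by simp
  qed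
  also have "\<eta> * (nrm f)\<^sup>2 \<le> (LINT x|lborel. W (f x))"
  proof -
    have "(LINT x|lborel. \<eta> * (f x)\<^sup>2) \<le> (LINT x|lborel. W (f x))"
      by (rule integral_mono) (use L2_sq[OF niceD(1)[OF assms(2)]] W_integrable_nice[OF assms(2)] W_small[OF assms(3)] in auto)
    then show ?thesis by (simp add: nrm_sq)
  qed
  finally show ?thesis unfolding energy_rep[OF assms(1)] m_def by (simp add: field_simps)
qed

text \<open>Hoelder continuity keeps \<open>\<bar>f\<bar> \<ge> 1/2\<close> on
  \<open>{-h..h}\<close>, where \<open>W\<close> is at least \<open>\<eta> / 4\<close>. In a
  splitting this guarantees the central piece a fixed amount of energy.\<close>

lemma central_energy:
  "\<exists>c>0. \<forall>p f f1 f2 N. rep p f f1 f2 \<longrightarrow> nice f f1 f2 \<longrightarrow> Xnorm p \<le> S \<longrightarrow> 1 < \<bar>f 0\<bar> \<longrightarrow> 1 \<le> N \<longrightarrow>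
     c \<le> (LINT x|lborel. indicator {x. \<bar>x\<bar> \<le> N} x * W (f x))"
proof -
  \<comment> \<open>Chosen so that \<open>sqrt h * (\<bar>S\<bar> + 1) = 1/2\<close>; the summand
    \<open>1\<close> avoids division by zero and gives \<open>h \<le> 1\<close>.\<close>
  define h where "h = 1 / (4 * (\<bar>S\<bar> + 1)\<^sup>2)"
  have S1: "1 \<le> (\<bar>S\<bar> + 1)\<^sup>2" using one_le_power[of "\<bar>S\<bar> + 1" 2] by simp
  have "1 \<le> 4 * (\<bar>S\<bar> + 1)\<^sup>2" using S1 by linarith
  then have h: "0 < h" "h \<le> 1" by (simp_all add: h_def)
  have sh: "sqrt h * (\<bar>S\<bar> + 1) = 1 / 2"
  proof -
    have "sqrt h = 1 / (2 * (\<bar>S\<bar> + 1))" by (simp add: h_def real_sqrt_divide real_sqrt_mult)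
    then show ?thesis by simp
  qed
  have "2 * h * (\<eta> / 4) \<le> (LINT x|lborel. indicator {x. \<bar>x\<bar> \<le> N} x * W (f x))"
    if r: "rep p f f1 f2" and n: "nice f f1 f2" and S: "Xnorm p \<le> S" and f0: "1 < \<bar>f 0\<bar>" and N: "1 \<le> N" for p f f1 f2 N
  proof -
    have W4: "\<eta> / 4 \<le> W (f x)" if "\<bar>x\<bar> \<le> h" for x
    proof -
      have "\<bar>f x - f 0\<bar> \<le> sqrt \<bar>x\<bar> * nrm f1" using ac_Holder[OF niceD(4,2)[OF n], of x 0] by simp
      also have "\<dots> \<le> sqrt h * (\<bar>S\<bar> + 1)"
        using that Xnorm_bounds(4)[OF r] S h(1) by (intro mult_mono nrm_nonneg) auto
      finally have fx: "1 / 2 \<le> \<bar>f x\<bar>" using sh f0 by linarith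
      show ?thesis
      proof (cases "\<bar>f x\<bar> \<le> 1")
        case True
        have "(1/2)\<^sup>2 \<le> (f x)\<^sup>2" using fx abs_le_square_iff[of "1/2" "f x"] by simp
        then have "\<eta> * (1/2)\<^sup>2 \<le> \<eta> * (f x)\<^sup>2" using eta_pos by (intro mult_left_mono) auto
        then show ?thesis using W_small[OF True] by (simp add: power2_eq_square)
      next
        case False
        then show ?thesis using W_large[of "f x"] eta_pos by simp
      qed
    qed
    have "(LINT x|lborel. indicator {-h..h} x * (\<eta> / 4)) \<le> (LINT x|lborel. indicator {x. \<bar>x\<bar> \<le> N} x * W (f x))"
    proof (rule integral_mono)
      show "integrable lborel (\<lambda>x. indicator {x. \<bar>x\<bar> \<le> N} x * W (f x))"
        using integrable_mult_indicator[OF _ W_integrable_nice[OF n], of "{x. \<bar>x\<bar> \<le> N}"] by simp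
      fix x show "indicator {-h..h} x * (\<eta> / 4) \<le> indicator {x. \<bar>x\<bar> \<le> N} x * W (f x)"
      proof (cases "\<bar>x\<bar> \<le> h")
        case True
        then have "\<bar>x\<bar> \<le> N" using h N by linarith
        then show ?thesis using W4[OF True] True by (simp add: indicator_def abs_le_iff)
      next
        case False
        then have "x \<notin> {-h..h}" by auto
        then show ?thesis using W_nonneg[of "f x"] by simp
      qed
    qed (intro integrable_mult_left integrable_real_indicator; simp add: emeasure_lborel_Icc_eq)
    then show ?thesis using h by simp
  qed
  then show ?thesis using h eta_pos by (intro exI[of _ "2 * h * (\<eta> / 4)"]) auto
qed

text \<open>Splitting off the tail would cost energy: the two pieces satisfy the lower bound separately, and
  the penalty \<open>\<delta> * E\<close> makes the sum of their bounds strictly larger than \<open>e0\<close> unless the tail is negligible.\<close>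
lemma tightness:
  assumes p: "\<And>n. rep (p n) (f n) (f1 n) (f2 n)" "\<And>n. nice (f n) (f1 n) (f2 n)" "\<And>n. Xnorm (p n) \<le> S"
    and E: "(\<lambda>n. energy W (p n)) \<longlonglongrightarrow> e0" and C: "(\<lambda>n. momentum (p n)) \<longlonglongrightarrow> p0" and p0: "p0 \<noteq> 0"
    and \<delta>: "0 < \<delta>" and j: "\<And>q. q \<in> X \<Longrightarrow> (j - \<delta> * energy W q) * \<bar>momentum q\<bar> \<le> energy W q"
    and e0: "e0 = (j - \<delta> * e0) * \<bar>p0\<bar>" and f0: "\<forall>\<^sub>F n in sequentially. 1 < \<bar>f n 0\<bar>" and \<epsilon>: "0 < \<epsilon>"
  shows "\<exists>N::nat. \<forall>\<^sub>F n in sequentially. (LINT x|lborel. indicator {x. 2 * real N \<le> \<bar>x\<bar>} x * W (f n x)) \<le> \<epsilon>"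
proof -
  obtain c where c: "0 \<le> c" "\<And>p f f1 f2 N. rep p f f1 f2 \<Longrightarrow> nice f f1 f2 \<Longrightarrow> Xnorm p \<le> S \<Longrightarrow> 0 < N \<Longrightarrow>
    (\<exists>a\<in>X. \<exists>b\<in>X. energy W a + energy W b \<le> energy W p + c / real N \<and>
      \<bar>momentum p - momentum a - momentum b\<bar> \<le> c / real N \<and>
      (LINT x|lborel. indicator {x. \<bar>x\<bar> \<le> real N} x * W (f x)) \<le> energy W a \<and>
      (LINT x|lborel. indicator {x. 2 * real N \<le> \<bar>x\<bar>} x * W (f x)) \<le> energy W b)"
    using energy_splitting[of S] by blast
  obtain c1 where c1: "0 < c1" "\<And>p f f1 f2 N. rep p f f1 f2 \<Longrightarrow> nice f f1 f2 \<Longrightarrow> Xnorm p \<le> S \<Longrightarrow> 1 < \<bar>f 0\<bar> \<Longrightarrow> 1 \<le> N \<Longrightarrow>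
     c1 \<le> (LINT x|lborel. indicator {x. \<bar>x\<bar> \<le> N} x * W (f x))"
    using central_energy[of S] by blast
  obtain T where T: "\<And>q. q \<in> X \<Longrightarrow> energy W q \<le> \<bar>e0\<bar> + 2 \<Longrightarrow> Xnorm q \<le> T" using energy_coercive by blast
  define Q where "Q = T\<^sup>2"
  define \<kappa> where "\<kappa> = j - \<delta> * e0"
  define P where "P = \<bar>p0\<bar>"
  have P: "0 < P" using p0 by (simp add: P_def)
  have e0_nonneg: "0 \<le> e0"
    by (rule LIMSEQ_le_const[OF E]) (use energy_nonneg rep_X[OF p(1)] in auto)
  have \<kappa>: "e0 = \<kappa> * P" "0 \<le> \<kappa>"
  proof -
    show "e0 = \<kappa> * P" using e0 by (simp add: \<kappa>_def P_def)
    then show "0 \<le> \<kappa>" using e0_nonneg P by (metis mult_neg_pos not_le)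
  qed
  define D where "D = 2 + 2 * \<kappa> + 4 * \<delta> * Q"
  have D: "0 < D" unfolding D_def Q_def using \<kappa>(2) \<delta> by (intro add_pos_nonneg) auto
  \<comment> \<open>\<open>r \<le> 1\<close> keeps the energies of both pieces below
    \<open>\<bar>e0\<bar> + 2\<close>, where the norm bound \<open>T\<close> holds. The second bound
    is the smallness condition of \<open>split_numeric_small\<close>, and the third turns its
    conclusion into \<open>\<le> \<epsilon>\<close>.\<close>
  define r where "r = min 1 (min (P / 2 / (2 + D / (\<delta> * c1))) (\<epsilon> * (\<delta> * P) / (2 * D)))"
  have den: "0 < 2 + D / (\<delta> * c1)" using D \<delta> c1 by (intro add_pos_pos) auto
  have r: "0 < r" "r \<le> 1" "2 * r + D * r / (\<delta> * c1) \<le> P / 2" "2 * D * r / (\<delta> * P) \<le> \<epsilon>"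
  proof -
    show "0 < r" "r \<le> 1" using P den D \<delta> \<epsilon> by (auto simp: r_def)
    have "r \<le> P / 2 / (2 + D / (\<delta> * c1))" unfolding r_def by linarith
    then have "r * (2 + D / (\<delta> * c1)) \<le> P / 2" unfolding pos_le_divide_eq[OF den] .
    then show "2 * r + D * r / (\<delta> * c1) \<le> P / 2" by (simp add: algebra_simps)
    have "r \<le> \<epsilon> * (\<delta> * P) / (2 * D)" by (simp add: r_def)
    then show "2 * D * r / (\<delta> * P) \<le> \<epsilon>" using D \<delta> P by (simp add: field_simps)
  qed
  \<comment> \<open>A window this wide makes the splitting defect \<open>c / N\<close> at most
    \<open>r\<close>.\<close>
  obtain N :: nat where "c / r < real N" using reals_Archimedean2 by blast
  moreover have "0 \<le> c / r" using c(1) r(1) by simp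
  ultimately have N: "0 < N" "c / real N \<le> r"
  proof -
    assume *: "c / r < real N" "0 \<le> c / r"
    then have "0 < real N" by linarith
    then show "0 < N" by simp
    have "c < real N * r" using * r(1) by (simp add: pos_divide_less_eq)
    then show "c / real N \<le> r" using \<open>0 < real N\<close> by (simp add: field_simps)
  qed
  have "\<forall>\<^sub>F n in sequentially. \<bar>energy W (p n) - e0\<bar> < r"
    using tendstoD[OF E r(1)] by (simp add: dist_real_def)
  moreover have "\<forall>\<^sub>F n in sequentially. \<bar>momentum (p n) - p0\<bar> < r"
    using tendstoD[OF C r(1)] by (simp add: dist_real_def)
  ultimately have "\<forall>\<^sub>F n in sequentially. (LINT x|lborel. indicator {x. 2 * real N \<le> \<bar>x\<bar>} x * W (f n x)) \<le> \<epsilon>"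
    using f0
  proof eventually_elim
    case (elim n)
    obtain a b where ab: "a \<in> X" "b \<in> X" "energy W a + energy W b \<le> energy W (p n) + c / real N"
      "\<bar>momentum (p n) - momentum a - momentum b\<bar> \<le> c / real N"
      "(LINT x|lborel. indicator {x. \<bar>x\<bar> \<le> real N} x * W (f n x)) \<le> energy W a"
      "(LINT x|lborel. indicator {x. 2 * real N \<le> \<bar>x\<bar>} x * W (f n x)) \<le> energy W b"
      using c(2)[OF p(1)[of n] p(2)[of n] p(3)[of n] N(1)] by blast
    have nn: "0 \<le> energy W a" "0 \<le> energy W b" using energy_nonneg ab by auto
    have Eab: "energy W a + energy W b \<le> energy W (p n) + r" using ab(3) N(2) by linarith
    have le: "energy W a \<le> \<bar>e0\<bar> + 2" "energy W b \<le> \<bar>e0\<bar> + 2"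
      using Eab nn elim(1) r(2) by linarith+
    have Qb: "\<bar>momentum q\<bar> \<le> Q" if "q \<in> X" "energy W q \<le> \<bar>e0\<bar> + 2" for q
    proof -
      have "(Xnorm q)\<^sup>2 \<le> T\<^sup>2" using T[OF that] Xnorm_nonneg by (intro power_mono) auto
      then show ?thesis using momentum_bound[OF that(1)] by (simp add: Q_def)
    qed
    have Cab: "\<bar>momentum (p n)\<bar> \<le> \<bar>momentum a\<bar> + \<bar>momentum b\<bar> + r" "P - r \<le> \<bar>momentum (p n)\<bar>"
      using ab(4) N(2) elim(2) unfolding P_def by linarith+
    have cost: "\<delta> * (energy W b * \<bar>momentum a\<bar> + energy W a * \<bar>momentum b\<bar>) \<le> (2 + 2 * \<kappa> + 4 * \<delta> * Q) * r"
    proof (rule split_numeric[OF nn abs_ge_zero abs_ge_zero \<kappa>(2) \<delta> less_imp_le[OF r(1)] _ _ Eab _ Cab Qb[OF ab(1) le(1)] Qb[OF ab(2) le(2)] \<kappa>(1)])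
      show "(\<kappa> + \<delta> * e0 - \<delta> * energy W a) * \<bar>momentum a\<bar> \<le> energy W a"
        "(\<kappa> + \<delta> * e0 - \<delta> * energy W b) * \<bar>momentum b\<bar> \<le> energy W b"
        using j[OF ab(1)] j[OF ab(2)] by (simp_all add: \<kappa>_def)
      show "\<bar>energy W (p n) - e0\<bar> \<le> r" using elim(1) by linarith
    qed
    have "energy W b \<le> 2 * D * r / (\<delta> * P)"
    proof (rule split_numeric_small[OF nn abs_ge_zero abs_ge_zero \<delta> c1(1) P less_imp_le[OF D] less_imp_le[OF r(1)] _ _ _ r(3)])
      show "\<delta> * (energy W b * \<bar>momentum a\<bar> + energy W a * \<bar>momentum b\<bar>) \<le> D * r" using cost by (simp add: D_def)
      show "c1 \<le> energy W a" using c1(2)[OF p(1)[of n] p(2)[of n] p(3)[of n] elim(3), of "real N"] ab(5) N(1) by simp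
      show "P - 2 * r \<le> \<bar>momentum a\<bar> + \<bar>momentum b\<bar>" using Cab by linarith
    qed
    then show ?case using ab(6) r(4) by linarith
  qed
  then show ?thesis by blast
qed

end

section \<open>Compactness modulo translations\<close>

lemma nrm_diff_le: assumes "L2 a" "L2 b" shows "nrm (\<lambda>x. a x - b x) \<le> nrm a + nrm b"
proof -
  have "L2 (\<lambda>x. - b x)" using L2_cmult[OF assms(2), of "-1"] by simp
  from nrm_triangle[OF assms(1) this] show ?thesis by (simp add: nrm_def)
qed

lemma nrm_cmult: "nrm (\<lambda>x. c * f x) = \<bar>c\<bar> * nrm f"
  by (simp add: nrm_def power_mult_distrib real_sqrt_mult)

lemma nrm_midpoint:
  assumes "L2 a" "L2 b"
  shows "(nrm (\<lambda>x. 1/2 * a x + 1/2 * b x))\<^sup>2 = 1/2 * (nrm a)\<^sup>2 + 1/2 * (nrm b)\<^sup>2 - 1/4 * (nrm (\<lambda>x. a x - b x))\<^sup>2"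
proof -
  define X Y Z where "X = (LINT x|lborel. (a x)\<^sup>2)" and "Y = (LINT x|lborel. a x * b x)" and "Z = (LINT x|lborel. (b x)\<^sup>2)"
  have 1: "(LINT x|lborel. (1/2 * a x + 1/2 * b x)\<^sup>2) = (1/2)\<^sup>2 * X + 2 * (1/2) * (1/2) * Y + (1/2)\<^sup>2 * Z"
    unfolding X_def Y_def Z_def by (rule integral_lin_sq[OF assms])
  have 2: "(LINT x|lborel. (a x - b x)\<^sup>2) = X - 2 * Y + Z"
    unfolding X_def Y_def Z_def using integral_lin_sq[OF assms, of 1 "-1"] by simp
  show ?thesis
    unfolding nrm_sq 1 2 X_def[symmetric] Z_def[symmetric] by (simp add: power2_eq_square field_simps)
qed

text \<open>Arzela-Ascoli with pointwise convergence: a diagonal subsequence converges at the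
  rationals, and the common Hoelder modulus extends this to every point.\<close>

lemma Holder_subsequence:
  fixes g :: "nat \<Rightarrow> real \<Rightarrow> real"
  assumes b: "\<And>n x. \<bar>g n x\<bar> \<le> M" and H: "\<And>n x y. \<bar>g n x - g n y\<bar> \<le> sqrt \<bar>x - y\<bar> * L"
  shows "\<exists>r G. strict_mono (r :: nat \<Rightarrow> nat) \<and> (\<forall>x. (\<lambda>n. g (r n) x) \<longlonglongrightarrow> G x)"
proof -
  obtain r where r: "strict_mono (r::nat \<Rightarrow> nat)" "\<And>x. x \<in> \<rat> \<Longrightarrow> \<exists>l. (\<lambda>n. g (r n) x) \<longlonglongrightarrow> l"
    using function_convergent_subsequence[of "\<rat> :: real set" g M] b countable_rat by auto
  have "convergent (\<lambda>n. g (r n) x)" for x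
  proof (rule Cauchy_convergent, rule metric_CauchyI)
    fix e :: real assume e: "0 < e"
    define h where "h = (e / (3 * (\<bar>L\<bar> + 1)))\<^sup>2"
    have h: "0 < h" using e by (simp add: h_def)
    obtain y where y: "y \<in> \<rat>" "x < y" "y < x + h" using Rats_dense_in_real[of x "x + h"] h by auto
    have "sqrt \<bar>x - y\<bar> * L \<le> e / 3"
    proof -
      have "sqrt \<bar>x - y\<bar> \<le> sqrt h" using y by simp
      also have "sqrt h = e / (3 * (\<bar>L\<bar> + 1))" using e by (simp add: h_def)
      finally have "sqrt \<bar>x - y\<bar> * (\<bar>L\<bar> + 1) \<le> e / (3 * (\<bar>L\<bar> + 1)) * (\<bar>L\<bar> + 1)" by (rule mult_right_mono) simp
      also have "\<dots> = e / 3" by (simp add: field_simps)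
      finally have "sqrt \<bar>x - y\<bar> * (\<bar>L\<bar> + 1) \<le> e / 3" .
      moreover have "sqrt \<bar>x - y\<bar> * L \<le> sqrt \<bar>x - y\<bar> * (\<bar>L\<bar> + 1)" by (intro mult_left_mono) auto
      ultimately show ?thesis by linarith
    qed
    then have near: "\<bar>g n x - g n y\<bar> \<le> e / 3" for n using H[of n x y] by linarith
    have "Cauchy (\<lambda>n. g (r n) y)" using r(2)[OF y(1)] LIMSEQ_imp_Cauchy by blast
    then obtain N where N: "\<And>m n. N \<le> m \<Longrightarrow> N \<le> n \<Longrightarrow> dist (g (r m) y) (g (r n) y) < e / 3"
      using metric_CauchyD[of _ "e / 3"] e by (metis zero_less_divide_iff zero_less_numeral)
    have "dist (g (r m) x) (g (r n) x) < e" if "N \<le> m" "N \<le> n" for m n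
      using N[OF that] near[of "r m"] near[of "r n"] unfolding dist_real_def by linarith
    then show "\<exists>N. \<forall>m\<ge>N. \<forall>n\<ge>N. dist (g (r m) x) (g (r n) x) < e" by blast
  qed
  then show ?thesis using r(1) by (intro exI[of _ r] exI[of _ "\<lambda>x. lim (\<lambda>n. g (r n) x)"]) (simp add: convergent_LIMSEQ_iff)
qed

context potential begin

text \<open>Outside a window the L2 mass is small by tightness, because \<open>W\<close> dominates a
  multiple of the square at bounded amplitude. Inside the window pointwise convergence is dominated
  by a constant. The pointwise limit \<open>G\<close> is only a reference for comparing two members;
  the L2 limit comes from completeness.\<close>

lemma tight_subsequence_L2_Cauchy:
  assumes p: "\<And>n. rep (p n) (g n) (g1 n) (g2 n)" "\<And>n. nice (g n) (g1 n) (g2 n)" "\<And>n. Xnorm (p n) \<le> S"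
    and tight: "\<And>\<epsilon>. 0 < \<epsilon> \<Longrightarrow> \<exists>N::nat. \<forall>\<^sub>F n in sequentially. (LINT x|lborel. indicator {x. 2 * real N \<le> \<bar>x\<bar>} x * W (g n x)) \<le> \<epsilon>"
  obtains r where "strict_mono (r :: nat \<Rightarrow> nat)"
    "\<And>e. 0 < e \<Longrightarrow> \<exists>N. \<forall>m\<ge>N. \<forall>n\<ge>N. (LINT x|lborel. (g (r m) x - g (r n) x)\<^sup>2) < e"
proof -
  have bd: "\<bar>g n x\<bar> \<le> 2 * S" for n x using nice_sup_bound(1)[OF p(1,2), of n x] p(3)[of n] by linarith
  have Hd: "\<bar>g n x - g n y\<bar> \<le> sqrt \<bar>x - y\<bar> * S" for n x y
  proof -
    have "sqrt \<bar>x - y\<bar> * nrm (g1 n) \<le> sqrt \<bar>x - y\<bar> * S"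
      using Xnorm_bounds(4)[OF p(1), of n] p(3)[of n] by (intro mult_left_mono) auto
    then show ?thesis using ac_Holder[OF niceD(4,2)[OF p(2)], of n x y] by linarith
  qed
  obtain r G where r: "strict_mono (r :: nat \<Rightarrow> nat)" and G: "\<And>x. (\<lambda>n. g (r n) x) \<longlonglongrightarrow> G x"
    using Holder_subsequence[of g "2 * S" S, OF bd Hd] by blast
  have GS: "\<bar>G x\<bar> \<le> 2 * S" for x
    by (rule LIMSEQ_le_const2[OF tendsto_rabs[OF G]]) (use bd in auto)
  have mg[measurable]: "g n \<in> borel_measurable borel" for n by (rule L2_measurable[OF niceD(1)[OF p(2)]])
  have [measurable]: "G \<in> borel_measurable borel"
    by (rule borel_measurable_LIMSEQ_metric[where f="\<lambda>n. g (r n)"]) (use G in auto)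
  obtain c where c: "0 < c" "\<And>s. \<bar>s\<bar> \<le> 2 * S \<Longrightarrow> c * s\<^sup>2 \<le> W s" using W_quadratic_lower by blast
  have "\<exists>N. \<forall>m\<ge>N. \<forall>n\<ge>N. (LINT x|lborel. (g (r m) x - g (r n) x)\<^sup>2) < e" if e: "0 < e" for e
  proof -
    \<comment> \<open>Four terms of size at most \<open>2 * \<epsilon>\<close> are added in the end;
      the ninth part makes the inequality strict.\<close>
    define \<epsilon> where "\<epsilon> = e / 9"
    have \<epsilon>: "0 < \<epsilon>" using e by (simp add: \<epsilon>_def)
    obtain K :: nat where K: "\<forall>\<^sub>F n in sequentially. (LINT x|lborel. indicator {x. 2 * real K \<le> \<bar>x\<bar>} x * W (g n x)) \<le> c * \<epsilon>"
      using tight[of "c * \<epsilon>"] c \<epsilon> by auto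
    define A where "A = {x::real. 2 * real K \<le> \<bar>x\<bar>}"
    have Am[measurable]: "A \<in> sets borel" unfolding A_def by measurable
    have iA: "integrable lborel (\<lambda>x. indicator A x * (g n x)\<^sup>2)" for n
      using integrable_mult_indicator[OF _ L2_sq[OF niceD(1)[OF p(2)]], of A n] by simp
    have tail: "\<forall>\<^sub>F n in sequentially. (LINT x|lborel. indicator A x * (g n x)\<^sup>2) \<le> \<epsilon>"
      using K
    proof eventually_elim
      case (elim n)
      have "(LINT x|lborel. c * (indicator A x * (g n x)\<^sup>2)) \<le> (LINT x|lborel. indicator A x * W (g n x))"
      proof (rule integral_mono)
        show "integrable lborel (\<lambda>x. c * (indicator A x * (g n x)\<^sup>2))" using iA by simp
        show "integrable lborel (\<lambda>x. indicator A x * W (g n x))"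
          using integrable_mult_indicator[OF _ W_integrable_nice[OF p(2)], of A n] by simp
        fix x show "c * (indicator A x * (g n x)\<^sup>2) \<le> indicator A x * W (g n x)"
          using c(2)[OF bd, of n x] by (cases "x \<in> A") auto
      qed
      then have "c * (LINT x|lborel. indicator A x * (g n x)\<^sup>2) \<le> c * \<epsilon>" using elim by (simp add: A_def)
      then show ?case using c(1) by simp
    qed
    have iB: "integrable lborel (\<lambda>x. indicator (- A) x * (g n x - G x)\<^sup>2)" for n
    proof (rule Bochner_Integration.integrable_bound)
      show "integrable lborel (\<lambda>x. (4 * S)\<^sup>2 * indicator {- 2 * real K..2 * real K} x)"
        by (intro integrable_mult_right integrable_real_indicator) (auto simp: emeasure_lborel_Icc_eq)
      show "AE x in lborel. norm (indicator (- A) x * (g n x - G x)\<^sup>2) \<le> norm ((4 * S)\<^sup>2 * indicator {- 2 * real K..2 * real K} x)"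
      proof (intro AE_I2)
        fix x
        have "\<bar>g n x - G x\<bar> \<le> \<bar>4 * S\<bar>" using bd[of n x] GS[of x] by linarith
        then have "(g n x - G x)\<^sup>2 \<le> (4 * S)\<^sup>2" using abs_le_square_iff by blast
        then show "norm (indicator (- A) x * (g n x - G x)\<^sup>2) \<le> norm ((4 * S)\<^sup>2 * indicator {- 2 * real K..2 * real K} x)"
          by (auto simp: A_def indicator_def)
      qed
    qed measurable
    have "(\<lambda>n. LINT x|lborel. indicator (- A) x * (g (r n) x - G x)\<^sup>2) \<longlonglongrightarrow> (LINT x|lborel. indicator (- A) x * (G x - G x)\<^sup>2)"
    proof (rule integral_dominated_convergence[where w="\<lambda>x. (4 * S)\<^sup>2 * indicator {- 2 * real K..2 * real K} x"])
      show "integrable lborel (\<lambda>x. (4 * S)\<^sup>2 * indicator {- 2 * real K..2 * real K} x)"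
        by (intro integrable_mult_right integrable_real_indicator) (auto simp: emeasure_lborel_Icc_eq)
      show "AE x in lborel. (\<lambda>n. indicator (- A) x * (g (r n) x - G x)\<^sup>2) \<longlonglongrightarrow> indicator (- A) x * (G x - G x)\<^sup>2"
        by (intro AE_I2 tendsto_intros G)
      show "AE x in lborel. norm (indicator (- A) x * (g (r n) x - G x)\<^sup>2) \<le> (4 * S)\<^sup>2 * indicator {- 2 * real K..2 * real K} x" for n
      proof (intro AE_I2)
        fix x
        have "\<bar>g (r n) x - G x\<bar> \<le> \<bar>4 * S\<bar>" using bd[of "r n" x] GS[of x] by linarith
        then have "(g (r n) x - G x)\<^sup>2 \<le> (4 * S)\<^sup>2" using abs_le_square_iff by blast
        then show "norm (indicator (- A) x * (g (r n) x - G x)\<^sup>2) \<le> (4 * S)\<^sup>2 * indicator {- 2 * real K..2 * real K} x"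
          by (auto simp: A_def indicator_def)
      qed
    qed measurable
    then have "(\<lambda>n. LINT x|lborel. indicator (- A) x * (g (r n) x - G x)\<^sup>2) \<longlonglongrightarrow> 0" by simp
    then have loc: "\<forall>\<^sub>F n in sequentially. (LINT x|lborel. indicator (- A) x * (g (r n) x - G x)\<^sup>2) < \<epsilon>"
      using order_tendstoD(2) \<epsilon> by blast
    have "\<forall>\<^sub>F n in sequentially. (LINT x|lborel. indicator A x * (g (r n) x)\<^sup>2) \<le> \<epsilon>"
      using eventually_subseq[OF r tail] .
    with loc have "\<forall>\<^sub>F n in sequentially. (LINT x|lborel. indicator (- A) x * (g (r n) x - G x)\<^sup>2) < \<epsilon> \<and>
        (LINT x|lborel. indicator A x * (g (r n) x)\<^sup>2) \<le> \<epsilon>" by (rule eventually_conj)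
    then obtain N where N: "\<And>n. N \<le> n \<Longrightarrow> (LINT x|lborel. indicator (- A) x * (g (r n) x - G x)\<^sup>2) < \<epsilon>"
      "\<And>n. N \<le> n \<Longrightarrow> (LINT x|lborel. indicator A x * (g (r n) x)\<^sup>2) \<le> \<epsilon>"
      unfolding eventually_sequentially by blast
    have "(LINT x|lborel. (g (r m) x - g (r n) x)\<^sup>2) < e" if "N \<le> m" "N \<le> n" for m n
    proof -
      have "(LINT x|lborel. (g (r m) x - g (r n) x)\<^sup>2)
        \<le> (LINT x|lborel. 2 * (indicator (- A) x * (g (r m) x - G x)\<^sup>2) + 2 * (indicator (- A) x * (g (r n) x - G x)\<^sup>2)
            + (2 * (indicator A x * (g (r m) x)\<^sup>2) + 2 * (indicator A x * (g (r n) x)\<^sup>2)))"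
      proof (rule integral_mono)
        show "integrable lborel (\<lambda>x. (g (r m) x - g (r n) x)\<^sup>2)"
          by (rule L2_sq[OF L2_diff[OF niceD(1)[OF p(2)] niceD(1)[OF p(2)]]])
        show "integrable lborel (\<lambda>x. 2 * (indicator (- A) x * (g (r m) x - G x)\<^sup>2) + 2 * (indicator (- A) x * (g (r n) x - G x)\<^sup>2)
            + (2 * (indicator A x * (g (r m) x)\<^sup>2) + 2 * (indicator A x * (g (r n) x)\<^sup>2)))"
          by (intro Bochner_Integration.integrable_add integrable_mult_right iA iB)
        fix x
        have sq: "(a - b)\<^sup>2 \<le> 2 * (a - z)\<^sup>2 + 2 * (b - z)\<^sup>2" for a b z :: real
          using zero_le_power2[of "a + b - 2 * z"] by (simp add: power2_eq_square algebra_simps)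
        show "(g (r m) x - g (r n) x)\<^sup>2 \<le> 2 * (indicator (- A) x * (g (r m) x - G x)\<^sup>2) + 2 * (indicator (- A) x * (g (r n) x - G x)\<^sup>2)
            + (2 * (indicator A x * (g (r m) x)\<^sup>2) + 2 * (indicator A x * (g (r n) x)\<^sup>2))"
          using sq[of "g (r m) x" "g (r n) x" "G x"] sq[of "g (r m) x" "g (r n) x" 0] by (cases "x \<in> A") auto
      qed
      also have "\<dots> = 2 * (LINT x|lborel. indicator (- A) x * (g (r m) x - G x)\<^sup>2) + 2 * (LINT x|lborel. indicator (- A) x * (g (r n) x - G x)\<^sup>2)
            + (2 * (LINT x|lborel. indicator A x * (g (r m) x)\<^sup>2) + 2 * (LINT x|lborel. indicator A x * (g (r n) x)\<^sup>2))"
        using iA iB by simp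
      also have "\<dots> < 9 * \<epsilon>" using N(1)[OF that(1)] N(1)[OF that(2)] N(2)[OF that(1)] N(2)[OF that(2)] \<epsilon> by linarith
      finally show ?thesis by (simp add: \<epsilon>_def)
    qed
    then show ?thesis by blast
  qed
  then show thesis by (rule that[OF r])
qed

text \<open>By the parallelogram identity, the midpoint of two almost minimizers would have too little
  energy unless they are close.\<close>
lemma midpoint_Cauchy:
  assumes p: "\<And>n. rep (p n) (g n) (g1 n) (g2 n)" "\<And>n. nice (g n) (g1 n) (g2 n)" "\<And>n. Xnorm (p n) \<le> S"
    and E: "(\<lambda>n. energy W (p n)) \<longlonglongrightarrow> e0" and C: "(\<lambda>n. momentum (p n)) \<longlonglongrightarrow> p0"
    and \<delta>: "0 < \<delta>" and j: "\<And>q. q \<in> X \<Longrightarrow> (j - \<delta> * energy W q) * \<bar>momentum q\<bar> \<le> energy W q"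
    and e0: "e0 = (j - \<delta> * e0) * \<bar>p0\<bar>"
    and dd: "((\<lambda>(n, m). nrm (\<lambda>x. g n x - g m x)) \<longlongrightarrow> 0) (sequentially \<times>\<^sub>F sequentially)"
  shows "((\<lambda>(n, m). nrm (\<lambda>x. g1 n x - g1 m x)) \<longlongrightarrow> 0) (sequentially \<times>\<^sub>F sequentially)"
    and "((\<lambda>(n, m). (nrm (\<lambda>x. snd (p n) x - snd (p m) x))\<^sup>2 + (nrm (\<lambda>x. g2 n x - g2 m x))\<^sup>2) \<longlongrightarrow> 0)
      (sequentially \<times>\<^sub>F sequentially)"
proof -
  let ?F = "sequentially \<times>\<^sub>F sequentially :: (nat \<times> nat) filter"
  define d where "d n m = nrm (\<lambda>x. g n x - g m x)" for n m
  have d: "((\<lambda>z. d (fst z) (snd z)) \<longlongrightarrow> 0) ?F" using dd by (simp add: d_def case_prod_beta')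
  have S0: "0 \<le> S" using p(3)[of 0] Xnorm_nonneg order_trans by blast
  define v where "v n = snd (p n)" for n
  have L: "L2 (v n)" "L2 (g n)" "L2 (g1 n)" "L2 (g2 n)" for n
    using repD(2)[OF p(1)] niceD[OF p(2)] by (auto simp: v_def)
  have nb: "nrm (v n) \<le> S" "nrm (g n) \<le> S" "nrm (g1 n) \<le> S" "nrm (g2 n) \<le> S" for n
    using Xnorm_bounds[OF p(1), of n] p(3)[of n] unfolding v_def by linarith+
  have ndiff: "nrm (\<lambda>x. v n x - v m x) \<le> 2 * S" "nrm (\<lambda>x. g2 n x - g2 m x) \<le> 2 * S" for n m
    using nrm_diff_le[OF L(1) L(1), of n m] nrm_diff_le[OF L(4) L(4), of n m] nb[of n] nb[of m] by linarith+
  \<comment> \<open>L2 closeness of the functions and boundedness of the second derivatives give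
    closeness of the first derivatives, by interpolation.\<close>
  have g1d: "nrm (\<lambda>x. g1 n x - g1 m x) \<le> sqrt (d n m * (2 * S))" for n m
  proof (rule real_le_rsqrt)
    have "(nrm (\<lambda>x. g1 n x - g1 m x))\<^sup>2 \<le> d n m * nrm (\<lambda>x. g2 n x - g2 m x)"
      unfolding d_def by (rule sobolev2_interpolation[OF sobolev2_diff[OF nice_sobolev2[OF p(2)] nice_sobolev2[OF p(2)]]])
    also have "\<dots> \<le> d n m * (2 * S)" by (intro mult_left_mono ndiff) (simp add: d_def nrm_nonneg)
    finally show "(nrm (\<lambda>x. g1 n x - g1 m x))\<^sup>2 \<le> d n m * (2 * S)" .
  qed
  have sqd: "((\<lambda>z. sqrt (d (fst z) (snd z) * (2 * S))) \<longlongrightarrow> 0) ?F"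
    using tendsto_real_sqrt[OF tendsto_mult_left_zero[OF d, of "2 * S"]] by simp
  have "((\<lambda>z. nrm (\<lambda>x. g1 (fst z) x - g1 (snd z) x)) \<longlongrightarrow> 0) ?F"
    by (rule tendsto_sandwich[OF _ _ tendsto_const sqd]) (auto simp: nrm_nonneg g1d)
  then show "((\<lambda>(n, m). nrm (\<lambda>x. g1 n x - g1 m x)) \<longlongrightarrow> 0) ?F" by (simp add: case_prod_beta')
  define D where "D n m = (nrm (\<lambda>x. v n x - v m x))\<^sup>2 + (nrm (\<lambda>x. g2 n x - g2 m x))\<^sup>2" for n m
  define q where "q n m = (\<lambda>x. 1/2 * fst (p n) x + 1/2 * fst (p m) x, \<lambda>x. 1/2 * v n x + 1/2 * v m x)" for n m
  have rq: "rep (q n m) (\<lambda>x. 1/2 * g n x + 1/2 * g m x) (\<lambda>x. 1/2 * g1 n x + 1/2 * g1 m x) (\<lambda>x. 1/2 * g2 n x + 1/2 * g2 m x)" for n m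
    unfolding q_def v_def by (rule rep_lin[OF p(1) p(1)])
  have qX: "q n m \<in> X" for n m by (rule rep_X[OF rq])
  \<comment> \<open>The momentum of the midpoint differs from the average by a quarter of the
    pairing of the two differences, and one of these, the slope difference, is already
    small.\<close>
  have mom: "\<bar>momentum (q n m) - (1/2 * momentum (p n) + 1/2 * momentum (p m))\<bar> \<le> S * sqrt (d n m * (2 * S))" for n m
  proof -
    note i = L2_mult_integrable[OF L(1) L(3)]
    have "momentum (q n m) = - (LINT x|lborel. (1/2 * v n x + 1/2 * v m x) * (1/2 * g1 n x + 1/2 * g1 m x))"
      unfolding momentum_rep[OF rq] by (simp add: q_def)
    also have "(LINT x|lborel. (1/2 * v n x + 1/2 * v m x) * (1/2 * g1 n x + 1/2 * g1 m x))
      = (LINT x|lborel. 1/2 * (v n x * g1 n x) + 1/2 * (v m x * g1 m x) - 1/4 * ((v n x - v m x) * (g1 n x - g1 m x)))"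
      by (rule Bochner_Integration.integral_cong) (auto simp: field_simps)
    also have "\<dots> = (LINT x|lborel. 1/2 * (v n x * g1 n x) + 1/2 * (v m x * g1 m x))
        - (LINT x|lborel. 1/4 * ((v n x - v m x) * (g1 n x - g1 m x)))"
      by (intro Bochner_Integration.integral_diff Bochner_Integration.integrable_add integrable_mult_right i
          L2_mult_integrable L2_diff L)
    also have "(LINT x|lborel. 1/2 * (v n x * g1 n x) + 1/2 * (v m x * g1 m x))
        = 1/2 * (LINT x|lborel. v n x * g1 n x) + 1/2 * (LINT x|lborel. v m x * g1 m x)"
      using i by simp
    finally have eq: "momentum (q n m) - (1/2 * momentum (p n) + 1/2 * momentum (p m))
        = 1/4 * (LINT x|lborel. (v n x - v m x) * (g1 n x - g1 m x))"
      unfolding momentum_rep[OF p(1)] v_def by simp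
    have "\<bar>LINT x|lborel. (v n x - v m x) * (g1 n x - g1 m x)\<bar>
      \<le> nrm (\<lambda>x. v n x - v m x) * nrm (\<lambda>x. g1 n x - g1 m x)"
      by (rule L2_Cauchy_Schwarz[OF L2_diff[OF L(1) L(1)] L2_diff[OF L(3) L(3)]])
    also have "\<dots> \<le> (2 * S) * sqrt (d n m * (2 * S))"
      using S0 by (intro mult_mono ndiff g1d nrm_nonneg) auto
    finally have "\<bar>LINT x|lborel. (v n x - v m x) * (g1 n x - g1 m x)\<bar> \<le> 2 * (S * sqrt (d n m * (2 * S)))"
      by (simp add: mult.assoc)
    moreover have "0 \<le> S * sqrt (d n m * (2 * S))" using S0 by (simp add: d_def nrm_nonneg)
    ultimately show ?thesis unfolding eq by simp
  qed
  have fst_snd: "((\<lambda>z. h (fst z)) \<longlongrightarrow> l) ?F" "((\<lambda>z. h (snd z)) \<longlongrightarrow> l) ?F" if "h \<longlonglongrightarrow> l" for h :: "nat \<Rightarrow> real" and l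
    by (rule filterlim_compose[OF that filterlim_fst], rule filterlim_compose[OF that filterlim_snd])
  have momlim: "((\<lambda>z. momentum (q (fst z) (snd z))) \<longlongrightarrow> p0) ?F"
  proof -
    have "((\<lambda>z. momentum (q (fst z) (snd z)) - (1/2 * momentum (p (fst z)) + 1/2 * momentum (p (snd z)))) \<longlongrightarrow> 0) ?F"
    proof (rule tendsto_rabs_zero_cancel, rule tendsto_sandwich[OF _ _ tendsto_const])
      show "((\<lambda>z. S * sqrt (d (fst z) (snd z) * (2 * S))) \<longlongrightarrow> 0) ?F" by (rule tendsto_mult_right_zero[OF sqd])
      show "\<forall>\<^sub>F z in ?F. \<bar>momentum (q (fst z) (snd z)) - (1/2 * momentum (p (fst z)) + 1/2 * momentum (p (snd z)))\<bar>
        \<le> S * sqrt (d (fst z) (snd z) * (2 * S))" by (intro always_eventually allI mom)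
    qed simp
    moreover have "((\<lambda>z. 1/2 * momentum (p (fst z)) + 1/2 * momentum (p (snd z))) \<longlongrightarrow> 1/2 * p0 + 1/2 * p0) ?F"
      by (intro tendsto_intros fst_snd C)
    ultimately show ?thesis using tendsto_add by fastforce
  qed
  \<comment> \<open>Solving \<open>(j - \<delta> * E) * \<bar>t\<bar> \<le> E\<close> for
    \<open>E\<close> gives the lower bound \<open>\<Phi> t\<close>, continuous in the momentum and
    equal to \<open>e0\<close> at \<open>p0\<close>. So the midpoint may miss the momentum
    \<open>p0\<close> slightly.\<close>
  define \<Phi> where "\<Phi> t = j * \<bar>t\<bar> / (1 + \<delta> * \<bar>t\<bar>)" for t
  have pos: "0 < 1 + \<delta> * \<bar>t\<bar>" for t using \<delta> by (simp add: add_pos_nonneg)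
  have "((\<lambda>z. \<Phi> (momentum (q (fst z) (snd z)))) \<longlongrightarrow> \<Phi> p0) ?F"
    unfolding \<Phi>_def using pos[of p0] by (intro tendsto_intros momlim) auto
  moreover have "\<Phi> p0 = e0"
    using e0 pos[of p0] by (simp add: \<Phi>_def field_simps)
  ultimately have \<Phi>lim: "((\<lambda>z. \<Phi> (momentum (q (fst z) (snd z)))) \<longlongrightarrow> e0) ?F" by simp
  have \<Phi>le: "\<Phi> (momentum (q n m)) \<le> energy W (q n m)" for n m
    unfolding \<Phi>_def using j[OF qX, of n m] pos[of "momentum (q n m)"] by (simp add: pos_divide_le_eq algebra_simps)
  obtain K where K: "0 \<le> K" "\<And>f h. L2 f \<Longrightarrow> L2 h \<Longrightarrow> (\<forall>x. \<bar>f x\<bar> \<le> 2 * S) \<Longrightarrow> (\<forall>x. \<bar>h x\<bar> \<le> 2 * S) \<Longrightarrow>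
     \<bar>(LINT x|lborel. W (f x)) - (LINT x|lborel. W (h x))\<bar> \<le> K * (nrm f + nrm h) * nrm (\<lambda>x. f x - h x)"
    using integral_W_Lipschitz[of "2 * S"] by blast
  have bd: "\<bar>g n x\<bar> \<le> 2 * S" for n x using nice_sup_bound(1)[OF p(1,2), of n x] p(3)[of n] by linarith
  have Wmid: "\<bar>(LINT x|lborel. W (1/2 * g n x + 1/2 * g m x)) - (LINT x|lborel. W (g k x))\<bar> \<le> K * (2 * S) * d n m"
    if k: "k = n \<or> k = m" for n m k
  proof -
    have Lm: "L2 (\<lambda>x. 1/2 * g n x + 1/2 * g m x)" by (rule L2_lin[OF L(2) L(2)])
    have "nrm (\<lambda>x. 1/2 * g n x + 1/2 * g m x) \<le> 1/2 * nrm (g n) + 1/2 * nrm (g m)"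
      using nrm_triangle[OF L2_cmult[OF L(2), of "1/2" n] L2_cmult[OF L(2), of "1/2" m]] unfolding nrm_cmult by simp
    then have n1: "nrm (\<lambda>x. 1/2 * g n x + 1/2 * g m x) + nrm (g k) \<le> 2 * S" using nb(2)[of n] nb(2)[of m] nb(2)[of k] by linarith
    have mid: "(\<lambda>x. 1/2 * g n x + 1/2 * g m x - g k x) = (\<lambda>x. (if k = n then - 1/2 else 1/2) * (g n x - g m x))"
      using k by (auto simp: fun_eq_iff field_simps)
    have "nrm (\<lambda>x. 1/2 * g n x + 1/2 * g m x - g k x) = \<bar>if k = n then - 1/2 else 1/2\<bar> * d n m"
      unfolding mid nrm_cmult d_def ..
    also have "\<dots> \<le> 1 * d n m" by (rule mult_right_mono) (auto simp: d_def nrm_nonneg)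
    finally have n2: "nrm (\<lambda>x. 1/2 * g n x + 1/2 * g m x - g k x) \<le> d n m" by simp
    have "\<bar>(LINT x|lborel. W (1/2 * g n x + 1/2 * g m x)) - (LINT x|lborel. W (g k x))\<bar>
      \<le> K * (nrm (\<lambda>x. 1/2 * g n x + 1/2 * g m x) + nrm (g k)) * nrm (\<lambda>x. 1/2 * g n x + 1/2 * g m x - g k x)"
    proof (rule K(2)[OF Lm L(2)])
      show "\<forall>x. \<bar>1/2 * g n x + 1/2 * g m x\<bar> \<le> 2 * S"
      proof
        fix x show "\<bar>1/2 * g n x + 1/2 * g m x\<bar> \<le> 2 * S" using bd[of n x] bd[of m x] by linarith
      qed
    qed (use bd in blast)
    also have "\<dots> \<le> K * (2 * S) * d n m"
      using n1 n2 K(1) S0 by (intro mult_mono mult_left_mono mult_nonneg_nonneg nrm_nonneg add_nonneg_nonneg) auto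
    finally show ?thesis .
  qed
  \<comment> \<open>The average energy minus the midpoint energy contains \<open>D / 8\<close> from
    the quadratic part; the potential part contributes only a multiple of
    \<open>d n m\<close>.\<close>
  have Dle: "1/8 * D n m \<le> 1/2 * energy W (p n) + 1/2 * energy W (p m) - \<Phi> (momentum (q n m)) + K * (2 * S) * d n m" for n m
  proof -
    have v2: "(nrm (\<lambda>x. 1/2 * v n x + 1/2 * v m x))\<^sup>2 = 1/2 * (nrm (v n))\<^sup>2 + 1/2 * (nrm (v m))\<^sup>2 - 1/4 * (nrm (\<lambda>x. v n x - v m x))\<^sup>2"
      by (rule nrm_midpoint[OF L(1) L(1)])
    have g2: "(nrm (\<lambda>x. 1/2 * g2 n x + 1/2 * g2 m x))\<^sup>2 = 1/2 * (nrm (g2 n))\<^sup>2 + 1/2 * (nrm (g2 m))\<^sup>2 - 1/4 * (nrm (\<lambda>x. g2 n x - g2 m x))\<^sup>2"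
      by (rule nrm_midpoint[OF L(4) L(4)])
    have Eq: "energy W (q n m) = 1/2 * ((nrm (\<lambda>x. 1/2 * v n x + 1/2 * v m x))\<^sup>2 + (nrm (\<lambda>x. 1/2 * g2 n x + 1/2 * g2 m x))\<^sup>2)
        + (LINT x|lborel. W (1/2 * g n x + 1/2 * g m x))"
      using energy_rep[OF rq, of n m] by (simp add: q_def)
    have En: "energy W (p k) = 1/2 * ((nrm (v k))\<^sup>2 + (nrm (g2 k))\<^sup>2) + (LINT x|lborel. W (g k x))" for k
      using energy_rep[OF p(1)] by (simp add: v_def)
    show ?thesis
      using Wmid[of n n m] Wmid[of m n m] \<Phi>le[of n m] unfolding Eq En v2 g2 D_def distrib_left right_diff_distrib
      by linarith
  qed
  have "((\<lambda>z. 1/2 * energy W (p (fst z)) + 1/2 * energy W (p (snd z)) - \<Phi> (momentum (q (fst z) (snd z))) + K * (2 * S) * d (fst z) (snd z))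
      \<longlongrightarrow> 1/2 * e0 + 1/2 * e0 - e0 + K * (2 * S) * 0) ?F"
    by (intro tendsto_intros fst_snd E \<Phi>lim d)
  then have up: "((\<lambda>z. 8 * (1/2 * energy W (p (fst z)) + 1/2 * energy W (p (snd z)) - \<Phi> (momentum (q (fst z) (snd z))) + K * (2 * S) * d (fst z) (snd z)))
      \<longlongrightarrow> 0) ?F"
    by (intro tendsto_mult_right_zero) simp
  have "((\<lambda>z. D (fst z) (snd z)) \<longlongrightarrow> 0) ?F"
  proof (rule tendsto_sandwich[OF _ _ tendsto_const up])
    show "\<forall>\<^sub>F z in ?F. 0 \<le> D (fst z) (snd z)" by (simp add: D_def)
    have "D n m \<le> 8 * (1/2 * energy W (p n) + 1/2 * energy W (p m) - \<Phi> (momentum (q n m)) + K * (2 * S) * d n m)" for n m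
      using mult_left_mono[OF Dle[of n m], of 8] by simp
    then show "\<forall>\<^sub>F z in ?F. D (fst z) (snd z) \<le> 8 * (1/2 * energy W (p (fst z)) + 1/2 * energy W (p (snd z)) - \<Phi> (momentum (q (fst z) (snd z))) + K * (2 * S) * d (fst z) (snd z))"
      by simp
  qed
  then show "((\<lambda>(n, m). (nrm (\<lambda>x. snd (p n) x - snd (p m) x))\<^sup>2 + (nrm (\<lambda>x. g2 n x - g2 m x))\<^sup>2) \<longlongrightarrow> 0) ?F"
    by (simp add: D_def v_def case_prod_beta')
qed

end

lemma tendsto_0_prod_sequentially:
  fixes A :: "nat \<Rightarrow> nat \<Rightarrow> real"
  assumes "\<And>m n. 0 \<le> A m n"
  shows "((\<lambda>(n, m). A n m) \<longlongrightarrow> 0) (sequentially \<times>\<^sub>F sequentially) \<longleftrightarrow> (\<forall>e>0. \<exists>N. \<forall>m\<ge>N. \<forall>n\<ge>N. A m n < e)"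
  unfolding tendsto_iff eventually_prod_sequentially using assms by (auto simp: dist_real_def) meson+

section \<open>Convergence of energy and momentum, the compactness theorem and a state below the
  threshold\<close>

context potential begin

text \<open>Bounded \<open>w n\<close> and convergent distances put all states into one ball, on
  which both functionals are Lipschitz. The reference states vary with \<open>n\<close> because
  stability compares with a moving point of the invariant set.\<close>

lemma energy_momentum_tendsto:
  assumes p: "\<And>n. p n \<in> X" and w: "\<And>n. w n \<in> X" "\<And>n. Xnorm (w n) \<le> S"
    and d: "(\<lambda>n. Xdist (p n) (w n)) \<longlonglongrightarrow> 0"
  shows "(\<lambda>n. energy W (p n) - energy W (w n)) \<longlonglongrightarrow> 0" "(\<lambda>n. momentum (p n) - momentum (w n)) \<longlonglongrightarrow> 0"
proof -
  have "Bseq (\<lambda>n. Xdist (p n) (w n))" using d by (intro convergent_imp_Bseq convergentI)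
  then obtain B where B: "\<And>n. norm (Xdist (p n) (w n)) \<le> B" unfolding Bseq_def by blast
  define T where "T = 3 * (S + B)"
  have S0: "0 \<le> S" using w(2)[of 0] Xnorm_nonneg order_trans by blast
  have B0: "0 \<le> B" using B[of 0] norm_ge_zero order_trans by blast
  have wT: "Xnorm (w n) \<le> T" for n using w(2)[of n] S0 B0 unfolding T_def distrib_left by linarith
  have pT: "Xnorm (p n) \<le> T" for n
    using Xnorm_le_Xdist[OF p w(1), of n n] w(2)[of n] B[of n] Xdist_nonneg[of "p n" "w n"]
    unfolding T_def distrib_left by simp
  obtain K where K: "\<And>p q. p \<in> X \<Longrightarrow> q \<in> X \<Longrightarrow> Xnorm p \<le> T \<Longrightarrow> Xnorm q \<le> T \<Longrightarrow> \<bar>energy W p - energy W q\<bar> \<le> K * Xdist p q"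
    using energy_Lipschitz by blast
  show "(\<lambda>n. energy W (p n) - energy W (w n)) \<longlonglongrightarrow> 0"
  proof (rule tendsto_rabs_zero_cancel, rule tendsto_sandwich[OF _ _ tendsto_const tendsto_mult_right_zero[OF d, of K]])
    show "\<forall>\<^sub>F n in sequentially. \<bar>energy W (p n) - energy W (w n)\<bar> \<le> K * Xdist (p n) (w n)"
      by (intro always_eventually allI K p w(1) pT wT)
  qed simp
  show "(\<lambda>n. momentum (p n) - momentum (w n)) \<longlonglongrightarrow> 0"
  proof (rule tendsto_rabs_zero_cancel, rule tendsto_sandwich[OF _ _ tendsto_const tendsto_mult_right_zero[OF d, of "2 * T"]])
    show "\<forall>\<^sub>F n in sequentially. \<bar>momentum (p n) - momentum (w n)\<bar> \<le> 2 * T * Xdist (p n) (w n)"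
      by (intro always_eventually allI momentum_Lipschitz p w(1) pT wT)
  qed simp
qed

lemma energy_momentum_continuous:
  assumes "\<And>n. p n \<in> X" "l \<in> X" "(\<lambda>n. Xdist (p n) l) \<longlonglongrightarrow> 0"
  shows "(\<lambda>n. energy W (p n)) \<longlonglongrightarrow> energy W l" "(\<lambda>n. momentum (p n)) \<longlonglongrightarrow> momentum l"
  using energy_momentum_tendsto[of p "\<lambda>_. l" "Xnorm l"] assms by (auto intro: LIM_zero_cancel)

lemma large_amplitude:
  assumes "p \<in> X" "rep p f f1 f2" "nice f f1 f2" "energy W p < min 1 (2 * \<eta>) * \<bar>momentum p\<bar>"
  shows "\<exists>x. 1 < \<bar>f x\<bar>"
  using small_amplitude_energy[OF assms(2,3)] assms(4) by (meson not_le)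

text \<open>Below the threshold the amplitude exceeds one somewhere; after translating that point to
  the origin, \<open>central_energy\<close> applies. The bound keeps the momentum of a minimizing
  sequence away from zero.\<close>

lemma energy_lower_bound:
  "\<exists>c>0. \<forall>p\<in>X. Xnorm p \<le> S \<longrightarrow> energy W p < min 1 (2 * \<eta>) * \<bar>momentum p\<bar> \<longrightarrow> c \<le> energy W p"
proof -
  obtain c1 where c1: "0 < c1" "\<And>p f f1 f2 N. rep p f f1 f2 \<Longrightarrow> nice f f1 f2 \<Longrightarrow> Xnorm p \<le> S \<Longrightarrow> 1 < \<bar>f 0\<bar> \<Longrightarrow> 1 \<le> N \<Longrightarrow>
     c1 \<le> (LINT x|lborel. indicator {x. \<bar>x\<bar> \<le> N} x * W (f x))"
    using central_energy[of S] by blast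
  have "c1 \<le> energy W p" if p: "p \<in> X" "Xnorm p \<le> S" "energy W p < min 1 (2 * \<eta>) * \<bar>momentum p\<bar>" for p
  proof -
    obtain f f1 f2 where f: "rep p f f1 f2" "nice f f1 f2" using X_rep[OF p(1)] by metis
    obtain y where y: "1 < \<bar>f y\<bar>" using large_amplitude[OF p(1) f p(3)] by blast
    have xs: "Xnorm (shift (- y) p) \<le> S"
      using p(2) unfolding Xnorm_rep[OF rep_shift[OF f(1)]] Xnorm_rep[OF f(1)] by (simp add: shift_def nrm_shift nrm_shift[where t="-y", simplified])
    have "c1 \<le> (LINT x|lborel. indicator {x. \<bar>x\<bar> \<le> 1} x * W (f (x - - y)))"
      by (rule c1(2)[OF rep_shift[OF f(1)] nice_shift[OF f(2)] xs]) (use y in auto)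
    also have "\<dots> \<le> (LINT x|lborel. W (f (x - - y)))"
    proof (rule integral_mono)
      have i: "integrable lborel (\<lambda>x. W (f (x - - y)))" by (rule W_integrable_nice[OF nice_shift[OF f(2)]])
      then show "integrable lborel (\<lambda>x. W (f (x - - y)))" .
      show "integrable lborel (\<lambda>x. indicator {x. \<bar>x\<bar> \<le> 1} x * W (f (x - - y)))"
        using integrable_mult_indicator[OF _ i, of "{x. \<bar>x\<bar> \<le> 1}"] by simp
      fix x show "indicator {x. \<bar>x\<bar> \<le> 1} x * W (f (x - - y)) \<le> W (f (x - - y))"
        using W_nonneg[of "f (x - - y)"] by (simp add: indicator_def)
    qed
    also have "\<dots> = (LINT x|lborel. W (f x))" using integral_shift[of "\<lambda>x. W (f x)" "- y"] by simp
    also have "\<dots> \<le> energy W p" unfolding energy_rep[OF f(1)] by simp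
    finally show ?thesis .
  qed
  then show ?thesis using c1(1) by blast
qed

text \<open>\<open>j\<close> is any lower bound for \<open>J\<close> that the limits
  \<open>e0\<close>, \<open>p0\<close> attain, so the statement serves minimizing sequences as well
  as sequences obtained from the flow. As \<open>j - \<delta> * e0 = e0 / \<bar>p0\<bar>\<close>,
  hypothesis \<open>lt\<close> places the limits below the threshold: eventually there is a point of
  amplitude above one, on which the translations centre the states.\<close>

theorem compactness_mod_translations:
  assumes p: "\<And>n. p n \<in> X"
    and E: "(\<lambda>n. energy W (p n)) \<longlonglongrightarrow> e0" and C: "(\<lambda>n. momentum (p n)) \<longlonglongrightarrow> p0" and p0: "p0 \<noteq> 0"
    and \<delta>: "0 < \<delta>" and j: "\<And>q. q \<in> X \<Longrightarrow> (j - \<delta> * energy W q) * \<bar>momentum q\<bar> \<le> energy W q"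
    and e0: "e0 = (j - \<delta> * e0) * \<bar>p0\<bar>" and lt: "j - \<delta> * e0 < min 1 (2 * \<eta>)"
  shows "\<exists>\<tau>::nat \<Rightarrow> real. \<exists>r l. strict_mono r \<and> l \<in> X \<and> (\<lambda>n. Xdist (shift (\<tau> (r n)) (p (r n))) l) \<longlonglongrightarrow> 0"
proof -
  define m where "m = min 1 (2 * \<eta>)"
  have "\<forall>n. \<exists>f f1 f2. rep (p n) f f1 f2 \<and> nice f f1 f2" using X_rep[OF p] by metis
  then obtain f f1 f2 where f: "\<And>n. rep (p n) (f n) (f1 n) (f2 n)" "\<And>n. nice (f n) (f1 n) (f2 n)" by metis
  have "(\<lambda>n. m * \<bar>momentum (p n)\<bar> - energy W (p n)) \<longlonglongrightarrow> m * \<bar>p0\<bar> - e0"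
    by (intro tendsto_intros C E)
  moreover have "0 < m * \<bar>p0\<bar> - e0"
  proof -
    have "(j - \<delta> * e0) * \<bar>p0\<bar> < m * \<bar>p0\<bar>" using lt p0 unfolding m_def by (intro mult_strict_right_mono) auto
    then show ?thesis using e0 by linarith
  qed
  ultimately have "\<forall>\<^sub>F n in sequentially. 0 < m * \<bar>momentum (p n)\<bar> - energy W (p n)" by (rule order_tendstoD(1))
  then have large: "\<forall>\<^sub>F n in sequentially. \<exists>x. 1 < \<bar>f n x\<bar>"
  proof eventually_elim
    case (elim n)
    then show ?case using large_amplitude[OF p f(1) f(2), of n] by (simp add: m_def)
  qed
  \<comment> \<open>Shifting by \<open>- x\<close> moves the point \<open>x\<close> to the origin.
    For the finitely many \<open>n\<close> without such a point the choice is arbitrary.\<close>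
  define \<tau> where "\<tau> n = - (SOME x. 1 < \<bar>f n x\<bar>)" for n
  define q where "q n = shift (\<tau> n) (p n)" for n
  define g where "g n x = f n (x - \<tau> n)" for n x
  define g1 where "g1 n x = f1 n (x - \<tau> n)" for n x
  define g2 where "g2 n x = f2 n (x - \<tau> n)" for n x
  have g: "rep (q n) (g n) (g1 n) (g2 n)" "nice (g n) (g1 n) (g2 n)" for n
    unfolding q_def g_def[abs_def] g1_def[abs_def] g2_def[abs_def] by (rule rep_shift[OF f(1)], rule nice_shift[OF f(2)])
  have qX: "q n \<in> X" for n by (rule rep_X[OF g(1)])
  have Eq: "(\<lambda>n. energy W (q n)) \<longlonglongrightarrow> e0" and Cq: "(\<lambda>n. momentum (q n)) \<longlonglongrightarrow> p0"
    unfolding q_def using E C by (simp_all add: energy_shift[OF p] momentum_shift[OF p])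
  have g0: "\<forall>\<^sub>F n in sequentially. 1 < \<bar>g n 0\<bar>"
    using large
  proof eventually_elim
    case (elim n)
    then have "1 < \<bar>f n (SOME x. 1 < \<bar>f n x\<bar>)\<bar>" by (rule someI_ex)
    then show ?case by (simp add: g_def \<tau>_def)
  qed
  have "Bseq (\<lambda>n. energy W (q n))" using Eq by (intro convergent_imp_Bseq convergentI)
  then obtain M where "\<And>n. norm (energy W (q n)) \<le> M" unfolding Bseq_def by blast
  then have M: "energy W (q n) \<le> M" for n using abs_le_D1 real_norm_def by metis
  obtain S where S: "\<And>q. q \<in> X \<Longrightarrow> energy W q \<le> M \<Longrightarrow> Xnorm q \<le> S" using energy_coercive by blast
  have qS: "Xnorm (q n) \<le> S" for n by (rule S[OF qX M])
  obtain r where r: "strict_mono (r :: nat \<Rightarrow> nat)"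
    "\<And>e. 0 < e \<Longrightarrow> \<exists>N. \<forall>m\<ge>N. \<forall>n\<ge>N. (LINT x|lborel. (g (r m) x - g (r n) x)\<^sup>2) < e"
    using tight_subsequence_L2_Cauchy[OF g qS tightness[OF g qS Eq Cq p0 \<delta> j e0 g0]] by blast
  let ?F = "sequentially \<times>\<^sub>F sequentially :: (nat \<times> nat) filter"
  have dd: "((\<lambda>(n, m). nrm (\<lambda>x. g (r n) x - g (r m) x)) \<longlongrightarrow> 0) ?F"
    unfolding tendsto_0_prod_sequentially[OF nrm_nonneg]
  proof (intro allI impI)
    fix e :: real assume e: "0 < e"
    obtain N where N: "\<And>m n. N \<le> m \<Longrightarrow> N \<le> n \<Longrightarrow> (LINT x|lborel. (g (r m) x - g (r n) x)\<^sup>2) < e\<^sup>2"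
      using r(2)[of "e\<^sup>2"] e by auto
    have "nrm (\<lambda>x. g (r m) x - g (r n) x) < e" if "N \<le> m" "N \<le> n" for m n
      using real_sqrt_less_mono[OF N[OF that]] e unfolding nrm_def by simp
    then show "\<exists>N. \<forall>m\<ge>N. \<forall>n\<ge>N. nrm (\<lambda>x. g (r m) x - g (r n) x) < e" by blast
  qed
  have Er: "(\<lambda>n. energy W (q (r n))) \<longlonglongrightarrow> e0" and Cr: "(\<lambda>n. momentum (q (r n))) \<longlonglongrightarrow> p0"
    using LIMSEQ_subseq_LIMSEQ[OF Eq r(1)] LIMSEQ_subseq_LIMSEQ[OF Cq r(1)] by (simp_all add: o_def)
  note mc = midpoint_Cauchy[of "\<lambda>n. q (r n)" "\<lambda>n. g (r n)" "\<lambda>n. g1 (r n)" "\<lambda>n. g2 (r n)", OF g(1) g(2) qS Er Cr \<delta> j e0 dd]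
  define v where "v n = snd (q n)" for n
  have L: "L2 (v n)" "L2 (g n)" "L2 (g1 n)" "L2 (g2 n)" for n
    using repD(2)[OF g(1)] niceD[OF g(2)] by (auto simp: v_def)
  have sqC: "\<exists>N. \<forall>m\<ge>N. \<forall>n\<ge>N. (LINT x|lborel. (h m x - h n x)\<^sup>2) < e"
    if "((\<lambda>(n, m). (nrm (\<lambda>x. h n x - h m x))\<^sup>2) \<longlongrightarrow> 0) ?F" "0 < e" for h :: "nat \<Rightarrow> real \<Rightarrow> real" and e :: real
    using that(1)[unfolded tendsto_0_prod_sequentially[where A="\<lambda>n m. (nrm (\<lambda>x. h n x - h m x))\<^sup>2", OF zero_le_power2]] that(2)
    unfolding nrm_sq by blast
  have c1: "((\<lambda>(n, m). (nrm (\<lambda>x. g1 (r n) x - g1 (r m) x))\<^sup>2) \<longlongrightarrow> 0) ?F"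
    using tendsto_power[OF mc(1), of 2] by (simp add: case_prod_beta')
  have cv: "((\<lambda>(n, m). (nrm (\<lambda>x. v (r n) x - v (r m) x))\<^sup>2) \<longlongrightarrow> 0) ?F"
    by (rule tendsto_sandwich[OF _ _ tendsto_const mc(2)]) (auto simp: v_def case_prod_beta' intro!: always_eventually)
  have c2: "((\<lambda>(n, m). (nrm (\<lambda>x. g2 (r n) x - g2 (r m) x))\<^sup>2) \<longlongrightarrow> 0) ?F"
    by (rule tendsto_sandwich[OF _ _ tendsto_const mc(2)]) (auto simp: case_prod_beta' intro!: always_eventually)
  obtain l where l: "L2 l" "(\<lambda>n. nrm (\<lambda>x. g (r n) x - l x)) \<longlonglongrightarrow> 0"
    using L2_complete[of "\<lambda>n. g (r n)", OF L(2) r(2)] by blast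
  obtain l1 where l1: "L2 l1" "(\<lambda>n. nrm (\<lambda>x. g1 (r n) x - l1 x)) \<longlonglongrightarrow> 0"
    using L2_complete[of "\<lambda>n. g1 (r n)", OF L(3) sqC[OF c1]] by blast
  obtain l2 where l2: "L2 l2" "(\<lambda>n. nrm (\<lambda>x. g2 (r n) x - l2 x)) \<longlonglongrightarrow> 0"
    using L2_complete[of "\<lambda>n. g2 (r n)", OF L(4) sqC[OF c2]] by blast
  obtain lv where lv: "L2 lv" "(\<lambda>n. nrm (\<lambda>x. v (r n) x - lv x)) \<longlonglongrightarrow> 0"
    using L2_complete[of "\<lambda>n. v (r n)", OF L(1) sqC[OF cv]] by blast
  have gs: "sobolev2 (g n) (g1 n) (g2 n)" for n by (rule nice_sobolev2[OF g(2)])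
  have "sobolev2 l l1 l2"
    unfolding sobolev2_def
    using l(1) l1(1) l2(1)
      weak_deriv_L2_limit[of "\<lambda>n. g (r n)" "\<lambda>n. g1 (r n)", OF sobolev2D(4)[OF gs] L(2) L(3) l(1) l1(1) l(2) l1(2)]
      weak_deriv_L2_limit[of "\<lambda>n. g1 (r n)" "\<lambda>n. g2 (r n)", OF sobolev2D(5)[OF gs] L(3) L(4) l1(1) l2(1) l1(2) l2(2)]
    by blast
  then have rl: "rep (l, lv) l l1 l2" by (rule rep_self[OF _ lv(1)])
  have "(\<lambda>n. sqrt ((nrm (\<lambda>x. v (r n) x - lv x))\<^sup>2 + (nrm (\<lambda>x. g2 (r n) x - l2 x))\<^sup>2 + (nrm (\<lambda>x. g (r n) x - l x))\<^sup>2)) \<longlonglongrightarrow> sqrt (0\<^sup>2 + 0\<^sup>2 + 0\<^sup>2)"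
    by (intro tendsto_intros l l2 lv)
  then have "(\<lambda>n. Xdist (q (r n)) (l, lv)) \<longlonglongrightarrow> 0"
    by (simp add: Xdist_rep[OF g(1) rl] v_def)
  then show ?thesis using r(1) rep_X[OF rl] unfolding q_def by blast
qed

text \<open>With \<open>v = - m * f1\<close> the momentum is \<open>m * ||f1||^2\<close> and the
  kinetic energy is half of \<open>m * |C|\<close>; bending and potential energy must fit into the
  other half. For the profile \<open>R * mollifier (x / \<mu>)\<close> and relative to
  \<open>||f1||^2\<close>, the bending energy scales like \<open>1 / \<mu>^2\<close> and the
  potential energy at most like \<open>\<mu>^2 * R powr (\<alpha> - 2)\<close>. Hence
  \<open>\<mu>\<close> is fixed first and \<open>R\<close> is taken large afterwards.\<close>

lemma trial_state:
  assumes M: "0 < M" and \<alpha>: "0 \<le> \<alpha>" "\<alpha> < 2" and Wup: "\<And>s. 0 \<le> s \<Longrightarrow> W s \<le> M * \<bar>s\<bar> powr \<alpha>" and m: "0 < m"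
  shows "\<exists>p\<in>X. momentum p \<noteq> 0 \<and> energy W p < m * \<bar>momentum p\<bar>"
proof -
  define A where "A = (nrm (deriv mollifier))\<^sup>2"
  define B where "B = (nrm (deriv (deriv mollifier)))\<^sup>2"
  note t = mollifier(1)
  obtain T where T: "0 \<le> T" "\<And>x. \<bar>mollifier x\<bar> \<le> T" using test_fun_bounded[OF t] by blast
  have A: "0 < A"
  proof (rule ccontr)
    assume "\<not> 0 < A"
    then have z: "nrm (deriv mollifier) = 0" by (simp add: A_def)
    have "ac mollifier (deriv mollifier)"
      by (rule DERIV_ac[OF test_fun_DERIV[OF t] test_fun_continuous[OF test_fun_deriv[OF t]]])
    then have "\<bar>mollifier x - mollifier 0\<bar> \<le> 0" for x
      using ac_Holder[OF _ L2_test_fun[OF test_fun_deriv[OF t]], of mollifier x 0] z by simp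
    then have "mollifier x = 0" for x using mollifier(4)[of 0] by simp
    then show False using mollifier(3) by simp
  qed
  have B: "0 \<le> B" by (simp add: B_def)
  \<comment> \<open>Makes the bending contribution \<open>B / (2 * \<mu>^2)\<close> smaller than
    \<open>m^2 * A / 4\<close>, half of what the kinetic term leaves over; the other half is left to
    the potential term.\<close>
  define \<mu> where "\<mu> = 1 + 2 * B / (m\<^sup>2 * A)"
  have \<mu>1: "1 \<le> \<mu>" using A B m by (simp add: \<mu>_def)
  have \<mu>B: "1/2 * B < 1/4 * (m\<^sup>2 * A) * \<mu>\<^sup>2"
  proof -
    have "2 * B < m\<^sup>2 * A * \<mu>" using A m by (simp add: \<mu>_def field_simps)
    also have "\<dots> \<le> m\<^sup>2 * A * \<mu>\<^sup>2" using \<mu>1 A m by (intro mult_left_mono) (auto simp: power2_eq_square)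
    finally show ?thesis by simp
  qed
  have "((\<lambda>R. R powr (\<alpha> - 2)) \<longlongrightarrow> 0) at_top" using \<alpha> by (intro tendsto_neg_powr filterlim_ident) auto
  then have "((\<lambda>R. M * T powr \<alpha> * \<mu>\<^sup>2 * R powr (\<alpha> - 2)) \<longlongrightarrow> 0) at_top" by (rule tendsto_mult_right_zero)
  then have "\<forall>\<^sub>F R in at_top. M * T powr \<alpha> * \<mu>\<^sup>2 * R powr (\<alpha> - 2) < 1/4 * (m\<^sup>2 * A)"
    using A m by (intro order_tendstoD(2)) auto
  then have "\<forall>\<^sub>F R in at_top. 0 < R \<and> M * T powr \<alpha> * \<mu>\<^sup>2 * R powr (\<alpha> - 2) < 1/4 * (m\<^sup>2 * A)"
    using eventually_gt_at_top[of 0] by eventually_elim simp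
  then obtain R where R: "0 < R" "M * T powr \<alpha> * \<mu>\<^sup>2 * R powr (\<alpha> - 2) < 1/4 * (m\<^sup>2 * A)"
    unfolding eventually_at_top_linorder by blast
  define f where "f x = R * mollifier (x / \<mu>)" for x
  define f1 where "f1 x = R / \<mu> * deriv mollifier (x / \<mu>)" for x
  define f2 where "f2 x = R / \<mu>\<^sup>2 * deriv (deriv mollifier) (x / \<mu>)" for x
  have sf: "sobolev2 f f1 f2"
  proof -
    have D: "((\<lambda>x. c * \<psi> (x / \<mu>)) has_real_derivative c / \<mu> * deriv \<psi> (x / \<mu>)) (at x)" if "test_fun \<psi>" for c \<psi> x
      using \<mu>1 by (auto intro!: derivative_eq_intros DERIV_chain2[OF test_fun_DERIV[OF that]])
    have 1: "deriv f = f1" unfolding f_def[abs_def] f1_def[abs_def] by (intro ext DERIV_imp_deriv D t)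
    have 2: "deriv f1 = f2" unfolding f1_def[abs_def] f2_def[abs_def]
      using D[OF test_fun_deriv[OF t], of "R / \<mu>"] by (intro ext DERIV_imp_deriv) (simp add: power2_eq_square)
    have "test_fun f"
    proof (rule test_funI[of _ "\<mu>"])
      show "smooth f" unfolding f_def[abs_def]
        using smooth_cmult[OF smooth_affine[of mollifier "1/\<mu>" 0], of R] t by (simp add: test_fun_iff)
      fix x assume "\<mu> \<le> \<bar>x\<bar>"
      then have "x / \<mu> \<notin> {0<..<1}" using \<mu>1 by (auto simp: field_simps)
      then show "f x = 0" using mollifier(4) by (simp add: f_def)
    qed
    from sobolev2_test_fun[OF this] show ?thesis by (simp add: 1 2)
  qed
  have scale: "(nrm (\<lambda>x. c * \<psi> (x / \<mu>)))\<^sup>2 = c\<^sup>2 * \<mu> * (nrm \<psi>)\<^sup>2" for c \<psi>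
    using lborel_integral_real_affine[of "1 / \<mu>" "\<lambda>x. (\<psi> x)\<^sup>2" 0] \<mu>1
    by (simp add: nrm_sq power_mult_distrib)
  have n1: "(nrm f1)\<^sup>2 = R\<^sup>2 * A / \<mu>" unfolding f1_def[abs_def] scale A_def using \<mu>1 by (simp add: power2_eq_square)
  have n2: "(nrm f2)\<^sup>2 = R\<^sup>2 * B / \<mu>^3" unfolding f2_def[abs_def] scale B_def
    using \<mu>1 by (simp add: power2_eq_square power3_eq_cube)
  define v where "v x = - m * f1 x" for x
  have v: "L2 v" unfolding v_def[abs_def] by (rule L2_cmult[OF sobolev2D(2)[OF sf]])
  have nv: "(nrm v)\<^sup>2 = m\<^sup>2 * (nrm f1)\<^sup>2" unfolding v_def[abs_def] nrm_cmult by (simp add: power_mult_distrib)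
  have rp: "rep (f, v) f f1 f2" by (rule rep_self[OF sf v])
  have mom: "momentum (f, v) = m * (R\<^sup>2 * A / \<mu>)"
    unfolding momentum_rep[OF rp] n1[symmetric] nrm_sq v_def by (simp add: power2_eq_square mult.assoc)
  \<comment> \<open>The profile is nonnegative, so the growth bound, stated for
    \<open>s \<ge> 0\<close>, applies; it is supported in \<open>{0..\<mu>}\<close> and bounded by
    \<open>R * T\<close>.\<close>
  have Wint: "(LINT x|lborel. W (f x)) \<le> M * (R * T) powr \<alpha> * \<mu>"
  proof -
    have "(LINT x|lborel. W (f x)) \<le> (LINT x|lborel. indicator {0..\<mu>} x * (M * (R * T) powr \<alpha>))"
    proof (rule integral_mono)
      have "\<bar>f x\<bar> \<le> R * T" for x using T(2)[of "x / \<mu>"] R(1) by (simp add: f_def abs_mult)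
      then show "integrable lborel (\<lambda>x. W (f x))" by (rule W_integrable[OF sobolev2D(1)[OF sf]])
      show "integrable lborel (\<lambda>x. indicator {0..\<mu>} x * (M * (R * T) powr \<alpha>))"
        by (intro integrable_mult_left integrable_real_indicator) (auto simp: emeasure_lborel_Icc_eq)
      fix x show "W (f x) \<le> indicator {0..\<mu>} x * (M * (R * T) powr \<alpha>)"
      proof (cases "x \<in> {0..\<mu>}")
        case True
        have f0: "0 \<le> f x" using R(1) mollifier(2) by (simp add: f_def)
        have "f x \<le> R * T" using T(2)[of "x / \<mu>"] R(1) unfolding f_def by (intro mult_left_mono) auto
        then have "f x powr \<alpha> \<le> (R * T) powr \<alpha>" using f0 \<alpha> by (intro powr_mono2) auto
        then have "M * \<bar>f x\<bar> powr \<alpha> \<le> M * (R * T) powr \<alpha>" using f0 M by simp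
        then show ?thesis using Wup[OF f0] True by simp
      next
        case False
        then have "x / \<mu> \<notin> {0<..<1}" using \<mu>1 by (auto simp: field_simps)
        then have "f x = 0" using mollifier(4) by (simp add: f_def)
        then show ?thesis using W_0 False by simp
      qed
    qed
    also have "\<dots> = M * (R * T) powr \<alpha> * \<mu>" using \<mu>1 by simp
    finally show ?thesis .
  qed
  have Rp: "(R * T) powr \<alpha> = R\<^sup>2 * (R powr (\<alpha> - 2) * T powr \<alpha>)"
  proof -
    have "R powr \<alpha> = R powr 2 * R powr (\<alpha> - 2)" by (simp add: powr_add[symmetric])
    then show ?thesis using R(1) T(1) by (simp add: powr_mult powr_numeral)
  qed
  have "energy W (f, v) \<le> R\<^sup>2 / \<mu> * (1/2 * (m\<^sup>2 * A) + 1/2 * B / \<mu>\<^sup>2 + M * T powr \<alpha> * \<mu>\<^sup>2 * R powr (\<alpha> - 2))"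
    unfolding energy_rep[OF rp] using Wint \<mu>1 unfolding snd_conv nv n1 n2 Rp
    by (simp add: field_simps power2_eq_square power3_eq_cube)
  also have "\<dots> < R\<^sup>2 / \<mu> * (m\<^sup>2 * A)"
  proof (rule mult_strict_left_mono)
    have "1/2 * B / \<mu>\<^sup>2 < 1/4 * (m\<^sup>2 * A)" using \<mu>B \<mu>1 by (simp add: pos_divide_less_eq)
    then show "1/2 * (m\<^sup>2 * A) + 1/2 * B / \<mu>\<^sup>2 + M * T powr \<alpha> * \<mu>\<^sup>2 * R powr (\<alpha> - 2) < m\<^sup>2 * A" using R(2) by linarith
    show "0 < R\<^sup>2 / \<mu>" using R(1) \<mu>1 by simp
  qed
  also have "\<dots> = m * \<bar>momentum (f, v)\<bar>"
    unfolding mom using m A \<mu>1 by (simp add: abs_mult power2_eq_square)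
  finally have "energy W (f, v) < m * \<bar>momentum (f, v)\<bar>" .
  moreover have "momentum (f, v) \<noteq> 0" unfolding mom using m A R(1) \<mu>1 by simp
  ultimately show ?thesis using rep_X[OF rp] by blast
qed

section \<open>Minimizers and solitons\<close>


definition J :: "real \<Rightarrow> state \<Rightarrow> real" where
  "J \<delta> p = energy W p / \<bar>momentum p\<bar> + \<delta> * energy W p"

text \<open>Because of \<open>x / 0 = 0\<close>, \<open>J\<close> would be
  \<open>\<delta> * E\<close> at zero momentum and the zero state would win; such states are
  excluded explicitly.\<close>

definition J_minimizer :: "real \<Rightarrow> state \<Rightarrow> bool" where
  "J_minimizer \<delta> u \<longleftrightarrow> u \<in> X \<and> momentum u \<noteq> 0 \<and> (\<forall>q\<in>X. momentum q \<noteq> 0 \<longrightarrow> J \<delta> u \<le> J \<delta> q)"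

text \<open>The form without division also makes sense at zero momentum, where it says
  \<open>0 \<le> E\<close>. So the pieces of a split state need no case distinction.\<close>

lemma J_lower_bound_iff:
  assumes "momentum q \<noteq> 0" shows "j \<le> J \<delta> q \<longleftrightarrow> (j - \<delta> * energy W q) * \<bar>momentum q\<bar> \<le> energy W q"
proof -
  have "j \<le> J \<delta> q \<longleftrightarrow> j - \<delta> * energy W q \<le> energy W q / \<bar>momentum q\<bar>" unfolding J_def by linarith
  also have "\<dots> \<longleftrightarrow> (j - \<delta> * energy W q) * \<bar>momentum q\<bar> \<le> energy W q"
    using assms by (intro pos_le_divide_eq) simp
  finally show ?thesis .
qed

text \<open>Energy and momentum are translation invariant and continuous on \<open>X\<close>, so the
  limit inherits the values \<open>e0\<close> and \<open>p0\<close>. This is used for existence, and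
  again for compactness and stability of the minimizing set.\<close>

lemma minimizing_sequence_compact:
  assumes \<delta>: "0 < \<delta>" and j: "\<And>q. q \<in> X \<Longrightarrow> momentum q \<noteq> 0 \<Longrightarrow> j \<le> J \<delta> q" and jm: "j < min 1 (2 * \<eta>)"
    and p: "\<And>n. p n \<in> X" and E: "(\<lambda>n. energy W (p n)) \<longlonglongrightarrow> e0" and C: "(\<lambda>n. momentum (p n)) \<longlonglongrightarrow> p0"
    and p0: "p0 \<noteq> 0" and e0: "e0 / \<bar>p0\<bar> + \<delta> * e0 = j"
  shows "\<exists>\<tau>::nat \<Rightarrow> real. \<exists>r l. strict_mono r \<and> l \<in> X \<and> energy W l = e0 \<and> momentum l = p0 \<and>
    (\<lambda>n. Xdist (shift (\<tau> (r n)) (p (r n))) l) \<longlonglongrightarrow> 0"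
proof -
  have j': "(j - \<delta> * energy W q) * \<bar>momentum q\<bar> \<le> energy W q" if "q \<in> X" for q
    using j[OF that] J_lower_bound_iff[of q j \<delta>] energy_nonneg[OF that] by (cases "momentum q = 0") auto
  have e0_nonneg: "0 \<le> e0" by (rule LIMSEQ_le_const[OF E]) (use energy_nonneg p in auto)
  have "j - \<delta> * e0 = e0 / \<bar>p0\<bar>" using e0 by linarith
  then have eq: "e0 = (j - \<delta> * e0) * \<bar>p0\<bar>" using p0 by simp
  have "0 \<le> \<delta> * e0" using \<delta> e0_nonneg by simp
  then have lt: "j - \<delta> * e0 < min 1 (2 * \<eta>)" using jm by linarith
  obtain \<tau> :: "nat \<Rightarrow> real" and r l where l: "strict_mono r" "l \<in> X" "(\<lambda>n. Xdist (shift (\<tau> (r n)) (p (r n))) l) \<longlonglongrightarrow> 0"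
    using compactness_mod_translations[OF p E C p0 \<delta> j' eq lt] by blast
  have "(\<lambda>n. energy W (shift (\<tau> (r n)) (p (r n)))) \<longlonglongrightarrow> energy W l" "(\<lambda>n. momentum (shift (\<tau> (r n)) (p (r n)))) \<longlonglongrightarrow> momentum l"
    using energy_momentum_continuous[of "\<lambda>n. shift (\<tau> (r n)) (p (r n))", OF shift_X[OF p] l(2,3)] by auto
  then have "(\<lambda>n. energy W (p (r n))) \<longlonglongrightarrow> energy W l" "(\<lambda>n. momentum (p (r n))) \<longlonglongrightarrow> momentum l"
    by (simp_all add: energy_shift[OF p] momentum_shift[OF p])
  moreover have "(\<lambda>n. energy W (p (r n))) \<longlonglongrightarrow> e0" "(\<lambda>n. momentum (p (r n))) \<longlonglongrightarrow> p0"
    using LIMSEQ_subseq_LIMSEQ[OF E l(1)] LIMSEQ_subseq_LIMSEQ[OF C l(1)] by (simp_all add: o_def)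
  ultimately have "energy W l = e0" "momentum l = p0" using LIMSEQ_unique by blast+
  then show ?thesis using l by blast
qed

text \<open>The pairs of energy and momentum stay in a compact set:
  \<open>\<delta> * E \<le> J\<close> bounds the energy, coercivity then bounds the momentum, and
  \<open>energy_lower_bound\<close> keeps the momentum away from zero. So \<open>J\<close> passes to
  the limit along a subsequence.\<close>

lemma J_minimizer_exists:
  assumes \<delta>: "0 < \<delta>" and w: "w \<in> X" "momentum w \<noteq> 0" "J \<delta> w < min 1 (2 * \<eta>)"
  shows "\<exists>u. J_minimizer \<delta> u"
proof -
  define A where "A = J \<delta> ` {q\<in>X. momentum q \<noteq> 0}"
  define j where "j = Inf A"
  have J_ge: "energy W q / \<bar>momentum q\<bar> \<le> J \<delta> q" "\<delta> * energy W q \<le> J \<delta> q" "0 \<le> J \<delta> q" if "q \<in> X" for q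
    using energy_nonneg[OF that] \<delta> by (auto simp: J_def)
  have bdd: "bdd_below A" unfolding A_def by (rule bdd_belowI[of _ 0]) (use J_ge in auto)
  have j: "j \<le> J \<delta> q" if "q \<in> X" "momentum q \<noteq> 0" for q
    unfolding j_def by (rule cInf_lower[OF _ bdd]) (use that in \<open>auto simp: A_def\<close>)
  have jm: "j < min 1 (2 * \<eta>)" using j[OF w(1,2)] w(3) by linarith
  \<comment> \<open>The tolerance tends to zero and, for every \<open>n\<close>, keeps
    \<open>J\<close> below the threshold.\<close>
  have "\<exists>q\<in>X. momentum q \<noteq> 0 \<and> J \<delta> q < j + min (min 1 (2 * \<eta>) - j) (inverse (real (Suc n)))" for n
  proof -
    have "\<exists>a\<in>A. a < j + min (min 1 (2 * \<eta>) - j) (inverse (real (Suc n)))"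
    proof (rule cInf_lessD)
      show "A \<noteq> {}" using w(1,2) unfolding A_def by blast
      show "Inf A < j + min (min 1 (2 * \<eta>) - j) (inverse (real (Suc n)))" using jm by (simp add: j_def[symmetric])
    qed
    then show ?thesis by (auto simp: A_def)
  qed
  then obtain p where p: "\<And>n. p n \<in> X" "\<And>n. momentum (p n) \<noteq> 0"
    and pJ: "\<And>n. J \<delta> (p n) < j + min (min 1 (2 * \<eta>) - j) (inverse (real (Suc n)))" by metis
  have pm: "J \<delta> (p n) < min 1 (2 * \<eta>)" for n using pJ[of n] by linarith
  have Jlim: "(\<lambda>n. J \<delta> (p n)) \<longlonglongrightarrow> j"
  proof (rule tendsto_sandwich)
    show "\<forall>\<^sub>F n in sequentially. j \<le> J \<delta> (p n)" by (intro always_eventually allI j p)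
    show "\<forall>\<^sub>F n in sequentially. J \<delta> (p n) \<le> j + inverse (real (Suc n))"
    proof (intro always_eventually allI)
      fix n show "J \<delta> (p n) \<le> j + inverse (real (Suc n))" using pJ[of n] by linarith
    qed
    show "(\<lambda>n. j + inverse (real (Suc n))) \<longlonglongrightarrow> j"
      using tendsto_add[OF tendsto_const[of j] LIMSEQ_inverse_real_of_nat] by simp
  qed simp
  \<comment> \<open>From \<open>\<delta> * E \<le> J\<close> and
    \<open>J < min 1 (2 * \<eta>) \<le> 1\<close>.\<close>
  define M where "M = 1 / \<delta>"
  have EM: "energy W (p n) \<le> M" for n
    using J_ge(2)[OF p(1), of n] pm[of n] \<delta> by (simp add: M_def field_simps)
  obtain S where S: "\<And>q. q \<in> X \<Longrightarrow> energy W q \<le> M \<Longrightarrow> Xnorm q \<le> S" using energy_coercive by blast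
  have pS: "Xnorm (p n) \<le> S" for n by (rule S[OF p(1) EM])
  have CM: "\<bar>momentum (p n)\<bar> \<le> S\<^sup>2" for n
    using momentum_bound[OF p(1), of n] power_mono[OF pS Xnorm_nonneg, of n 2] by linarith
  have Elt: "energy W (p n) < min 1 (2 * \<eta>) * \<bar>momentum (p n)\<bar>" for n
  proof -
    have "energy W (p n) / \<bar>momentum (p n)\<bar> < min 1 (2 * \<eta>)" using J_ge(1)[OF p(1), of n] pm[of n] by linarith
    moreover have "0 < \<bar>momentum (p n)\<bar>" using p(2)[of n] by simp
    ultimately show ?thesis by (simp only: pos_divide_less_eq)
  qed
  obtain c where c: "0 < c" "\<And>p. p \<in> X \<Longrightarrow> Xnorm p \<le> S \<Longrightarrow> energy W p < min 1 (2 * \<eta>) * \<bar>momentum p\<bar> \<Longrightarrow> c \<le> energy W p"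
    using energy_lower_bound[of S] by blast
  have cE: "c \<le> energy W (p n)" for n by (rule c(2)[OF p(1) pS Elt])
  have cC: "c \<le> \<bar>momentum (p n)\<bar>" for n
  proof -
    have "min 1 (2 * \<eta>) * \<bar>momentum (p n)\<bar> \<le> 1 * \<bar>momentum (p n)\<bar>" by (rule mult_right_mono) auto
    then show ?thesis using Elt[of n] cE[of n] by linarith
  qed
  have "(energy W (p n), momentum (p n)) \<in> {0..M} \<times> {- S\<^sup>2..S\<^sup>2}" for n
    using EM[of n] energy_nonneg[OF p(1), of n] CM[of n] by auto
  moreover have "compact ({0..M} \<times> {- S\<^sup>2..S\<^sup>2})" by (intro compact_Times compact_Icc)
  ultimately obtain e0 p0 r where r: "strict_mono (r :: nat \<Rightarrow> nat)"
    "((\<lambda>n. (energy W (p n), momentum (p n))) \<circ> r) \<longlonglongrightarrow> (e0, p0)"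
    unfolding compact_def by (metis (no_types, lifting) surj_pair)
  have E: "(\<lambda>n. energy W (p (r n))) \<longlonglongrightarrow> e0" and C: "(\<lambda>n. momentum (p (r n))) \<longlonglongrightarrow> p0"
    using tendsto_fst[OF r(2)] tendsto_snd[OF r(2)] by (simp_all add: o_def)
  have "c \<le> \<bar>p0\<bar>" by (rule LIMSEQ_le_const[OF tendsto_rabs[OF C]]) (use cC in auto)
  then have p0: "p0 \<noteq> 0" using c(1) by auto
  have "(\<lambda>n. J \<delta> (p (r n))) \<longlonglongrightarrow> e0 / \<bar>p0\<bar> + \<delta> * e0"
    unfolding J_def using p0 by (intro tendsto_intros E C) auto
  moreover have "(\<lambda>n. J \<delta> (p (r n))) \<longlonglongrightarrow> j" using LIMSEQ_subseq_LIMSEQ[OF Jlim r(1)] by (simp add: o_def)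
  ultimately have ej: "e0 / \<bar>p0\<bar> + \<delta> * e0 = j" by (rule LIMSEQ_unique)
  obtain u where u: "u \<in> X" "energy W u = e0" "momentum u = p0"
    using minimizing_sequence_compact[OF \<delta> j jm p(1) E C p0 ej] by blast
  then have "J \<delta> u = j" using ej by (simp add: J_def)
  then show ?thesis using u p0 j unfolding J_minimizer_def by (intro exI[of _ u]) auto
qed

text \<open>Stationarity of \<open>J \<delta>\<close> along the scaling \<open>v \<mapsto> s v\<close>; it recovers \<open>\<delta>\<close> from the minimizer.\<close>
lemma J_minimizer_delta:
  assumes "J_minimizer \<delta> u"
  shows "0 < (nrm (snd u))\<^sup>2"
    "\<delta> * (\<bar>momentum u\<bar> * (nrm (snd u))\<^sup>2) = energy W u - (nrm (snd u))\<^sup>2"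
proof -
  have u: "u \<in> X" "momentum u \<noteq> 0" "\<And>q. q \<in> X \<Longrightarrow> momentum q \<noteq> 0 \<Longrightarrow> J \<delta> u \<le> J \<delta> q"
    using assms by (auto simp: J_minimizer_def)
  obtain f f1 f2 where f: "rep u f f1 f2" using X_rep[OF u(1)] by metis
  define A where "A = (nrm (snd u))\<^sup>2"
  define B where "B = energy W u - 1/2 * A"
  define C where "C = \<bar>momentum u\<bar>"
  have C: "0 < C" using u(2) by (simp add: C_def)
  show "0 < (nrm (snd u))\<^sup>2"
  proof (rule ccontr)
    assume "\<not> 0 < (nrm (snd u))\<^sup>2"
    then have "nrm (snd u) = 0" by simp
    then have "momentum u = 0"
      using L2_Cauchy_Schwarz[OF repD(2)[OF f] sobolev2D(2)[OF repD(1)[OF f]]] by (simp add: momentum_rep[OF f])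
    then show False using u(2) by simp
  qed
  \<comment> \<open>\<open>J\<close> along the scaling: the kinetic part is quadratic in
    \<open>s\<close>, the momentum linear, and \<open>B\<close> collects the terms without
    velocity.\<close>
  define \<phi> where "\<phi> s = (1/2 * (s\<^sup>2 * A) + B) / (s * C) + \<delta> * (1/2 * (s\<^sup>2 * A) + B)" for s
  have J\<phi>: "J \<delta> (fst u, \<lambda>x. s * snd u x) = \<phi> s \<and> (fst u, \<lambda>x. s * snd u x) \<in> X \<and> momentum (fst u, \<lambda>x. s * snd u x) \<noteq> 0"
    if s: "0 < s" for s
  proof -
    have rs: "rep (fst u, \<lambda>x. s * snd u x) f f1 f2"
      using f L2_cmult[OF repD(2)[OF f], of s] by (simp add: rep_def)
    have m: "momentum (fst u, \<lambda>x. s * snd u x) = s * momentum u"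
      unfolding momentum_rep[OF rs] momentum_rep[OF f] by (simp add: mult.assoc)
    have e: "energy W (fst u, \<lambda>x. s * snd u x) = 1/2 * (s\<^sup>2 * A) + B"
      unfolding energy_rep[OF rs] B_def energy_rep[OF f] A_def by (simp add: nrm_cmult power_mult_distrib algebra_simps)
    show ?thesis using s u(2) rep_X[OF rs] by (simp add: J_def m e \<phi>_def abs_mult C_def)
  qed
  have "\<phi> 1 = J \<delta> u" by (simp add: \<phi>_def J_def B_def C_def)
  then have min: "\<phi> 1 \<le> \<phi> s" if "0 < s" for s using J\<phi>[OF that] u(3) by metis
  have "(\<phi> has_real_derivative (1/2 * A - B) / C + \<delta> * A) (at 1)"
    unfolding \<phi>_def using C by (auto intro!: derivative_eq_intros simp: field_simps power2_eq_square)
  then have "(1/2 * A - B) / C + \<delta> * A = 0"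
    by (rule DERIV_local_min[of _ _ _ 1]) (use min in \<open>auto simp: abs_if split: if_splits\<close>)
  then have "\<delta> * (C * A) = B - 1/2 * A" using C by (simp add: field_simps)
  then show "\<delta> * (\<bar>momentum u\<bar> * (nrm (snd u))\<^sup>2) = energy W u - (nrm (snd u))\<^sup>2"
    by (simp add: A_def[symmetric] C_def[symmetric] B_def)
qed

text \<open>Energy, momentum and the norm of the velocity do not change under translations or on
  null sets, and they determine \<open>\<delta>\<close>, since its coefficient
  \<open>\<bar>C\<bar> * (nrm v)^2\<close> in the stationarity relation is positive.\<close>

lemma J_minimizer_distinct:
  assumes "J_minimizer \<delta>1 u1" "J_minimizer \<delta>2 u2" "Xeq u1 (shift \<tau> u2)"
  shows "\<delta>1 = \<delta>2"
proof -
  have X: "u1 \<in> X" "u2 \<in> X" and m: "momentum u1 \<noteq> 0" using assms by (auto simp: J_minimizer_def)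
  obtain f f1 f2 where f: "rep (shift \<tau> u2) f f1 f2" using X_rep[OF shift_X[OF X(2)]] by metis
  have L1: "L2 (snd u1)" "fst u1 \<in> borel_measurable borel"
    using X(1) by (auto simp: X_def H2_def L2_def)
  have ae: "AE x in lborel. fst u1 x = fst (shift \<tau> u2) x" "AE x in lborel. snd u1 x = snd (shift \<tau> u2) x"
    using assms(3) by (auto simp: Xeq_def)
  have r1: "rep u1 f f1 f2"
    unfolding rep_def
  proof (intro conjI repD(1)[OF f] L1)
    show "AE x in lborel. fst u1 x = f x" using ae(1) repD(4)[OF f] by eventually_elim simp
  qed
  note [measurable] = rep_measurable[OF r1] rep_measurable[OF f]
  have nv: "nrm (snd u1) = nrm (snd u2)"
    using nrm_cong_AE[OF rep_measurable(5)[OF r1] rep_measurable(5)[OF f] ae(2)] nrm_shift[of "snd u2" \<tau>] by (simp add: shift_def)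
  have "energy W u1 = energy W (shift \<tau> u2)"
    unfolding energy_rep[OF r1] energy_rep[OF f] using nrm_cong_AE[OF rep_measurable(5)[OF r1] rep_measurable(5)[OF f] ae(2)] by simp
  then have e: "energy W u1 = energy W u2" by (simp add: energy_shift[OF X(2)])
  have "(LINT x|lborel. snd u1 x * f1 x) = (LINT x|lborel. snd (shift \<tau> u2) x * f1 x)"
    by (rule integral_cong_AE) (use ae(2) in auto)
  then have "momentum u1 = momentum (shift \<tau> u2)" unfolding momentum_rep[OF r1] momentum_rep[OF f] by simp
  then have mm: "momentum u1 = momentum u2" by (simp add: momentum_shift[OF X(2)])
  have "\<delta>1 * (\<bar>momentum u1\<bar> * (nrm (snd u1))\<^sup>2) = \<delta>2 * (\<bar>momentum u1\<bar> * (nrm (snd u1))\<^sup>2)"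
    using J_minimizer_delta(2)[OF assms(1)] J_minimizer_delta(2)[OF assms(2)] unfolding nv e mm by simp
  then show ?thesis using m J_minimizer_delta(1)[OF assms(1)] by simp
qed

text \<open>Stability is shown by contradiction: if starting points approach \<open>\<Gamma>\<close>
  but evolve to a distance above \<open>\<epsilon>\<close>, conservation gives the evolved states
  energies and momenta tending to \<open>e0\<close> and \<open>p0\<close>. They are then compact up
  to translations with limit in \<open>\<Gamma>\<close>, and \<open>\<Gamma>\<close> is translation
  invariant.\<close>

lemma J_minimizer_hylomorphic:
  assumes \<delta>: "0 < \<delta>" and u: "J_minimizer \<delta> u" and jm: "J \<delta> u < min 1 (2 * \<eta>)" and flow: "beam_dyn_system W \<gamma>"
  shows "hylomorphic_soliton W \<gamma> u"
proof -
  define e0 where "e0 = energy W u"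
  define p0 where "p0 = momentum u"
  define \<Gamma> where "\<Gamma> = {w\<in>X. energy W w = e0 \<and> momentum w = p0}"
  have uX: "u \<in> X" and p0: "p0 \<noteq> 0" and j: "\<And>q. q \<in> X \<Longrightarrow> momentum q \<noteq> 0 \<Longrightarrow> J \<delta> u \<le> J \<delta> q"
    using u by (auto simp: J_minimizer_def p0_def)
  have ej: "e0 / \<bar>p0\<bar> + \<delta> * e0 = J \<delta> u" by (simp add: J_def e0_def p0_def)
  have uG: "u \<in> \<Gamma>" using uX by (simp add: \<Gamma>_def e0_def p0_def)
  have GX: "\<Gamma> \<subseteq> X" by (auto simp: \<Gamma>_def)
  have \<gamma>X: "\<gamma> t p \<in> X" and \<gamma>E: "energy W (\<gamma> t p) = energy W p" and \<gamma>C: "momentum (\<gamma> t p) = momentum p"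
    if "p \<in> X" for t p
    using flow that unfolding beam_dyn_system_def by blast+
  \<comment> \<open>At fixed momentum \<open>J\<close> is a positive constant times
    \<open>E\<close>.\<close>
  have mini: "e0 \<le> energy W w" if "w \<in> X" "momentum w = p0" for w
  proof -
    have "J \<delta> u \<le> J \<delta> w" using j that p0 by auto
    then have "e0 * (1 / \<bar>p0\<bar> + \<delta>) \<le> energy W w * (1 / \<bar>p0\<bar> + \<delta>)"
      unfolding J_def that(2) e0_def[symmetric] p0_def[symmetric] by (simp add: algebra_simps)
    moreover have "0 < 1 / \<bar>p0\<bar> + \<delta>" using \<delta> p0 by (intro add_pos_pos) auto
    ultimately show ?thesis by (rule mult_right_le_imp_le)
  qed
  have comp: "\<exists>\<tau>::nat \<Rightarrow> real. \<exists>r l. strict_mono r \<and> l \<in> X \<and> energy W l = e0 \<and> momentum l = p0 \<and>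
      (\<lambda>n. Xdist (shift (\<tau> (r n)) (p (r n))) l) \<longlonglongrightarrow> 0"
    if "\<And>n. p n \<in> X" "(\<lambda>n. energy W (p n)) \<longlonglongrightarrow> e0" "(\<lambda>n. momentum (p n)) \<longlonglongrightarrow> p0" for p
    using minimizing_sequence_compact[OF \<delta> j jm that p0 ej] by blast
  have shG: "shift \<tau> w \<in> \<Gamma>" if "w \<in> \<Gamma>" for \<tau> w
    using that shift_X energy_shift momentum_shift by (auto simp: \<Gamma>_def)
  have inv: "invariant_set \<gamma> \<Gamma>"
    unfolding invariant_set_def by (auto simp: \<Gamma>_def \<gamma>X \<gamma>E \<gamma>C)
  have gc: "G_compact \<Gamma>"
    unfolding G_compact_def X_closed_def
  proof (intro conjI allI impI)
    show "\<Gamma> \<subseteq> X" by (rule GX)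
    fix s l assume s: "\<forall>n. s n \<in> \<Gamma>" and l: "l \<in> X" "(\<lambda>n. Xdist (s n) l) \<longlonglongrightarrow> 0"
    have sX: "s n \<in> X" "energy W (s n) = e0" "momentum (s n) = p0" for n using s by (auto simp: \<Gamma>_def)
    from energy_momentum_continuous[OF sX(1) l] show "l \<in> \<Gamma>"
      using l(1) by (simp add: \<Gamma>_def sX(2,3) LIMSEQ_const_iff)
  next
    show "shift \<tau> ` \<Gamma> \<subseteq> \<Gamma>" for \<tau> using shG by auto
  next
    fix s :: "nat \<Rightarrow> state" assume s: "\<forall>n. s n \<in> \<Gamma>"
    have sX: "s n \<in> X" "energy W (s n) = e0" "momentum (s n) = p0" for n using s by (auto simp: \<Gamma>_def)
    have "(\<lambda>n. energy W (s n)) \<longlonglongrightarrow> e0" "(\<lambda>n. momentum (s n)) \<longlonglongrightarrow> p0" by (simp_all add: sX(2,3))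
    from comp[OF sX(1) this] show "\<exists>\<tau>::nat \<Rightarrow> real. \<exists>r l. strict_mono r \<and> l \<in> X \<and>
            (\<lambda>n. Xdist (shift (\<tau> (r n)) (s (r n))) l) \<longlonglongrightarrow> 0" by blast
  qed
  have Xd: "Xdist_set p \<Gamma> \<le> Xdist p w" if "w \<in> \<Gamma>" for p w
    unfolding Xdist_set_def
    by (rule cINF_lower[OF _ that]) (auto intro!: bdd_belowI2[of _ 0] Xdist_nonneg)
  have st: "stable_set \<gamma> \<Gamma>"
    unfolding stable_set_def
  proof (intro allI impI, rule ccontr)
    fix \<epsilon> :: real assume \<epsilon>: "0 < \<epsilon>"
    assume neg: "\<not> (\<exists>d>0. \<forall>p\<in>X. Xdist_set p \<Gamma> \<le> d \<longrightarrow> (\<forall>t\<ge>0. Xdist_set (\<gamma> t p) \<Gamma> \<le> \<epsilon>))"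
    have "\<exists>p\<in>X. \<exists>t. Xdist_set p \<Gamma> \<le> inverse (real (Suc n)) \<and> \<epsilon> < Xdist_set (\<gamma> t p) \<Gamma>" for n
    proof (rule ccontr)
      assume "\<not> ?thesis"
      then have "\<forall>p\<in>X. Xdist_set p \<Gamma> \<le> inverse (real (Suc n)) \<longrightarrow> (\<forall>t\<ge>0. Xdist_set (\<gamma> t p) \<Gamma> \<le> \<epsilon>)"
        by (meson not_le)
      moreover have "0 < inverse (real (Suc n))" by simp
      ultimately show False using neg by blast
    qed
    then obtain p t where p: "\<And>n. p n \<in> X" "\<And>n. Xdist_set (p n) \<Gamma> \<le> inverse (real (Suc n))"
      "\<And>n. \<epsilon> < Xdist_set (\<gamma> (t n) (p n)) \<Gamma>" by metis
    \<comment> \<open>The infimum may fail to be attained, hence the factor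
      \<open>2\<close>.\<close>
    have "\<exists>w\<in>\<Gamma>. Xdist (p n) w < 2 * inverse (real (Suc n))" for n
    proof -
      have "Inf (Xdist (p n) ` \<Gamma>) < 2 * inverse (real (Suc n))"
      proof -
        have "0 < inverse (real (Suc n))" by simp
        then show ?thesis using p(2)[of n] unfolding Xdist_set_def by linarith
      qed
      then have "\<exists>a\<in>Xdist (p n) ` \<Gamma>. a < 2 * inverse (real (Suc n))"
        by (intro cInf_lessD) (use uG in auto)
      then show ?thesis by blast
    qed
    then obtain w where w: "\<And>n. w n \<in> \<Gamma>" "\<And>n. Xdist (p n) (w n) < 2 * inverse (real (Suc n))" by metis
    have wX: "w n \<in> X" "energy W (w n) = e0" "momentum (w n) = p0" for n using w(1)[of n] by (auto simp: \<Gamma>_def)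
    obtain S where S: "\<And>q. q \<in> X \<Longrightarrow> energy W q \<le> e0 \<Longrightarrow> Xnorm q \<le> S" using energy_coercive by blast
    have d0: "(\<lambda>n. Xdist (p n) (w n)) \<longlonglongrightarrow> 0"
    proof (rule tendsto_sandwich[OF _ _ tendsto_const tendsto_mult_right_zero[OF LIMSEQ_inverse_real_of_nat, of 2]])
      show "\<forall>\<^sub>F n in sequentially. 0 \<le> Xdist (p n) (w n)" by (simp add: Xdist_nonneg)
      show "\<forall>\<^sub>F n in sequentially. Xdist (p n) (w n) \<le> 2 * inverse (real (Suc n))"
        by (intro always_eventually allI less_imp_le w(2))
    qed
    have wS: "Xnorm (w n) \<le> S" for n by (rule S) (use wX in auto)
    note lim = energy_momentum_tendsto[OF p(1) wX(1) wS d0]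
    define q where "q n = \<gamma> (t n) (p n)" for n
    have qX: "q n \<in> X" for n unfolding q_def by (rule \<gamma>X[OF p(1)])
    have E: "(\<lambda>n. energy W (q n)) \<longlonglongrightarrow> e0" and C: "(\<lambda>n. momentum (q n)) \<longlonglongrightarrow> p0"
      using lim unfolding q_def wX(2,3) by (auto simp: \<gamma>E[OF p(1)] \<gamma>C[OF p(1)] intro: LIM_zero_cancel)
    obtain \<tau> :: "nat \<Rightarrow> real" and r l where l: "strict_mono r" "l \<in> X" "energy W l = e0" "momentum l = p0"
      "(\<lambda>n. Xdist (shift (\<tau> (r n)) (q (r n))) l) \<longlonglongrightarrow> 0"
      using comp[OF qX E C] by blast
    have lG: "l \<in> \<Gamma>" using l by (simp add: \<Gamma>_def)
    \<comment> \<open>Undoing the shift turns the distance to \<open>l\<close> into the distance to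
      a translate of \<open>l\<close>, again a point of \<open>\<Gamma>\<close>.\<close>
    have ge: "\<epsilon> \<le> Xdist (shift (\<tau> (r n)) (q (r n))) l" for n
    proof -
      have cancel: "shift (\<tau> (r n)) (shift (- \<tau> (r n)) l) = l" by (simp add: shift_def)
      have "Xdist (shift (\<tau> (r n)) (q (r n))) l = Xdist (q (r n)) (shift (- \<tau> (r n)) l)"
        using Xdist_shift[OF qX shift_X[OF l(2)], of "\<tau> (r n)" "r n" "- \<tau> (r n)"] unfolding cancel by simp
      then show ?thesis using Xd[OF shG[OF lG], of "q (r n)" "- \<tau> (r n)"] p(3)[of "r n"] unfolding q_def by linarith
    qed
    have "\<epsilon> \<le> 0" by (rule LIMSEQ_le_const[OF l(5)]) (use ge in auto)
    then show False using \<epsilon> by simp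
  qed
  have sw: "soliton_with \<gamma> \<Gamma> u"
    unfolding soliton_with_def using uX inv st gc uG by (auto simp: invariant_set_def)
  have "\<exists>w\<in>X. momentum w = p0 \<and> energy W w = e0" using uX by (auto simp: e0_def p0_def)
  then show ?thesis
    unfolding hylomorphic_soliton_def soliton_def using sw mini unfolding \<Gamma>_def by blast
qed

end

theorem theorem2:
  fixes W :: "real \<Rightarrow> real" and \<gamma> :: "real \<Rightarrow> state \<Rightarrow> state"
  assumes C1: "\<forall>s. W differentiable (at s)" "continuous_on UNIV (deriv W)"
    and Wi: "\<exists>\<eta>>0. (\<forall>s. \<bar>s\<bar> \<le> 1 \<longrightarrow> W s \<ge> \<eta> * s\<^sup>2) \<and> (\<forall>s. \<bar>s\<bar> \<ge> 1 \<longrightarrow> W s \<ge> \<eta>)"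
    and Wii: "(deriv W has_real_derivative 1) (at 0)"
    and Wiii: "\<exists>M>0. \<exists>\<alpha>. 0 \<le> \<alpha> \<and> \<alpha> < 2 \<and> (\<forall>s\<ge>0. W s \<le> M * \<bar>s\<bar> powr \<alpha>)"
    and flow: "beam_dyn_system W \<gamma>"
  shows "\<exists>a b. a < b \<and> (\<exists>U :: real \<Rightarrow> state.
           (\<forall>\<delta>\<in>{a<..<b}. U \<delta> \<in> X \<and> hylomorphic_soliton W \<gamma> (U \<delta>)) \<and>
           (\<forall>\<delta>1\<in>{a<..<b}. \<forall>\<delta>2\<in>{a<..<b}. \<delta>1 \<noteq> \<delta>2 \<longrightarrow>
              (\<forall>\<tau>. \<not> Xeq (U \<delta>1) (shift \<tau> (U \<delta>2)))))"
proof -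
  obtain \<eta> where \<eta>: "0 < \<eta>" "\<And>s. \<bar>s\<bar> \<le> 1 \<Longrightarrow> \<eta> * s\<^sup>2 \<le> W s" "\<And>s. 1 \<le> \<bar>s\<bar> \<Longrightarrow> \<eta> \<le> W s"
    using Wi by blast
  obtain M \<alpha> where M: "0 < M" "0 \<le> \<alpha>" "\<alpha> < 2" "\<And>s. 0 \<le> s \<Longrightarrow> W s \<le> M * \<bar>s\<bar> powr \<alpha>"
    using Wiii by blast
  \<comment> \<open>(W-i) gives \<open>0 \<le> W 0\<close>, and (W-iii) gives
    \<open>W 0 \<le> 0\<close> because \<open>0 powr \<alpha> = 0\<close>, for
    \<open>\<alpha> = 0\<close> too.\<close>
  have "W 0 = 0" using M(4)[of 0] \<eta>(2)[of 0] by simp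
  then interpret potential W \<eta>
    using C1 \<eta> Wii by unfold_locales auto
  define m where "m = min 1 (2 * \<eta>)"
  have m: "0 < m" using \<eta> by (simp add: m_def)
  obtain w where w: "w \<in> X" "momentum w \<noteq> 0" "energy W w < m * \<bar>momentum w\<bar>"
    using trial_state[OF M m] by blast
  \<comment> \<open>For \<open>\<delta> < b\<close> the penalty \<open>\<delta> * E\<close> of the
    one trial state \<open>w\<close> is smaller than its gap below the threshold; the summand
    \<open>1\<close> guards against zero energy.\<close>
  define b where "b = (m - energy W w / \<bar>momentum w\<bar>) / (energy W w + 1)"
  have E0: "0 \<le> energy W w" by (rule energy_nonneg[OF w(1)])
  have gap: "0 < m - energy W w / \<bar>momentum w\<bar>" using w(2,3) by (simp add: pos_divide_less_eq)
  have b: "0 < b" unfolding b_def using gap E0 by (intro divide_pos_pos) auto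
  have Jw: "J \<delta> w < m" if "\<delta> \<in> {0<..<b}" for \<delta>
  proof -
    have "\<delta> * energy W w \<le> \<delta> * (energy W w + 1)" using that by (intro mult_left_mono) auto
    also have "\<dots> < b * (energy W w + 1)" using that E0 by (intro mult_strict_right_mono) auto
    also have "\<dots> = m - energy W w / \<bar>momentum w\<bar>" unfolding b_def using E0 by simp
    finally show ?thesis unfolding J_def by linarith
  qed
  have "\<exists>u. J_minimizer \<delta> u" if "\<delta> \<in> {0<..<b}" for \<delta>
    using J_minimizer_exists[OF _ w(1,2), of \<delta>] Jw[OF that] that by (simp add: m_def)
  then obtain U where U: "\<And>\<delta>. \<delta> \<in> {0<..<b} \<Longrightarrow> J_minimizer \<delta> (U \<delta>)" by metis
  have "U \<delta> \<in> X \<and> hylomorphic_soliton W \<gamma> (U \<delta>)" if \<delta>: "\<delta> \<in> {0<..<b}" for \<delta>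
  proof
    show "U \<delta> \<in> X" using U[OF \<delta>] by (simp add: J_minimizer_def)
    have "J \<delta> (U \<delta>) \<le> J \<delta> w" using U[OF \<delta>] w by (simp add: J_minimizer_def)
    then have "J \<delta> (U \<delta>) < min 1 (2 * \<eta>)" using Jw[OF \<delta>] by (simp add: m_def)
    then show "hylomorphic_soliton W \<gamma> (U \<delta>)"
      using J_minimizer_hylomorphic[OF _ U[OF \<delta>] _ flow] \<delta> by simp
  qed
  moreover have "\<not> Xeq (U \<delta>1) (shift \<tau> (U \<delta>2))" if "\<delta>1 \<in> {0<..<b}" "\<delta>2 \<in> {0<..<b}" "\<delta>1 \<noteq> \<delta>2" for \<delta>1 \<delta>2 \<tau>
    using J_minimizer_distinct[OF U[OF that(1)] U[OF that(2)]] that(3) by blast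
  ultimately show ?thesis using b by (intro exI[of _ 0] exI[of _ b]) blast
qed

end
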